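(* Let $A\in\mathcal A(L)$ and $\Psi\in\Gamma(M,\mathrm{Hom}(E,S\otimes L))$ be a solution of $$D_{A\otimes B}\Psi=0\quad\text{and}\quad\mu(\Psi)=0.\qquad( * )$$ Denote $Z:=\Psi^{-1}(0)$. Then the following hold: (1) $F:=\mathrm{coim}(\Psi)=\ker(\Psi)^\perp$ is a rank $2$ subbundle of $E|_{M\setminus Z}$. (2) The line bundle $K:=\det F$ has a square root $K^{1/2}$. In particular, $\mathring F:=F\otimes K^{-1/2}$ is an $\mathrm{SU}(2)$-bundle. (3) The connection induced on $L|_{M\setminus Z}\otimes K^{-1/2}$ and the induced section $\Phi\in\Gamma(M\setminus Z,\mathrm{Hom}(\mathring F,S\otimes L\otimes K^{-1/2}))$ satisfy the equations $( * )$ over $M\setminus Z$ (with $(E,B)$ replaced by $\mathring F$ with its induced connection and $L$ replaced by $L\otimes K^{-1/2}$). We have $|\Phi|=|\Psi|$ over $M\setminus Z$ and, hence, $|\Phi|$ extends as a continuous function over $M$ and $Z=|\Phi|^{-1}(0)$. (4) The induced connection on $L\otimes K^{-1/2}$ (over $M\setminus Z$) is flat and has $\mathbf Z_2$-monodromy, i.e. its holonomies lie in $\{\pm1\}\subset\mathrm U(1)$.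
   Context: $M$ is an oriented, closed Riemannian three-manifold with a fixed Spin-structure; $S$ is the associated spinor bundle (Hermitian of rank $2$, with $\mathrm{SU}(2)$-structure) with Clifford multiplication $\gamma$. $L$ is a $\mathrm U(1)$-bundle over $M$ (identified with its Hermitian line bundle), $n\ge1$, and $E$ is an $\mathrm{SU}(n)$-bundle over $M$ (identified with its Hermitian rank $n$ vector bundle) with a connection $B$. $\mathcal A(L)$ is the space of connections on $L$. For $A\in\mathcal A(L)$, $\nabla_{A\otimes B}$ is the connection on $\mathrm{Hom}(E,S\otimes L)$ induced by the Levi-Civita spin connection, $A$ and $B$, and $D_{A\otimes B}=\sum_i\gamma(e_i)\nabla_{A\otimes B,e_i}$ is the Dirac operator. $\mu(\Psi)=\Psi\Psi^*-\frac12|\Psi|^2\mathrm{id}_S\in i\,\mathfrak{su}(S)$. The subbundle $F\subset E|_{M\setminus Z}$ carries the connection obtained by orthogonally projecting $B$; this induces connections on $K=\det F$, on $K^{\pm1/2}$, on $\mathring F$ and, together with $A$, on $L\otimes K^{-1/2}$. The induced section is $\Phi=\Psi|_F\otimes\mathrm{id}_{K^{-1/2}}$. *)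

theory Defs
  imports "HOL-Analysis.Analysis"
begin

section \<open>Smooth three-manifolds\<close>

text \<open>Used for open \<open>S\<close> and finite-dimensional domains only, where continuity of all iterated
  directional derivatives is the usual notion of \<open>C\<^sup>k\<close>.\<close>

primrec Ck_on :: "nat \<Rightarrow> 'a::euclidean_space set \<Rightarrow> ('a \<Rightarrow> 'b::real_normed_vector) \<Rightarrow> bool" where
  "Ck_on 0 S f \<longleftrightarrow> continuous_on S f"
| "Ck_on (Suc k) S f \<longleftrightarrow>
     (\<forall>x\<in>S. f differentiable (at x)) \<and> (\<forall>v. Ck_on k S (\<lambda>x. frechet_derivative f (at x) v))"

definition smooth_on :: "'a::euclidean_space set \<Rightarrow> ('a \<Rightarrow> 'b::real_normed_vector) \<Rightarrow> bool" where
  "smooth_on S f \<longleftrightarrow> (\<forall>k. Ck_on k S f)"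

type_synonym 'm chart = "'m set \<times> ('m \<Rightarrow> real^3)"

text \<open>An oriented Riemannian three-manifold with a Spin structure. The underlying set is the type
  \<open>'m\<close>. A local spin frame is a triple \<open>(U, s, e)\<close>, where \<open>e x\<close> has as columns an oriented orthonormal
  frame of the tangent space at \<open>x\<close> and \<open>s x\<close> is a lift of it to the Spin bundle, see
  \<open>spin_structure\<close>.\<close>

record 'm spin_manifold =
  atlas :: "'m chart set"
  metric :: "'m \<Rightarrow> real^3 \<Rightarrow> real^3 \<Rightarrow> real"
  spin_frames :: "('m set \<times> ('m \<Rightarrow> complex^2^2) \<times> ('m \<Rightarrow> real^3^3)) set"

definition oriented_atlas :: "'m::t2_space chart set \<Rightarrow> bool" where
  "oriented_atlas \<A> \<longleftrightarrow>
     (\<Union>(U, \<phi>)\<in>\<A>. U) = UNIV \<and>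
     (\<forall>(U, \<phi>)\<in>\<A>. open U \<and> open (\<phi> ` U) \<and> homeomorphism U (\<phi> ` U) \<phi> (inv_into U \<phi>)) \<and>
     (\<forall>(U, \<phi>)\<in>\<A>. \<forall>(V, \<psi>)\<in>\<A>. smooth_on (\<phi> ` (U \<inter> V)) (\<psi> \<circ> inv_into U \<phi>) \<and>
        (\<forall>p\<in>\<phi> ` (U \<inter> V). det (jacobian (\<psi> \<circ> inv_into U \<phi>) (at p)) > 0))"

text \<open>The tangent space at \<open>x\<close> is the type \<open>real^3\<close>: tangent vectors at \<open>x\<close> are represented by their
  components in the preferred chart at \<open>x\<close>. The choice of charts is not continuous in \<open>x\<close>; smoothness
  is always tested in a fixed chart. As the atlas is oriented, the orientation of the tangent
  space is the standard one of \<open>real^3\<close>.\<close>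

definition chart_at :: "'m spin_manifold \<Rightarrow> 'm \<Rightarrow> 'm chart" where
  "chart_at M x = (SOME c. c \<in> atlas M \<and> x \<in> fst c)"

text \<open>The derivative of \<open>f\<close> at \<open>x\<close> in the direction of the tangent vector \<open>v\<close>.\<close>

definition mderiv ::
  "'m spin_manifold \<Rightarrow> ('m \<Rightarrow> 'b::real_normed_vector) \<Rightarrow> 'm \<Rightarrow> real^3 \<Rightarrow> 'b" where
  "mderiv M f x v =
     (let (U, \<phi>) = chart_at M x in frechet_derivative (f \<circ> inv_into U \<phi>) (at (\<phi> x)) v)"

definition smooth_map ::
  "'m spin_manifold \<Rightarrow> 'm set \<Rightarrow> ('m \<Rightarrow> 'b::real_normed_vector) \<Rightarrow> bool" where
  "smooth_map M W f \<longleftrightarrow> (\<forall>(U, \<phi>)\<in>atlas M. smooth_on (\<phi> ` (W \<inter> U)) (f \<circ> inv_into U \<phi>))"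

text \<open>The tangent vector at \<open>y\<close> whose components in the chart \<open>c\<close> are \<open>v\<close>.\<close>

definition coord_vector :: "'m spin_manifold \<Rightarrow> 'm chart \<Rightarrow> 'm \<Rightarrow> real^3 \<Rightarrow> real^3" where
  "coord_vector M c y v =
     (let (U, \<phi>) = c in
      frechet_derivative (snd (chart_at M y) \<circ> inv_into U \<phi>) (at (\<phi> y)) v)"

definition smooth_vector_field :: "'m spin_manifold \<Rightarrow> 'm set \<Rightarrow> ('m \<Rightarrow> real^3) \<Rightarrow> bool" where
  "smooth_vector_field M W X \<longleftrightarrow>
     (\<forall>(U, \<phi>)\<in>atlas M. smooth_map M (W \<inter> U) (\<lambda>y. mderiv M \<phi> y (X y)))"

definition lie_bracket ::
  "'m spin_manifold \<Rightarrow> ('m \<Rightarrow> real^3) \<Rightarrow> ('m \<Rightarrow> real^3) \<Rightarrow> 'm \<Rightarrow> real^3" where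
  "lie_bracket M X Y x =
     (let \<phi> = snd (chart_at M x) in
      mderiv M (\<lambda>y. mderiv M \<phi> y (Y y)) x (X x) - mderiv M (\<lambda>y. mderiv M \<phi> y (X y)) x (Y x))"

definition riemannian_metric :: "'m spin_manifold \<Rightarrow> bool" where
  "riemannian_metric M \<longleftrightarrow>
     (\<forall>x. bilinear (metric M x) \<and> (\<forall>v w. metric M x v w = metric M x w v) \<and>
          (\<forall>v. v \<noteq> 0 \<longrightarrow> metric M x v v > 0)) \<and>
     (\<forall>(U, \<phi>)\<in>atlas M. \<forall>i j. smooth_map M U
        (\<lambda>y. metric M y (coord_vector M (U, \<phi>) y (axis i 1)) (coord_vector M (U, \<phi>) y (axis j 1))))"

text \<open>The Christoffel symbols of the preferred chart at \<open>x\<close>, at the point \<open>x\<close>.\<close>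

definition christoffel :: "'m spin_manifold \<Rightarrow> 'm \<Rightarrow> 3 \<Rightarrow> 3 \<Rightarrow> 3 \<Rightarrow> real" where
  "christoffel M x k i j =
     (let b = (\<lambda>i y. coord_vector M (chart_at M x) y (axis i 1));
          g = (\<lambda>y. \<chi> i j. metric M y (b i y) (b j y))
      in 1/2 * (\<Sum>l\<in>UNIV. matrix_inv (g x) $ k $ l *
           (mderiv M (\<lambda>y. g y $ j $ l) x (axis i 1) + mderiv M (\<lambda>y. g y $ i $ l) x (axis j 1)
            - mderiv M (\<lambda>y. g y $ i $ j) x (axis l 1))))"

text \<open>The covariant derivative of the vector field \<open>Y\<close> at \<open>x\<close> in the direction \<open>v\<close>.\<close>

definition levi_civita :: "'m spin_manifold \<Rightarrow> ('m \<Rightarrow> real^3) \<Rightarrow> 'm \<Rightarrow> real^3 \<Rightarrow> real^3" where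
  "levi_civita M Y x v =
     mderiv M (\<lambda>y. mderiv M (snd (chart_at M x)) y (Y y)) x v
     + (\<chi> k. \<Sum>i\<in>UNIV. \<Sum>j\<in>UNIV. christoffel M x k i j * v $ i * Y x $ j)"


section \<open>Hermitian linear algebra\<close>

definition adj :: "complex^'n^'m \<Rightarrow> complex^'m^'n" where
  "adj A = (\<chi> i j. cnj (A $ j $ i))"

definition hinner :: "complex^'n \<Rightarrow> complex^'n \<Rightarrow> complex" where
  "hinner v w = (\<Sum>i\<in>UNIV. cnj (v $ i) * w $ i)"

definition mscale :: "complex \<Rightarrow> complex^'n^'m \<Rightarrow> complex^'n^'m" where
  "mscale c A = (\<chi> i j. c * A $ i $ j)"

definition U_group :: "(complex^'r^'r) set" where
  "U_group = {a. adj a ** a = mat 1}"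

definition SU_group :: "(complex^'r^'r) set" where
  "SU_group = {a. adj a ** a = mat 1 \<and> det a = 1}"

definition u_alg :: "(complex^'r^'r) set" where
  "u_alg = {a. adj a = - a}"

definition su_alg :: "(complex^'r^'r) set" where
  "su_alg = {a. adj a = - a \<and> trace a = 0}"

text \<open>\<open>\<Lambda>\<^sup>2\<close> of \<open>\<complex>\<^sup>k\<close> is the space of alternating tensors in \<open>\<complex>\<^sup>k \<otimes> \<complex>\<^sup>k\<close>, normalised so that \<open>v \<wedge> w\<close> has
  norm one for orthonormal \<open>v\<close>, \<open>w\<close>.\<close>

definition wedge :: "complex^'k \<Rightarrow> complex^'k \<Rightarrow> complex^('k \<times> 'k)" where
  "wedge v w = (\<chi> p. (v $ fst p * w $ snd p - v $ snd p * w $ fst p) / complex_of_real (sqrt 2))"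

definition perp :: "(complex^'k) set \<Rightarrow> (complex^'k) set" where
  "perp V = {w. \<forall>v\<in>V. hinner v w = 0}"


section \<open>Hermitian vector bundles\<close>

text \<open>A Hermitian vector bundle of rank \<open>r\<close> is given by a set of local unitary frames \<open>(U, e)\<close>. The fibre
  over \<open>x\<close> is a subspace of the ambient space \<open>\<complex>\<^sup>k\<close>, and for \<open>x \<in> U\<close> the columns of the \<open>k \<times> r\<close> matrix
  \<open>e x\<close> are an orthonormal basis of it. Neither the fibres nor the frames need to depend continuously
  on \<open>x\<close> in the ambient space: the topology and smooth structure of the bundle are those
  for which all frames are smooth, and only the transition functions are required to be smooth.
  In particular, for \<open>k = r\<close> the fibres are identified with \<open>\<complex>\<^sup>r\<close> as Hermitian vector spaces, point by
  point, which does not restrict the bundle in any way.\<close>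

type_synonym ('m, 'r, 'k) frames = "('m set \<times> ('m \<Rightarrow> ((complex, 'r) vec, 'k) vec)) set"

text \<open>\<open>\<E>\<close> is a bundle over the open set \<open>W\<close> with structure group \<open>G\<close>.\<close>

definition G_bundle ::
  "'m::topological_space spin_manifold \<Rightarrow> 'm set \<Rightarrow> (complex^'r^'r) set
   \<Rightarrow> ('m, 'r::finite, 'k::finite) frames \<Rightarrow> bool" where
  "G_bundle M W G \<E> \<longleftrightarrow>
     (\<Union>(U, e)\<in>\<E>. U) = W \<and>
     (\<forall>(U, e)\<in>\<E>. open U \<and> (\<forall>x\<in>U. adj (e x) ** e x = mat 1)) \<and>
     (\<forall>(U, e)\<in>\<E>. \<forall>(V, f)\<in>\<E>.
        (\<forall>x\<in>U \<inter> V. range ((*v) (e x)) = range ((*v) (f x)) \<and> adj (e x) ** f x \<in> G) \<and>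
        smooth_map M (U \<inter> V) (\<lambda>x. adj (e x) ** f x))"

definition bundle_restrict ::
  "'m set \<Rightarrow> ('m, 'r::finite, 'k::finite) frames \<Rightarrow> ('m, 'r, 'k) frames" where
  "bundle_restrict W \<E> = (\<lambda>(U, e). (U \<inter> W, e)) ` \<E>"

definition frame_at :: "('m, 'r::finite, 'k::finite) frames \<Rightarrow> 'm \<Rightarrow> ('m \<Rightarrow> complex^'r^'k)" where
  "frame_at \<E> x = snd (SOME f. f \<in> \<E> \<and> x \<in> fst f)"

definition fibre :: "('m, 'r::finite, 'k::finite) frames \<Rightarrow> 'm \<Rightarrow> (complex^'k) set" where
  "fibre \<E> x = range ((*v) (frame_at \<E> x x))"

text \<open>The orthogonal projection of the ambient space onto the fibre.\<close>

definition fibre_proj :: "('m, 'r::finite, 'k::finite) frames \<Rightarrow> 'm \<Rightarrow> complex^'k^'k" where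
  "fibre_proj \<E> x = frame_at \<E> x x ** adj (frame_at \<E> x x)"

definition smooth_section ::
  "'m spin_manifold \<Rightarrow> ('m, 'r::finite, 'k::finite) frames \<Rightarrow> 'm set \<Rightarrow> ('m \<Rightarrow> complex^'k) \<Rightarrow> bool" where
  "smooth_section M \<E> U s \<longleftrightarrow>
     (\<forall>(V, e)\<in>\<E>. (\<forall>x\<in>U \<inter> V. s x \<in> range ((*v) (e x))) \<and>
                 smooth_map M (U \<inter> V) (\<lambda>x. adj (e x) *v s x))"

definition smooth_one_form ::
  "'m spin_manifold \<Rightarrow> 'm set \<Rightarrow> (complex^'r^'r) set \<Rightarrow> ('m \<Rightarrow> real^3 \<Rightarrow> complex^'r^'r) \<Rightarrow> bool" where
  "smooth_one_form M U \<gg> a \<longleftrightarrow>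
     (\<forall>x\<in>U. linear (a x) \<and> range (a x) \<subseteq> \<gg>) \<and>
     (\<forall>c\<in>atlas M. \<forall>i. smooth_map M (U \<inter> fst c) (\<lambda>y. a y (coord_vector M c y (axis i 1))))"

text \<open>A connection is a covariant derivative; \<open>D s x v\<close> is the derivative at \<open>x\<close> in the direction \<open>v\<close> of
  the local section \<open>s\<close>, meaningful if \<open>s\<close> is smooth near \<open>x\<close>. In every frame it is \<open>d + a\<close> with a
  one-form \<open>a\<close> with values in the Lie algebra \<open>\<gg>\<close>.\<close>

type_synonym ('m, 'k) conn = "('m \<Rightarrow> (complex, 'k) vec) \<Rightarrow> 'm \<Rightarrow> real^3 \<Rightarrow> (complex, 'k) vec"

definition connection ::
  "'m::topological_space spin_manifold \<Rightarrow> (complex^'r^'r) set \<Rightarrow> ('m, 'r::finite, 'k::finite) frames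
   \<Rightarrow> ('m, 'k) conn \<Rightarrow> bool" where
  "connection M \<gg> \<E> D \<longleftrightarrow>
     (\<forall>(U, e)\<in>\<E>. \<exists>a. smooth_one_form M U \<gg> a \<and>
        (\<forall>V s x v. open V \<and> V \<subseteq> U \<and> smooth_section M \<E> V s \<and> x \<in> V \<longrightarrow>
           D s x v = e x *v (mderiv M (\<lambda>y. adj (e y) *v s y) x v + a x v *v (adj (e x) *v s x))))"

definition conn_form ::
  "('m, 'k::finite) conn \<Rightarrow> ('m \<Rightarrow> complex^'r^'k) \<Rightarrow> 'm \<Rightarrow> real^3 \<Rightarrow> complex^'r^'r" where
  "conn_form D e x v = (\<chi> i j. (adj (e x) *v D (\<lambda>y. column j (e y)) x v) $ i)"


subsection \<open>Line bundles, tensor products and determinants\<close>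

text \<open>Line bundles have rank type \<open>1\<close>. If the fibres of the line bundle \<open>\<L>\<close> are all of \<open>\<complex>\<close>, then
  \<open>\<E> \<otimes> \<L>\<close> has the same fibres as \<open>\<E>\<close>, by \<open>V \<otimes> \<complex> = V\<close>, but other frames.\<close>

definition tensor_line ::
  "('m, 'r::finite, 'k::finite) frames \<Rightarrow> ('m, 1, 1) frames \<Rightarrow> ('m, 'r, 'k) frames" where
  "tensor_line \<E> \<L> =
     {(U \<inter> V, \<lambda>x. mscale (l x $ 1 $ 1) (e x)) | U e V l. (U, e) \<in> \<E> \<and> (V, l) \<in> \<L>}"

text \<open>With a local frame \<open>l\<close> of \<open>\<L>\<close> one has \<open>s = (l\<^sup>-\<^sup>1 s) \<otimes> l\<close>, so the Leibniz rule gives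
  \<open>\<nabla>(l\<^sup>-\<^sup>1 s) \<otimes> l + (l\<^sup>-\<^sup>1 s) \<otimes> \<nabla>l\<close>.\<close>

definition tensor_conn ::
  "('m, 1, 1) frames \<Rightarrow> ('m, 'k::finite) conn \<Rightarrow> ('m, 1) conn \<Rightarrow> ('m, 'k) conn" where
  "tensor_conn \<L> D DL s x v =
     (let l = (\<lambda>y. column 1 (frame_at \<L> x y)); t = (\<lambda>y. inverse (l y $ 1) *s s y)
      in (l x $ 1) *s D t x v + (DL l x v $ 1) *s t x)"

text \<open>The dual of a Hermitian line bundle is its conjugate.\<close>

definition dual_line :: "('m, 1, 1) frames \<Rightarrow> ('m, 1, 1) frames" where
  "dual_line \<N> = {(U, \<lambda>x. \<chi> i j. cnj (n x $ i $ j)) | U n. (U, n) \<in> \<N>}"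

definition dual_conn :: "('m, 1) conn \<Rightarrow> ('m, 1) conn" where
  "dual_conn D s x v = (\<chi> i. cnj (D (\<lambda>y. \<chi> j. cnj (s y $ j)) x v $ i))"

definition det_bundle :: "('m, 2, 'k::finite) frames \<Rightarrow> ('m, 1, 'k \<times> 'k) frames" where
  "det_bundle \<F> = {(U, \<lambda>x. columnvector (wedge (column 1 (f x)) (column 2 (f x)))) | U f. (U, f) \<in> \<F>}"

definition det_conn ::
  "'m spin_manifold \<Rightarrow> ('m, 2, 'k::finite) frames \<Rightarrow> ('m, 'k) conn \<Rightarrow> ('m, 'k \<times> 'k) conn" where
  "det_conn M \<F> D s x v =
     (let f1 = (\<lambda>y. column 1 (frame_at \<F> x y)); f2 = (\<lambda>y. column 2 (frame_at \<F> x y));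
          c = (\<lambda>y. hinner (wedge (f1 y) (f2 y)) (s y))
      in mderiv M c x v *s wedge (f1 x) (f2 x)
         + c x *s (wedge (D f1 x v) (f2 x) + wedge (f1 x) (D f2 x v)))"

text \<open>\<open>\<N>\<close> is a square root of the Hermitian line bundle \<open>\<K>\<close> over \<open>W\<close> by means of the isomorphism
  \<open>\<N> \<otimes> \<N> \<rightarrow> \<K>\<close> which maps the element \<open>1\<close> of the fibre \<open>\<complex> \<otimes> \<complex> = \<complex>\<close> over \<open>x\<close> to \<open>\<iota> x\<close>. The section \<open>\<iota>\<close> itself
  is in general not continuous.\<close>

definition square_root ::
  "'m::topological_space spin_manifold \<Rightarrow> 'm set \<Rightarrow> ('m, 1, 'p::finite) frames
   \<Rightarrow> ('m, 1, 1) frames \<Rightarrow> ('m \<Rightarrow> complex^'p) \<Rightarrow> bool" where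
  "square_root M W \<K> \<N> \<iota> \<longleftrightarrow>
     G_bundle M W U_group \<N> \<and>
     (\<forall>x\<in>W. \<iota> x \<in> fibre \<K> x \<and> norm (\<iota> x) = 1) \<and>
     (\<forall>(U, n)\<in>\<N>. smooth_section M \<K> U (\<lambda>x. (n x $ 1 $ 1)\<^sup>2 *s \<iota> x))"

text \<open>The connection on \<open>\<N>\<close> for which \<open>\<N> \<otimes> \<N> \<rightarrow> \<K>\<close> is parallel: if \<open>\<nabla> n\<^sup>2 = \<omega> n\<^sup>2\<close>, then \<open>\<nabla> n = (\<omega>/2) n\<close>.\<close>

definition sqrt_conn ::
  "'m spin_manifold \<Rightarrow> ('m, 1, 1) frames \<Rightarrow> ('m \<Rightarrow> complex^'p::finite) \<Rightarrow> ('m, 'p) conn \<Rightarrow> ('m, 1) conn" where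
  "sqrt_conn M \<N> \<iota> DK t x v =
     (let n = (\<lambda>y. column 1 (frame_at \<N> x y)); c = (\<lambda>y. hinner (n y) (t y));
          k = (\<lambda>y. (n y $ 1)\<^sup>2 *s \<iota> y); \<omega> = hinner (k x) (DK k x v)
      in (mderiv M c x v + \<omega> / 2 * c x) *s n x)"


subsection \<open>Subbundles\<close>

text \<open>The subspaces \<open>F x\<close> form a smooth subbundle of \<open>\<E>\<close> over \<open>W\<close> of rank \<open>CARD('r)\<close>.\<close>

definition is_subbundle ::
  "'r::finite itself \<Rightarrow> 'm::topological_space spin_manifold \<Rightarrow> 'm set \<Rightarrow> ('m, 'q::finite, 'k::finite) frames
   \<Rightarrow> ('m \<Rightarrow> (complex^'k) set) \<Rightarrow> bool" where
  "is_subbundle _ M W \<E> F \<longleftrightarrow>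
     (\<forall>x\<in>W. \<exists>U (f :: 'm \<Rightarrow> complex^'r^'k). open U \<and> x \<in> U \<and> U \<subseteq> W \<and>
        (\<forall>j. smooth_section M \<E> U (\<lambda>y. column j (f y))) \<and>
        (\<forall>y\<in>U. inj ((*v) (f y)) \<and> range ((*v) (f y)) = F y))"

text \<open>The Hermitian bundle of rank \<open>CARD('r)\<close> formed by the \<open>F x\<close>: all local unitary frames of \<open>F\<close> which
  consist of smooth sections of \<open>\<E>\<close>.\<close>

definition unitary_frames ::
  "'m::topological_space spin_manifold \<Rightarrow> 'm set \<Rightarrow> ('m, 'q::finite, 'k::finite) frames
   \<Rightarrow> ('m \<Rightarrow> (complex^'k) set) \<Rightarrow> ('m, 'r::finite, 'k) frames" where
  "unitary_frames M W \<E> F =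
     {(U, f). open U \<and> U \<subseteq> W \<and> (\<forall>j. smooth_section M \<E> U (\<lambda>y. column j (f y))) \<and>
        (\<forall>y\<in>U. adj (f y) ** f y = mat 1 \<and> range ((*v) (f y)) = F y)}"

definition proj_conn ::
  "('m, 'r::finite, 'k::finite) frames \<Rightarrow> ('m, 'k) conn \<Rightarrow> ('m, 'k) conn" where
  "proj_conn \<F> D s x v = fibre_proj \<F> x *v D s x v"

text \<open>Let \<open>\<N>\<close> be a square root of \<open>det \<F>\<close> via \<open>\<iota>\<close>. The fibre of \<open>\<Lambda>\<^sup>2(\<F> \<otimes> \<N>\<^sup>*)\<close> over \<open>x\<close> is that of \<open>\<Lambda>\<^sup>2\<F>\<close>,
  and the isomorphism \<open>det (\<F> \<otimes> \<N>\<^sup>*) = \<K> \<otimes> \<N>\<^sup>-\<^sup>2 = \<complex>\<close> maps \<open>\<iota> x\<close> to \<open>1\<close>. This trivialisation of the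
  determinant singles out the special unitary frames.\<close>

definition ring_bundle ::
  "'m::topological_space spin_manifold \<Rightarrow> 'm set \<Rightarrow> ('m, 2, 'k::finite) frames
   \<Rightarrow> ('m, 1, 1) frames \<Rightarrow> ('m \<Rightarrow> complex^('k \<times> 'k)) \<Rightarrow> ('m, 2, 'k) frames" where
  "ring_bundle M W \<F> \<N> \<iota> =
     (let \<H> = tensor_line \<F> (dual_line \<N>) in
      {(U, h) \<in> unitary_frames M W \<H> (fibre \<H>).
         \<forall>x\<in>U. wedge (column 1 (h x)) (column 2 (h x)) = \<iota> x})"


subsection \<open>Curvature and holonomy\<close>

definition curvature ::
  "'m spin_manifold \<Rightarrow> ('m, 'k::finite) conn \<Rightarrow> ('m \<Rightarrow> real^3) \<Rightarrow> ('m \<Rightarrow> real^3)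
   \<Rightarrow> ('m \<Rightarrow> complex^'k) \<Rightarrow> 'm \<Rightarrow> complex^'k" where
  "curvature M D X Y s x =
     D (\<lambda>y. D s y (Y y)) x (X x) - D (\<lambda>y. D s y (X y)) x (Y x) - D s x (lie_bracket M X Y x)"

definition flat_conn ::
  "'m::topological_space spin_manifold \<Rightarrow> 'm set \<Rightarrow> ('m, 'r::finite, 'k::finite) frames
   \<Rightarrow> ('m, 'k) conn \<Rightarrow> bool" where
  "flat_conn M W \<E> D \<longleftrightarrow>
     (\<forall>U X Y s. open U \<and> U \<subseteq> W \<and> smooth_vector_field M U X \<and> smooth_vector_field M U Y \<and>
        smooth_section M \<E> U s \<longrightarrow> (\<forall>x\<in>U. curvature M D X Y s x = 0))"

text \<open>Curves are parametrised by \<open>{0..1}\<close>; \<open>T\<close> is the set of exceptional parameters of a piecewise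
  \<open>C\<^sup>1\<close> curve.\<close>

definition piecewise_C1_curve ::
  "'m::topological_space spin_manifold \<Rightarrow> real set \<Rightarrow> (real \<Rightarrow> 'm) \<Rightarrow> bool" where
  "piecewise_C1_curve M T c \<longleftrightarrow>
     continuous_on {0..1} c \<and> finite T \<and>
     (\<forall>(U, \<phi>)\<in>atlas M. (\<phi> \<circ> c) C1_differentiable_on ({t \<in> {0<..<1}. c t \<in> U} - T))"

definition velocity :: "'m spin_manifold \<Rightarrow> (real \<Rightarrow> 'm) \<Rightarrow> real \<Rightarrow> real^3" where
  "velocity M c t = vector_derivative (snd (chart_at M (c t)) \<circ> c) (at t)"

definition parallel_along ::
  "'m spin_manifold \<Rightarrow> ('m, 'r::finite, 'k::finite) frames \<Rightarrow> ('m, 'k) conn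
   \<Rightarrow> real set \<Rightarrow> (real \<Rightarrow> 'm) \<Rightarrow> (real \<Rightarrow> complex^'k) \<Rightarrow> bool" where
  "parallel_along M \<E> D T c s \<longleftrightarrow>
     (\<forall>(U, e)\<in>\<E>.
        (\<forall>t\<in>{0..1}. c t \<in> U \<longrightarrow> s t \<in> range ((*v) (e (c t)))) \<and>
        continuous_on {t \<in> {0..1}. c t \<in> U} (\<lambda>t. adj (e (c t)) *v s t) \<and>
        (\<forall>t\<in>{0<..<1} - T. c t \<in> U \<longrightarrow>
           ((\<lambda>t. adj (e (c t)) *v s t) has_vector_derivative
             - (conn_form D e (c t) (velocity M c t) *v (adj (e (c t)) *v s t))) (at t)))"

text \<open>The holonomies, around all loops in \<open>W\<close>, of a connection on a line bundle.\<close>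

definition holonomies ::
  "'m::topological_space spin_manifold \<Rightarrow> 'm set \<Rightarrow> ('m, 1, 'k::finite) frames
   \<Rightarrow> ('m, 'k) conn \<Rightarrow> complex set" where
  "holonomies M W \<L> D =
     {z. \<exists>T c s. piecewise_C1_curve M T c \<and> c ` {0..1} \<subseteq> W \<and> c 0 = c 1 \<and>
           parallel_along M \<L> D T c s \<and> s 0 \<noteq> 0 \<and> s 1 = z *s s 0}"


section \<open>Spin structure, spinor bundle and Dirac operator\<close>

text \<open>The basis \<open>- \<i> \<sigma>\<^sub>k\<close> of \<open>su(2)\<close>, for the Pauli matrices \<open>\<sigma>\<^sub>k\<close>. The matrices satisfy
  \<open>\<gamma>\<^sub>i \<gamma>\<^sub>j + \<gamma>\<^sub>j \<gamma>\<^sub>i = - 2 \<delta>\<^sub>i\<^sub>j\<close> and are orthonormal for \<open>- trace (a b) / 2\<close>.\<close>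

definition gam :: "3 \<Rightarrow> complex^2^2" where
  "gam k =
     (if k = 1 then vector [vector [0, - \<i>], vector [- \<i>, 0]]
      else if k = 2 then vector [vector [0, - 1], vector [1, 0]]
      else vector [vector [- \<i>, 0], vector [0, \<i>]])"

text \<open>The double cover of \<open>SO(3)\<close> by \<open>Spin(3) = SU(2)\<close>, characterised by
  \<open>a \<gamma>\<^sub>j a\<^sup>-\<^sup>1 = \<Sum>i. (Ad a)\<^sub>i\<^sub>j \<gamma>\<^sub>i\<close>.\<close>

definition Ad :: "complex^2^2 \<Rightarrow> real^3^3" where
  "Ad a = (\<chi> i j. - Re (trace (gam i ** a ** gam j ** adj a)) / 2)"

definition oriented_orthonormal_frame ::
  "'m spin_manifold \<Rightarrow> 'm set \<Rightarrow> ('m \<Rightarrow> real^3^3) \<Rightarrow> bool" where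
  "oriented_orthonormal_frame M U e \<longleftrightarrow>
     (\<forall>j. smooth_vector_field M U (\<lambda>x. column j (e x))) \<and>
     (\<forall>x\<in>U. det (e x) > 0 \<and>
        (\<forall>i j. metric M x (column i (e x)) (column j (e x)) = (if i = j then 1 else 0)))"

text \<open>A Spin structure is a lift of the oriented orthonormal frame bundle along \<open>Ad\<close>: the transition
  functions of the frames \<open>e\<close> lift to \<open>SU(2)\<close>-valued functions, which form the cocycle of the frames
  \<open>s\<close>.\<close>

definition spin_structure :: "'m::topological_space spin_manifold \<Rightarrow> bool" where
  "spin_structure M \<longleftrightarrow>
     G_bundle M UNIV SU_group {(U, s). \<exists>e. (U, s, e) \<in> spin_frames M} \<and>
     (\<forall>(U, s, e)\<in>spin_frames M. oriented_orthonormal_frame M U e) \<and>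
     (\<forall>(U, s, e)\<in>spin_frames M. \<forall>(V, s', e')\<in>spin_frames M. \<forall>x\<in>U \<inter> V.
        e' x = e x ** Ad (adj (s x) ** s' x))"

definition closed_spin_manifold :: "'m::t2_space spin_manifold \<Rightarrow> bool" where
  "closed_spin_manifold M \<longleftrightarrow>
     compact (UNIV :: 'm set) \<and> oriented_atlas (atlas M) \<and> riemannian_metric M \<and> spin_structure M"

text \<open>The spinor bundle is associated to the Spin structure by the standard representation of \<open>SU(2)\<close>.\<close>

definition spinor_bundle :: "'m spin_manifold \<Rightarrow> ('m, 2, 2) frames" where
  "spinor_bundle M = {(U, s). \<exists>e. (U, s, e) \<in> spin_frames M}"

definition spin_frame_at :: "'m spin_manifold \<Rightarrow> 'm \<Rightarrow> ('m \<Rightarrow> complex^2^2) \<times> ('m \<Rightarrow> real^3^3)" where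
  "spin_frame_at M x = snd (SOME f. f \<in> spin_frames M \<and> x \<in> fst f)"

text \<open>Clifford multiplication by the tangent vector \<open>v\<close>: the vector \<open>e\<^sub>i\<close> acts by \<open>\<gamma>\<^sub>i\<close> in the frame \<open>s\<close>.\<close>

definition clifford :: "'m spin_manifold \<Rightarrow> 'm \<Rightarrow> real^3 \<Rightarrow> complex^2^2" where
  "clifford M x v =
     (let (s, e) = spin_frame_at M x
      in s x ** (\<Sum>i\<in>UNIV. metric M x v (column i (e x)) *\<^sub>R gam i) ** adj (s x))"

text \<open>In the frame \<open>s\<close>, the Levi-Civita spin connection is \<open>d + 1/4 \<Sum>i\<noteq>j. g(\<nabla>e\<^sub>i, e\<^sub>j) \<gamma>\<^sub>i \<gamma>\<^sub>j\<close>.\<close>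

definition spin_conn :: "'m spin_manifold \<Rightarrow> ('m, 2) conn" where
  "spin_conn M \<psi> x v =
     (let (s, e) = spin_frame_at M x;
          \<Omega> = (\<Sum>i\<in>UNIV. \<Sum>j\<in>UNIV - {i}.
                 (1/4 * metric M x (levi_civita M (\<lambda>y. column i (e y)) x v) (column j (e x)))
                 *\<^sub>R (gam i ** gam j))
      in s x *v (mderiv M (\<lambda>y. adj (s y) *v \<psi> y) x v + \<Omega> *v (adj (s x) *v \<psi> x)))"

text \<open>An element of \<open>Hom(\<E>, \<T>)\<close> at \<open>x\<close> is a matrix which vanishes on the orthogonal complement of the
  fibre of \<open>\<E>\<close> in its ambient space.\<close>

definition smooth_hom ::
  "'m spin_manifold \<Rightarrow> 'm set \<Rightarrow> ('m, 'r::finite, 'k::finite) frames \<Rightarrow> ('m, 'q::finite, 'l::finite) frames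
   \<Rightarrow> ('m \<Rightarrow> complex^'k^'l) \<Rightarrow> bool" where
  "smooth_hom M W \<E> \<T> \<Psi> \<longleftrightarrow>
     (\<forall>x\<in>W. \<Psi> x = fibre_proj \<T> x ** \<Psi> x ** fibre_proj \<E> x) \<and>
     (\<forall>(U, e)\<in>\<E>. \<forall>(V, t)\<in>\<T>. smooth_map M (W \<inter> U \<inter> V) (\<lambda>x. adj (t x) ** \<Psi> x ** e x))"

text \<open>The induced connection on \<open>Hom(\<E>, \<T>)\<close>: \<open>(\<nabla>\<Psi>) s = \<nabla>(\<Psi> s) - \<Psi> (\<nabla>s)\<close>, evaluated on a frame of \<open>\<E>\<close>.\<close>

definition hom_conn ::
  "('m, 'r::finite, 'k::finite) frames \<Rightarrow> ('m, 'k) conn \<Rightarrow> ('m, 'l::finite) conn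
   \<Rightarrow> ('m \<Rightarrow> complex^'k^'l) \<Rightarrow> 'm \<Rightarrow> real^3 \<Rightarrow> complex^'k^'l" where
  "hom_conn \<E> DE DT \<Psi> x v =
     (let e = frame_at \<E> x
      in (\<chi> i j. (DT (\<lambda>y. \<Psi> y *v column j (e y)) x v - \<Psi> x *v DE (\<lambda>y. column j (e y)) x v) $ i)
         ** adj (e x))"

text \<open>The Dirac operator on \<open>Hom(\<E>, S \<otimes> \<L>)\<close>, where \<open>B\<close> is a connection on \<open>\<E>\<close> and \<open>A\<close> on \<open>\<L>\<close>.\<close>

definition dirac ::
  "'m spin_manifold \<Rightarrow> ('m, 'r::finite, 'k::finite) frames \<Rightarrow> ('m, 'k) conn
   \<Rightarrow> ('m, 1, 1) frames \<Rightarrow> ('m, 1) conn \<Rightarrow> ('m \<Rightarrow> complex^'k^2) \<Rightarrow> 'm \<Rightarrow> complex^'k^2" where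
  "dirac M \<E> B \<L> A \<Psi> x =
     (let (s, e) = spin_frame_at M x
      in \<Sum>i\<in>UNIV. clifford M x (column i (e x))
           ** hom_conn \<E> B (tensor_conn \<L> (spin_conn M) A) \<Psi> x (column i (e x)))"

text \<open>\<open>\<Psi> \<Psi>\<^sup>*\<close> is an endomorphism of \<open>S \<otimes> \<L>\<close>, hence of \<open>S\<close>. The norm is the Hilbert-Schmidt norm.\<close>

definition mu :: "complex^'k^2 \<Rightarrow> complex^2^2" where
  "mu \<Psi> = \<Psi> ** adj \<Psi> - (1/2 * (norm \<Psi>)\<^sup>2) *\<^sub>R mat 1"

definition solution ::
  "'m spin_manifold \<Rightarrow> 'm set \<Rightarrow> ('m, 'r::finite, 'k::finite) frames \<Rightarrow> ('m, 'k) conn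
   \<Rightarrow> ('m, 1, 1) frames \<Rightarrow> ('m, 1) conn \<Rightarrow> ('m \<Rightarrow> complex^'k^2) \<Rightarrow> bool" where
  "solution M W \<E> B \<L> A \<Psi> \<longleftrightarrow>
     smooth_hom M W \<E> (tensor_line (spinor_bundle M) \<L>) \<Psi> \<and>
     (\<forall>x\<in>W. dirac M \<E> B \<L> A \<Psi> x = 0 \<and> mu (\<Psi> x) = 0)"

text \<open>The section \<open>\<Psi>|\<^sub>F \<otimes> id\<close> of \<open>Hom(\<F> \<otimes> \<N>\<^sup>*, S \<otimes> \<L> \<otimes> \<N>\<^sup>*)\<close>. All fibres of \<open>\<N>\<^sup>*\<close> are \<open>\<complex>\<close>, so that tensoring a
  linear map with the identity of the fibre amounts to \<open>V \<otimes> \<complex> = V\<close>.\<close>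

definition induced_section ::
  "('m, 2, 'k::finite) frames \<Rightarrow> ('m \<Rightarrow> complex^'k^2) \<Rightarrow> 'm \<Rightarrow> complex^'k^2" where
  "induced_section \<F> \<Psi> x = \<Psi> x ** fibre_proj \<F> x"

end

theory Submission
  imports Defs
begin

text \<open>The equation \<open>\<mu>(\<Psi>) = 0\<close> says \<open>\<Psi> \<Psi>\<^sup>* = |\<Psi>|\<^sup>2/2\<close>. Away from the zeros the rescaled \<open>\<Psi>\<^sup>*\<close> is therefore a
  unitary isomorphism from \<open>S \<otimes> L\<close> onto \<open>F\<close>, and its determinant an isomorphism \<open>L\<^sup>2 \<rightarrow> K\<close>. For a vector \<open>e\<^sub>i\<close> of an
  orthonormal frame put \<open>X\<^sub>i = (\<nabla>\<^sub>i \<Psi>|\<^sub>F) \<Psi>\<^sup>*\<close>. The selfadjoint part of \<open>X\<^sub>i\<close> is a multiple of the identity, namely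
  half of the derivative of \<open>|\<Psi>|\<^sup>2/2\<close>, and \<open>\<Sum>i. \<gamma>\<^sub>i X\<^sub>i = 0\<close> by the Dirac equation. The Clifford relations then
  force the trace of \<open>X\<^sub>i\<close> to be real, which says that \<open>L\<^sup>2 \<rightarrow> K\<close> is parallel. Hence \<open>(L \<otimes> K\<^sup>-\<^sup>1\<^sup>/\<^sup>2)\<^sup>2\<close> has a
  parallel unit section, so that \<open>L \<otimes> K\<^sup>-\<^sup>1\<^sup>/\<^sup>2\<close> is flat and its holonomies square to one.\<close>

section \<open>Smooth functions on open subsets of Euclidean spaces\<close>

text \<open>Why the trace is real: since the selfadjoint part of \<open>X i\<close> is scalar,
  \<open>X i\<close> is \<open>r i / 2 + \<i> * t i\<close> plus a real combination of the matrices
  \<open>gam j\<close>. The products \<open>gam i ** gam j\<close> are real combinations of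
  \<open>mat 1\<close> and the \<open>gam k\<close>, so in the Dirac sum the imaginary part of the
  coefficient of \<open>gam k\<close> is just \<open>t k\<close>, which must vanish. Taking traces
  then yields the logarithmic derivative of the determinant of \<Psi> on F: the spin connection has
  trace zero, L counts twice because S has rank 2, and B enters through the trace of its projection
  to F. The isomorphism from the square of L to K also exhibits L, restricted to the complement of
  Z, as one square root of K; the remaining claims concern an arbitrary one. The formal obstacle is
  that the induced connections and the Dirac operator are defined through frames chosen separately
  at every point. Each connection is therefore shown to have the expected matrix at one point in a
  frame given near it, and the later computations use these matrices.\<close>

lemma frechet_derivative_cong_open:
  assumes "open S" "x \<in> S" "\<And>y. y \<in> S \<Longrightarrow> f y = g y"
  shows "frechet_derivative f (at x) = frechet_derivative g (at x)"
proof -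
  have "(f has_derivative f') (at x) \<longleftrightarrow> (g has_derivative f') (at x)" for f'
    using has_derivative_transform_within_open[of f f' x UNIV S g]
      has_derivative_transform_within_open[of g f' x UNIV S f] assms by auto
  then show ?thesis unfolding frechet_derivative_def by simp
qed

lemma differentiable_cong_open:
  assumes "open S" "x \<in> S" "\<And>y. y \<in> S \<Longrightarrow> f y = g y" "f differentiable (at x)"
  shows "g differentiable (at x)"
  using assms by (auto simp: differentiable_def intro: has_derivative_transform_within_open)

lemma frechet_derivative_eqI:
  "(f has_derivative f') (at x) \<Longrightarrow> frechet_derivative f (at x) = f'"
  using frechet_derivative_at by metis

lemma Ck_on_cong:
  assumes "open S" "\<And>x. x \<in> S \<Longrightarrow> f x = g x" "Ck_on k S f"
  shows "Ck_on k S g"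
  using assms(2,3)
proof (induction k arbitrary: f g)
  case 0
  then show ?case by (simp cong: continuous_on_cong)
next
  case (Suc k)
  have "Ck_on k S (\<lambda>x. frechet_derivative g (at x) v)" for v
  proof (rule Suc.IH)
    show "Ck_on k S (\<lambda>x. frechet_derivative f (at x) v)" using Suc.prems by simp
    show "frechet_derivative f (at x) v = frechet_derivative g (at x) v" if "x \<in> S" for x
      using frechet_derivative_cong_open[OF assms(1) that, of f g] Suc.prems(1) by simp
  qed
  then show ?case using Suc.prems differentiable_cong_open[OF assms(1), of _ f g] by auto
qed

lemma Ck_on_subset: "Ck_on k S f \<Longrightarrow> T \<subseteq> S \<Longrightarrow> Ck_on k T f"
  by (induction k arbitrary: f) (auto intro: continuous_on_subset)

lemma Ck_on_local:
  assumes "\<And>x. x \<in> S \<Longrightarrow> \<exists>T. open T \<and> x \<in> T \<and> Ck_on k T f"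
  shows "Ck_on k S f"
  using assms
proof (induction k arbitrary: f)
  case 0
  then show ?case
    by (auto simp: continuous_on_eq_continuous_at intro!: continuous_at_imp_continuous_on) (metis continuous_on_eq_continuous_at)
next
  case (Suc k)
  have "Ck_on k S (\<lambda>x. frechet_derivative f (at x) v)" for v
    by (rule Suc.IH) (use Suc.prems in fastforce)
  then show ?case using Suc.prems by fastforce
qed

lemma Ck_on_Suc_imp: "Ck_on (Suc k) S f \<Longrightarrow> Ck_on k S f"
proof (induction k arbitrary: f)
  case 0
  then show ?case
    by (auto intro!: continuous_at_imp_continuous_on differentiable_imp_continuous_within)
next
  case (Suc k)
  then show ?case by simp
qed

lemma Ck_on_const: "Ck_on k S (\<lambda>x. c)"
  by (induction k arbitrary: c) auto

lemma Ck_on_bounded_linear: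
  assumes "bounded_linear L" "open S" "Ck_on k S f"
  shows "Ck_on k S (\<lambda>x. L (f x))"
  using assms(3)
proof (induction k arbitrary: f)
  case 0
  then show ?case using bounded_linear.continuous_on[OF assms(1)] by simp
next
  case (Suc k)
  have d: "((\<lambda>x. L (f x)) has_derivative (\<lambda>v. L (frechet_derivative f (at x) v))) (at x)" if "x \<in> S" for x
    using Suc.prems that
    by (intro bounded_linear.has_derivative[OF assms(1)]) (simp add: frechet_derivative_works)
  have "Ck_on k S (\<lambda>x. frechet_derivative (\<lambda>x. L (f x)) (at x) v)" for v
  proof (rule Ck_on_cong[OF assms(2)])
    show "Ck_on k S (\<lambda>x. L (frechet_derivative f (at x) v))" using Suc by simp
  qed (simp add: frechet_derivative_eqI[OF d])
  then show ?case using d by (auto simp: differentiable_def)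
qed

lemma Ck_on_add:
  assumes "open S" "Ck_on k S f" "Ck_on k S g"
  shows "Ck_on k S (\<lambda>x. f x + g x)"
  using assms(2,3)
proof (induction k arbitrary: f g)
  case 0
  then show ?case by (simp add: continuous_on_add)
next
  case (Suc k)
  have d: "((\<lambda>x. f x + g x) has_derivative
      (\<lambda>v. frechet_derivative f (at x) v + frechet_derivative g (at x) v)) (at x)" if "x \<in> S" for x
    using Suc.prems that by (auto intro!: has_derivative_add simp: frechet_derivative_works)
  have "Ck_on k S (\<lambda>x. frechet_derivative (\<lambda>x. f x + g x) (at x) v)" for v
    by (rule Ck_on_cong[OF assms(1) _ Suc.IH[of "\<lambda>x. frechet_derivative f (at x) v" "\<lambda>x. frechet_derivative g (at x) v"]])
      (use Suc.prems frechet_derivative_eqI[OF d] in auto)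
  then show ?case using d by (auto simp: differentiable_def)
qed

lemma Ck_on_bilinear:
  assumes "bounded_bilinear P" "open S" "Ck_on k S f" "Ck_on k S g"
  shows "Ck_on k S (\<lambda>x. P (f x) (g x))"
  using assms(3,4)
proof (induction k arbitrary: f g)
  case 0
  then show ?case using assms(1) by (simp add: bounded_bilinear.continuous_on)
next
  case (Suc k)
  have d: "((\<lambda>x. P (f x) (g x)) has_derivative
      (\<lambda>v. P (f x) (frechet_derivative g (at x) v) + P (frechet_derivative f (at x) v) (g x))) (at x)" if "x \<in> S" for x
    using Suc.prems that
    by (intro bounded_bilinear.FDERIV[OF assms(1)]) (simp_all add: frechet_derivative_works)
  have "Ck_on k S (\<lambda>x. frechet_derivative (\<lambda>x. P (f x) (g x)) (at x) v)" for v
  proof (rule Ck_on_cong[OF assms(2)])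
    show "Ck_on k S (\<lambda>x. P (f x) (frechet_derivative g (at x) v) + P (frechet_derivative f (at x) v) (g x))"
      using Suc.prems Ck_on_Suc_imp[OF Suc.prems(1)] Ck_on_Suc_imp[OF Suc.prems(2)]
      by (intro Ck_on_add assms Suc.IH) auto
  qed (simp add: frechet_derivative_eqI[OF d])
  then show ?case using d by (auto simp: differentiable_def)
qed

lemma Ck_on_sum:
  assumes "open S" "\<And>i. i \<in> I \<Longrightarrow> Ck_on k S (f i)"
  shows "Ck_on k S (\<lambda>x. \<Sum>i\<in>I. f i x)"
  using assms(2)
proof (induction I rule: infinite_finite_induct)
  case (insert i I)
  have "Ck_on k S (\<lambda>x. f i x + (\<Sum>i\<in>I. f i x))"
    by (rule Ck_on_add[OF assms(1)]) (use insert in blast)+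
  then show ?case using insert.hyps by simp
qed (simp_all add: Ck_on_const)

lemma Ck_on_compose:
  fixes f :: "'b::euclidean_space \<Rightarrow> 'c::real_normed_vector" and g :: "'a::euclidean_space \<Rightarrow> 'b"
  assumes "open S" "open T" "g ` S \<subseteq> T" "Ck_on k S g" "Ck_on k T f"
  shows "Ck_on k S (\<lambda>x. f (g x))"
  using assms(4,5)
proof (induction k arbitrary: f)
  case 0
  then show ?case using assms(3) by (auto intro: continuous_on_compose2)
next
  case (Suc k)
  have df: "(f has_derivative frechet_derivative f (at (g x))) (at (g x))"
    and dg: "(g has_derivative frechet_derivative g (at x)) (at x)" if "x \<in> S" for x
    using Suc.prems that assms(3) by (auto simp: frechet_derivative_works)
  have d: "((\<lambda>x. f (g x)) has_derivative
      (\<lambda>v. frechet_derivative f (at (g x)) (frechet_derivative g (at x) v))) (at x)" if "x \<in> S" for x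
    using diff_chain_at[OF dg[OF that] df[OF that]] by (simp add: o_def)
  have lin: "linear (frechet_derivative f (at (g x)))" if "x \<in> S" for x
    using df[OF that] has_derivative_bounded_linear bounded_linear.linear by blast
  have "Ck_on k S (\<lambda>x. frechet_derivative (\<lambda>x. f (g x)) (at x) v)" for v
  proof (rule Ck_on_cong[OF assms(1)])
    \<comment> \<open>The direction \<open>frechet_derivative g (at x) v\<close> moves with
      \<open>x\<close>, whereas the induction hypothesis treats derivatives of \<open>f\<close> in
      fixed directions. Expanding in the basis separates the two.\<close>
    show "Ck_on k S (\<lambda>x. \<Sum>b\<in>Basis. (frechet_derivative g (at x) v \<bullet> b) *\<^sub>R frechet_derivative f (at (g x)) b)"
    proof (intro Ck_on_sum Ck_on_bilinear[OF bounded_bilinear_scaleR] assms(1))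
      fix b :: 'b
      show "Ck_on k S (\<lambda>x. frechet_derivative g (at x) v \<bullet> b)"
        using Suc.prems by (intro Ck_on_bounded_linear[OF bounded_linear_inner_left] assms(1)) auto
      show "Ck_on k S (\<lambda>x. frechet_derivative f (at (g x)) b)"
        using Suc.IH[of "\<lambda>y. frechet_derivative f (at y) b"] Suc.prems Ck_on_Suc_imp[of k S g] by auto
    qed
    show "(\<Sum>b\<in>Basis. (frechet_derivative g (at x) v \<bullet> b) *\<^sub>R frechet_derivative f (at (g x)) b)
        = frechet_derivative (\<lambda>x. f (g x)) (at x) v" if "x \<in> S" for x
      unfolding frechet_derivative_eqI[OF d[OF that]]
      by (subst (2) euclidean_representation[symmetric])
        (simp add: linear_sum[OF lin[OF that]] linear_scale[OF lin[OF that]])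
  qed
  then show ?case using d by (auto simp: differentiable_def)
qed

text \<open>The derivative of the inverse is a polynomial in the inverse itself, so the order of
  differentiability rises by induction.\<close>

lemma Ck_on_inverse:
  "Ck_on k (- {0}) (inverse :: 'a::{real_normed_field, euclidean_space} \<Rightarrow> 'a)"
proof (induction k)
  case 0
  then show ?case by (auto intro!: continuous_intros)
next
  case (Suc k)
  have d: "(inverse has_derivative (\<lambda>v. - (inverse x * v * inverse x))) (at x)" if "x \<noteq> 0" for x :: 'a
    using has_derivative_inverse'[OF that, of UNIV] by simp
  have "Ck_on k (- {0}) (\<lambda>x::'a. frechet_derivative inverse (at x) v)" for v
  proof (rule Ck_on_cong)
    show "Ck_on k (- {0}) (\<lambda>x::'a. - (inverse x * v * inverse x))"
      by (intro Ck_on_bounded_linear[OF bounded_linear_minus[OF bounded_linear_ident]]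
          Ck_on_bilinear[OF bounded_bilinear_mult] Ck_on_const Suc.IH) auto
  qed (auto simp: frechet_derivative_eqI[OF d])
  then show ?case using d by (auto simp: differentiable_def)
qed

lemma Ck_on_sqrt: "Ck_on k {0<..} sqrt"
proof (induction k)
  case 0
  then show ?case by (auto intro!: continuous_intros)
next
  case (Suc k)
  have d: "(sqrt has_derivative (\<lambda>v. inverse (2 * sqrt x) * v)) (at x)" if "x > 0" for x
    by (rule has_derivative_eq_rhs[OF DERIV_real_sqrt[OF that, unfolded has_field_derivative_def]])
      (simp add: fun_eq_iff field_simps)
  have "Ck_on k {0<..} (\<lambda>x. frechet_derivative sqrt (at x) v)" for v
  proof (rule Ck_on_cong)
    show "Ck_on k {0<..} (\<lambda>x. inverse (2 * sqrt x) * v)"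
      by (rule Ck_on_bilinear[OF bounded_bilinear_mult _ Ck_on_compose[OF _ _ _ _ Ck_on_inverse] Ck_on_const])
        (auto intro!: Ck_on_bilinear[OF bounded_bilinear_mult] Ck_on_const Suc.IH)
  qed (auto simp: frechet_derivative_eqI[OF d])
  then show ?case using d by (auto simp: differentiable_def)
qed

lemma smooth_on_frechet:
  "smooth_on S f \<Longrightarrow> smooth_on S (\<lambda>x. frechet_derivative f (at x) v)"
  unfolding smooth_on_def by (metis Ck_on.simps(2))

lemma smooth_on_differentiable: "smooth_on S f \<Longrightarrow> x \<in> S \<Longrightarrow> f differentiable (at x)"
  unfolding smooth_on_def by (metis Ck_on.simps(2))

lemma smooth_on_continuous: "smooth_on S f \<Longrightarrow> continuous_on S f"
  unfolding smooth_on_def by (metis Ck_on.simps(1))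

lemma smooth_on_has_derivative:
  "smooth_on S f \<Longrightarrow> x \<in> S \<Longrightarrow> (f has_derivative frechet_derivative f (at x)) (at x)"
  using smooth_on_differentiable frechet_derivative_works by blast

lemma smooth_on_compose:
  fixes f :: "'b::euclidean_space \<Rightarrow> 'c::real_normed_vector" and g :: "'a::euclidean_space \<Rightarrow> 'b"
  assumes "open S" "open T" "g ` S \<subseteq> T" "smooth_on S g" "smooth_on T f"
  shows "smooth_on S (\<lambda>x. f (g x))"
  unfolding smooth_on_def
proof
  fix k
  have "Ck_on k S g" "Ck_on k T f" using assms(4,5) by (simp_all add: smooth_on_def)
  then show "Ck_on k S (\<lambda>x. f (g x))" by (rule Ck_on_compose[OF assms(1-3)])
qed

lemma smooth_on_cong:
  "open S \<Longrightarrow> (\<And>x. x \<in> S \<Longrightarrow> f x = g x) \<Longrightarrow> smooth_on S f \<Longrightarrow> smooth_on S g"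
  unfolding smooth_on_def using Ck_on_cong by blast

lemma smooth_on_const: "smooth_on S (\<lambda>x. c)"
  unfolding smooth_on_def using Ck_on_const by blast

lemma smooth_on_bounded_linear:
  "bounded_linear L \<Longrightarrow> open S \<Longrightarrow> smooth_on S f \<Longrightarrow> smooth_on S (\<lambda>x. L (f x))"
  unfolding smooth_on_def using Ck_on_bounded_linear[of L S _ f] by simp

lemma smooth_on_add:
  "open S \<Longrightarrow> smooth_on S f \<Longrightarrow> smooth_on S g \<Longrightarrow> smooth_on S (\<lambda>x. f x + g x)"
  unfolding smooth_on_def using Ck_on_add[of S _ f g] by simp

lemma smooth_on_bilinear:
  "bounded_bilinear P \<Longrightarrow> open S \<Longrightarrow> smooth_on S f \<Longrightarrow> smooth_on S g
    \<Longrightarrow> smooth_on S (\<lambda>x. P (f x) (g x))"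
  unfolding smooth_on_def using Ck_on_bilinear[of P S _ f g] by simp

lemma smooth_on_inverse:
  fixes f :: "'a::euclidean_space \<Rightarrow> 'b::{real_normed_field, euclidean_space}"
  shows "open S \<Longrightarrow> smooth_on S f \<Longrightarrow> (\<And>x. x \<in> S \<Longrightarrow> f x \<noteq> 0) \<Longrightarrow> smooth_on S (\<lambda>x. inverse (f x))"
  by (rule smooth_on_compose[of S "- {0}"]) (auto simp: smooth_on_def Ck_on_inverse)

lemma smooth_on_sqrt:
  "open S \<Longrightarrow> smooth_on S f \<Longrightarrow> (\<And>x. x \<in> S \<Longrightarrow> f x > 0) \<Longrightarrow> smooth_on S (\<lambda>x. sqrt (f x))"
  by (rule smooth_on_compose[of S "{0<..}"]) (auto simp: smooth_on_def Ck_on_sqrt)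

lemma smooth_on_subset: "smooth_on S f \<Longrightarrow> T \<subseteq> S \<Longrightarrow> smooth_on T f"
  unfolding smooth_on_def using Ck_on_subset by blast

section \<open>Symmetry of the second derivative\<close>

lemma second_difference_eq:
  fixes f :: "'a::euclidean_space \<Rightarrow> real"
  assumes "smooth_on S f" "r > 0" "\<And>a b. a \<in> {0..r} \<Longrightarrow> b \<in> {0..r} \<Longrightarrow> x + a *\<^sub>R u + b *\<^sub>R w \<in> S"
  obtains a b where "a \<in> {0..r}" "b \<in> {0..r}"
    "f (x + r *\<^sub>R u + r *\<^sub>R w) - f (x + r *\<^sub>R u) - f (x + r *\<^sub>R w) + f x
     = r\<^sup>2 * frechet_derivative (\<lambda>y. frechet_derivative f (at y) u) (at (x + a *\<^sub>R u + b *\<^sub>R w)) w"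
proof -
  let ?D = "\<lambda>y. frechet_derivative f (at y)"
  let ?DD = "\<lambda>y. frechet_derivative (\<lambda>y. ?D y u) (at y)"
  have line: "((\<lambda>t. p + t *\<^sub>R v) has_derivative (\<lambda>h. h *\<^sub>R v)) (at t)" for p v :: 'a and t
    by (auto intro!: derivative_eq_intros)
  have d: "((\<lambda>t. f (p + t *\<^sub>R v)) has_derivative (\<lambda>h. ?D (p + t *\<^sub>R v) (h *\<^sub>R v))) (at t)"
    if "p + t *\<^sub>R v \<in> S" for p v t
    using diff_chain_at[OF line smooth_on_has_derivative[OF assms(1) that]] by (simp add: o_def)
  have dd: "((\<lambda>t. ?D (p + t *\<^sub>R v) u) has_derivative (\<lambda>h. ?DD (p + t *\<^sub>R v) (h *\<^sub>R v))) (at t)"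
    if "p + t *\<^sub>R v \<in> S" for p v t
    using diff_chain_at[OF line smooth_on_has_derivative[OF smooth_on_frechet[OF assms(1)] that]]
    by (simp add: o_def)
  have lin: "?D y (h *\<^sub>R v) = h * ?D y v" "?DD y (h *\<^sub>R v) = h * ?DD y v" if "y \<in> S" for y h v
    using linear_scale[OF linear_frechet_derivative[OF smooth_on_differentiable[OF assms(1) that]]]
      linear_scale[OF linear_frechet_derivative[OF smooth_on_differentiable[OF smooth_on_frechet[OF assms(1)] that]]]
    by auto
  \<comment> \<open>The second difference is the increment of \<open>G\<close> over
    \<open>{0..r}\<close>. The mean value theorem for \<open>G\<close> gives the parameter along
    \<open>u\<close>, and a second application, to the derivative in direction \<open>u\<close>,
    gives the parameter along \<open>w\<close>.\<close>
  define G where "G t = f ((x + r *\<^sub>R w) + t *\<^sub>R u) - f (x + t *\<^sub>R u)" for t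
  have mem: "x + r *\<^sub>R w + t *\<^sub>R u \<in> S" "x + t *\<^sub>R u \<in> S" if "t \<in> {0..r}" for t
    using assms(3)[OF that, of r] assms(3)[OF that, of 0] assms(2) by (auto simp: algebra_simps)
  have dG: "(G has_derivative (\<lambda>h. ?D ((x + r *\<^sub>R w) + t *\<^sub>R u) (h *\<^sub>R u) - ?D (x + t *\<^sub>R u) (h *\<^sub>R u))) (at t)"
    if "t \<in> {0..r}" for t
    unfolding G_def using mem[OF that] by (intro has_derivative_diff d)
  have ex_a: "\<exists>a\<in>{0<..<r}. G r - G 0
      = (\<lambda>h. ?D ((x + r *\<^sub>R w) + a *\<^sub>R u) (h *\<^sub>R u) - ?D (x + a *\<^sub>R u) (h *\<^sub>R u)) (r - 0)"
    by (rule mvt_simple[OF assms(2)]) (rule has_derivative_at_withinI, rule dG, simp)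
  from ex_a[unfolded diff_0_right] obtain a where a: "a \<in> {0<..<r}"
    and Ga: "G r - G 0 = ?D ((x + r *\<^sub>R w) + a *\<^sub>R u) (r *\<^sub>R u) - ?D (x + a *\<^sub>R u) (r *\<^sub>R u)"
    by blast
  have mem2: "(x + a *\<^sub>R u) + b *\<^sub>R w \<in> S" if "b \<in> {0..r}" for b
    using assms(3)[OF _ that, of a] a by auto
  have ex_b: "\<exists>b\<in>{0<..<r}. ?D ((x + a *\<^sub>R u) + r *\<^sub>R w) u - ?D ((x + a *\<^sub>R u) + 0 *\<^sub>R w) u
      = (\<lambda>h. ?DD ((x + a *\<^sub>R u) + b *\<^sub>R w) (h *\<^sub>R w)) (r - 0)"
    by (rule mvt_simple[OF assms(2)]) (rule has_derivative_at_withinI, rule dd, rule mem2, simp)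
  from ex_b[unfolded diff_0_right] obtain b where b: "b \<in> {0<..<r}"
    and Gb: "?D ((x + a *\<^sub>R u) + r *\<^sub>R w) u - ?D ((x + a *\<^sub>R u) + 0 *\<^sub>R w) u = ?DD ((x + a *\<^sub>R u) + b *\<^sub>R w) (r *\<^sub>R w)"
    by blast
  have e: "x + r *\<^sub>R w + a *\<^sub>R u = x + a *\<^sub>R u + r *\<^sub>R w" by simp
  have "G r - G 0 = r * (?D ((x + a *\<^sub>R u) + r *\<^sub>R w) u - ?D (x + a *\<^sub>R u) u)"
    using Ga lin(1) mem2[of r] mem2[of 0] a assms(2) unfolding e by (simp add: algebra_simps)
  also have "\<dots> = r * (r * ?DD ((x + a *\<^sub>R u) + b *\<^sub>R w) w)"
    using Gb lin(2)[OF mem2[of b]] b by simp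
  finally show ?thesis
    using that[of a b] a b by (simp add: G_def power2_eq_square algebra_simps)
qed

text \<open>The second difference is symmetric in \<open>u\<close> and \<open>w\<close>. It equals
  \<open>r\<^sup>2\<close> times either mixed derivative at some point of a small parallelogram,
  where by continuity both mixed derivatives are within \<open>e\<close> of their values at
  \<open>x\<close>.\<close>

lemma second_derivative_symmetric_real:
  fixes f :: "'a::euclidean_space \<Rightarrow> real"
  assumes "open S" "x \<in> S" "smooth_on S f"
  shows "frechet_derivative (\<lambda>y. frechet_derivative f (at y) u) (at x) w
       = frechet_derivative (\<lambda>y. frechet_derivative f (at y) w) (at x) u" (is "?H u w x = ?H w u x")
proof (rule ccontr)
  assume ne: "?H u w x \<noteq> ?H w u x"
  \<comment> \<open>Half the distance, so that two errors below \<open>e\<close> cannot bridge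
    it.\<close>
  define e where "e = \<bar>?H u w x - ?H w u x\<bar> / 2"
  have e: "e > 0" using ne by (simp add: e_def)
  have "isCont (?H u' w') x" for u' w'
    using smooth_on_continuous[OF smooth_on_frechet[OF smooth_on_frechet[OF assms(3)]]] assms(1,2)
    by (simp add: continuous_on_eq_continuous_at)
  then have "\<exists>d>0. \<forall>y. dist y x < d \<longrightarrow> dist (?H u' w' y) (?H u' w' x) < e" for u' w'
    using e unfolding continuous_at_eps_delta by metis
  then obtain d1 d2 where d: "d1 > 0" "\<And>y. dist y x < d1 \<Longrightarrow> dist (?H u w y) (?H u w x) < e"
      "d2 > 0" "\<And>y. dist y x < d2 \<Longrightarrow> dist (?H w u y) (?H w u x) < e" by meson
  obtain d3 where d3: "d3 > 0" "ball x d3 \<subseteq> S" using assms(1,2) openE by blast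
  define d where "d = min d1 (min d2 d3)"
  have "d > 0" using d d3 by (simp add: d_def)
  \<comment> \<open>Keeps the parallelogram within distance \<open>d\<close> of \<open>x\<close>;
    the summand 1 makes the denominator positive even if both directions are zero.\<close>
  define r where "r = d / (2 * (norm u + norm w + 1))"
  have n0: "norm u + norm w + 1 > 0" using norm_ge_zero[of u] norm_ge_zero[of w] by linarith
  have r: "r > 0" using d d3 n0 by (simp add: r_def d_def)
  have rd: "r * (norm u + norm w + 1) = d / 2" 
  proof -
    have "d / (2 * N) * N = d / 2" if "N > 0" for N :: real using that by simp
    then show ?thesis using n0 unfolding r_def by blast
  qed
  have near: "dist (x + a *\<^sub>R u + b *\<^sub>R w) x < d" if "a \<in> {0..r}" "b \<in> {0..r}" for a b
  proof -
    have "dist (x + a *\<^sub>R u + b *\<^sub>R w) x = norm (a *\<^sub>R u + b *\<^sub>R w)" by (simp add: dist_norm)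
    also have "\<dots> \<le> a * norm u + b * norm w" using norm_triangle_ineq[of "a *\<^sub>R u" "b *\<^sub>R w"] that by simp
    also have "\<dots> \<le> r * norm u + r * norm w" using that by (intro add_mono mult_right_mono) auto
    also have "\<dots> < r * (norm u + norm w + 1)" using r by (simp add: algebra_simps)
    also have "\<dots> \<le> d" using rd \<open>d > 0\<close> by linarith
    finally show ?thesis .
  qed
  have S: "x + a *\<^sub>R u + b *\<^sub>R w \<in> S" if "a \<in> {0..r}" "b \<in> {0..r}" for a b
    using near[OF that] d3 by (auto simp: d_def dist_commute)
  obtain a b where ab: "a \<in> {0..r}" "b \<in> {0..r}"
    "f (x + r *\<^sub>R u + r *\<^sub>R w) - f (x + r *\<^sub>R u) - f (x + r *\<^sub>R w) + f x = r\<^sup>2 * ?H u w (x + a *\<^sub>R u + b *\<^sub>R w)"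
    using second_difference_eq[OF assms(3) r S] by blast
  have S': "x + a *\<^sub>R w + b *\<^sub>R u \<in> S" if "a \<in> {0..r}" "b \<in> {0..r}" for a b
    using S[OF that(2,1)] by (simp add: algebra_simps)
  obtain a' b' where ab': "a' \<in> {0..r}" "b' \<in> {0..r}"
    "f (x + r *\<^sub>R w + r *\<^sub>R u) - f (x + r *\<^sub>R w) - f (x + r *\<^sub>R u) + f x = r\<^sup>2 * ?H w u (x + a' *\<^sub>R w + b' *\<^sub>R u)"
    using second_difference_eq[OF assms(3) r S'] by blast
  have comm: "x + r *\<^sub>R w + r *\<^sub>R u = x + r *\<^sub>R u + r *\<^sub>R w" by simp
  have "r\<^sup>2 * ?H u w (x + a *\<^sub>R u + b *\<^sub>R w) = r\<^sup>2 * ?H w u (x + a' *\<^sub>R w + b' *\<^sub>R u)"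
    using ab(3) ab'(3) unfolding comm by linarith
  then have "?H u w (x + a *\<^sub>R u + b *\<^sub>R w) = ?H w u (x + a' *\<^sub>R w + b' *\<^sub>R u)"
    using r by (metis less_irrefl mult_left_cancel power_eq_0_iff)
  moreover have "dist (?H u w (x + a *\<^sub>R u + b *\<^sub>R w)) (?H u w x) < e"
    using d(2)[of "x + a *\<^sub>R u + b *\<^sub>R w"] near[OF ab(1,2)] by (simp add: d_def)
  moreover have swap: "x + a' *\<^sub>R w + b' *\<^sub>R u = x + b' *\<^sub>R u + a' *\<^sub>R w" by simp
  have "dist (?H w u (x + a' *\<^sub>R w + b' *\<^sub>R u)) (?H w u x) < e"
    unfolding swap using d(4)[of "x + b' *\<^sub>R u + a' *\<^sub>R w"] near[OF ab'(2,1)] by (simp add: d_def)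
  ultimately show False unfolding e_def dist_real_def by argo
qed

text \<open>The mean value theorem is scalar, hence the passage to coordinates of the
  target.\<close>

lemma second_derivative_symmetric:
  fixes f :: "'a::euclidean_space \<Rightarrow> 'b::euclidean_space"
  assumes "open S" "x \<in> S" "smooth_on S f"
  shows "frechet_derivative (\<lambda>y. frechet_derivative f (at y) u) (at x) w
       = frechet_derivative (\<lambda>y. frechet_derivative f (at y) w) (at x) u"
proof (rule euclidean_eqI)
  fix b :: 'b assume "b \<in> Basis"
  have sm: "smooth_on S (\<lambda>y. f y \<bullet> b)"
    using Ck_on_bounded_linear[OF bounded_linear_inner_left assms(1), of _ f b] assms(3) by (simp add: smooth_on_def)
  have inner: "frechet_derivative (\<lambda>y. g y \<bullet> b) (at y) v = frechet_derivative g (at y) v \<bullet> b"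
    if "smooth_on S g" "y \<in> S" for g :: "'a \<Rightarrow> 'b" and y v
    using frechet_derivative_eqI[OF bounded_linear.has_derivative[OF bounded_linear_inner_left
        smooth_on_has_derivative[OF that]]] by metis
  have "frechet_derivative (\<lambda>y. frechet_derivative f (at y) u) (at x) w \<bullet> b
      = frechet_derivative (\<lambda>y. frechet_derivative (\<lambda>y. f y \<bullet> b) (at y) u) (at x) w" for u w
  proof -
    have "frechet_derivative (\<lambda>y. frechet_derivative (\<lambda>y. f y \<bullet> b) (at y) u) (at x)
        = frechet_derivative (\<lambda>y. frechet_derivative f (at y) u \<bullet> b) (at x)"
      using inner[OF assms(3)] by (intro frechet_derivative_cong_open[OF assms(1,2)]) auto
    then show ?thesis using inner[OF smooth_on_frechet[OF assms(3)] assms(2)] by simp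
  qed
  then show "frechet_derivative (\<lambda>y. frechet_derivative f (at y) u) (at x) w \<bullet> b
      = frechet_derivative (\<lambda>y. frechet_derivative f (at y) w) (at x) u \<bullet> b"
    using second_derivative_symmetric_real[OF assms(1,2) sm] by simp
qed

section \<open>Smooth functions on a manifold\<close>

text \<open>Smoothness of a germ: on a whole neighbourhood, not just at one point. Products,
  derivatives and changes of frame can then be treated at a point, by means of identities that hold
  only near it.\<close>

definition smooth_at :: "'m::topological_space spin_manifold \<Rightarrow> 'm \<Rightarrow> ('m \<Rightarrow> 'b::real_normed_vector) \<Rightarrow> bool" where
  "smooth_at M x f \<longleftrightarrow> (\<exists>V. open V \<and> x \<in> V \<and> smooth_map M V f)"

lemma smooth_at_eventually:
  assumes "smooth_at M x f"
  shows "\<forall>\<^sub>F y in nhds x. smooth_at M y f"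
proof -
  obtain V where "open V" "x \<in> V" "smooth_map M V f" using assms by (auto simp: smooth_at_def)
  then show ?thesis by (auto simp: smooth_at_def eventually_nhds intro!: exI[of _ V])
qed

lemma eventually_nhdsE:
  assumes "\<forall>\<^sub>F y in nhds x. P y"
  obtains V where "open V" "x \<in> V" "\<And>y. y \<in> V \<Longrightarrow> P y"
  using assms unfolding eventually_nhds by auto

lemma linear_eq_sum_axis:
  fixes w :: "real^'n"
  assumes "linear D"
  shows "D w = (\<Sum>i\<in>UNIV. (w $ i) *\<^sub>R D (axis i 1))"
proof -
  have "D w = D (\<Sum>i\<in>UNIV. (w $ i) *\<^sub>R axis i 1)"
    using basis_expansion[of w] by (simp add: scalar_mult_eq_scaleR)
  then show ?thesis by (simp add: linear_sum[OF assms] linear_scale[OF assms])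
qed

locale manifold =
  fixes M :: "'m::t2_space spin_manifold"
  assumes oriented_atlas: "oriented_atlas (atlas M)"
begin

lemma chart_ex: "\<exists>U \<phi>. (U, \<phi>) \<in> atlas M \<and> x \<in> U"
proof -
  have "(\<Union>(U, \<phi>)\<in>atlas M. U) = UNIV" using oriented_atlas unfolding oriented_atlas_def by (elim conjE)
  then have "x \<in> (\<Union>(U, \<phi>)\<in>atlas M. U)" by simp
  then show ?thesis by auto
qed

lemma chart_atE:
  obtains U \<phi> where "chart_at M x = (U, \<phi>)" "(U, \<phi>) \<in> atlas M" "x \<in> U"
proof -
  have "chart_at M x \<in> atlas M \<and> x \<in> fst (chart_at M x)"
    unfolding chart_at_def by (rule someI_ex) (use chart_ex in force)
  then show ?thesis using that by (metis prod.collapse)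
qed

context
  fixes U \<phi>
  assumes chart: "(U, \<phi>) \<in> atlas M"
begin

lemma chart_open: "open U" and chart_homeo: "homeomorphism U (\<phi> ` U) \<phi> (inv_into U \<phi>)"
  and chart_open_image: "open (\<phi> ` U)"
proof -
  have "\<forall>(U, \<phi>)\<in>atlas M. open U \<and> open (\<phi> ` U) \<and> homeomorphism U (\<phi> ` U) \<phi> (inv_into U \<phi>)"
    using oriented_atlas unfolding oriented_atlas_def by (elim conjE)
  from bspec[OF this chart] show "open U" "homeomorphism U (\<phi> ` U) \<phi> (inv_into U \<phi>)" "open (\<phi> ` U)"
    by simp_all
qed

lemma chart_inv: "x \<in> U \<Longrightarrow> inv_into U \<phi> (\<phi> x) = x"
  using chart_homeo unfolding homeomorphism_def by auto

lemma chart_image_eq: "W \<subseteq> U \<Longrightarrow> \<phi> ` W = \<phi> ` U \<inter> inv_into U \<phi> -` W"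
  using chart_inv by force

lemma chart_image_open: "open W \<Longrightarrow> W \<subseteq> U \<Longrightarrow> open (\<phi> ` W)"
  unfolding chart_image_eq using chart_homeo
  by (intro continuous_open_preimage chart_open_image) (auto simp: homeomorphism_def)

lemma chart_transition:
  assumes "(U', \<psi>) \<in> atlas M"
  shows "smooth_on (\<phi> ` (U \<inter> U')) (\<lambda>p. \<psi> (inv_into U \<phi> p))"
proof -
  have "\<forall>(U, \<phi>)\<in>atlas M. \<forall>(V, \<psi>)\<in>atlas M. smooth_on (\<phi> ` (U \<inter> V)) (\<psi> \<circ> inv_into U \<phi>) \<and>
        (\<forall>p\<in>\<phi> ` (U \<inter> V). det (jacobian (\<psi> \<circ> inv_into U \<phi>) (at p)) > 0)"
    using oriented_atlas unfolding oriented_atlas_def by (elim conjE)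
  from bspec[OF this chart] assms show ?thesis by (auto simp: o_def)
qed

lemma smooth_on_chart:
  assumes "smooth_map M V f" "open V" "W \<subseteq> V" "W \<subseteq> U"
  shows "smooth_on (\<phi> ` W) (\<lambda>p. f (inv_into U \<phi> p))"
proof -
  have "smooth_on (\<phi> ` (V \<inter> U)) (\<lambda>p. f (inv_into U \<phi> p))"
    using assms(1) chart by (auto simp: smooth_map_def o_def)
  then show ?thesis by (rule smooth_on_subset) (use assms in auto)
qed

text \<open>Transition maps are smooth, so smoothness seen in one chart that contains
  \<open>W\<close> passes to all charts.\<close>

lemma smooth_map_chartI:
  assumes "open W" "W \<subseteq> U" and f: "smooth_on (\<phi> ` W) (\<lambda>p. f (inv_into U \<phi> p))"
  shows "smooth_map M W f"
  unfolding smooth_map_def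
proof safe
  fix U' \<psi> assume c': "(U', \<psi>) \<in> atlas M"
  have op: "open (\<psi> ` (W \<inter> U'))" "open (\<phi> ` W)"
    using manifold.chart_image_open[OF manifold_axioms c'] chart_image_open manifold.chart_open[OF manifold_axioms c'] assms(1,2)
    by auto
  have "smooth_on (\<psi> ` (W \<inter> U')) (\<lambda>p. \<phi> (inv_into U' \<psi> p))"
    using manifold.chart_transition[OF manifold_axioms c' chart]
    by (rule smooth_on_subset) (use assms(2) in auto)
  then have "smooth_on (\<psi> ` (W \<inter> U')) (\<lambda>p. f (inv_into U \<phi> (\<phi> (inv_into U' \<psi> p))))"
    using manifold.chart_inv[OF manifold_axioms c']
    by (intro smooth_on_compose[OF op _ _ f]) auto
  then show "smooth_on (\<psi> ` (W \<inter> U')) (f \<circ> inv_into U' \<psi>)"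
    using manifold.chart_inv[OF manifold_axioms c'] chart_inv assms(2)
    by (elim smooth_on_cong[OF op(1), rotated]) auto
qed

lemma smooth_at_chart_iff:
  assumes "x \<in> U"
  shows "smooth_at M x f \<longleftrightarrow>
    (\<exists>W. open W \<and> x \<in> W \<and> W \<subseteq> U \<and> smooth_on (\<phi> ` W) (\<lambda>p. f (inv_into U \<phi> p)))"
proof
  assume "smooth_at M x f"
  then obtain V where "open V" "x \<in> V" "smooth_map M V f" unfolding smooth_at_def by blast
  then show "\<exists>W. open W \<and> x \<in> W \<and> W \<subseteq> U \<and> smooth_on (\<phi> ` W) (\<lambda>p. f (inv_into U \<phi> p))"
    using smooth_on_chart[of V f "V \<inter> U"] chart_open assms by (intro exI[of _ "V \<inter> U"]) auto
qed (auto simp: smooth_at_def intro: smooth_map_chartI)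

end

lemma smooth_map_iff:
  assumes "open V"
  shows "smooth_map M V f \<longleftrightarrow> (\<forall>x\<in>V. smooth_at M x f)"
proof
  assume loc: "\<forall>x\<in>V. smooth_at M x f"
  show "smooth_map M V f"
    unfolding smooth_map_def
  proof safe
    fix U \<phi> assume c: "(U, \<phi>) \<in> atlas M"
    show "smooth_on (\<phi> ` (V \<inter> U)) (f \<circ> inv_into U \<phi>)"
      unfolding smooth_on_def
    proof (intro allI Ck_on_local)
      fix k p assume "p \<in> \<phi> ` (V \<inter> U)"
      then obtain x where x: "x \<in> V" "x \<in> U" "p = \<phi> x" by auto
      then obtain W where W: "open W" "x \<in> W" "W \<subseteq> U" "smooth_on (\<phi> ` W) (\<lambda>p. f (inv_into U \<phi> p))"
        using loc smooth_at_chart_iff[OF c x(2), of f] by auto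
      then show "\<exists>T. open T \<and> p \<in> T \<and> Ck_on k T (f \<circ> inv_into U \<phi>)"
        using chart_image_open[OF c W(1,3)] x by (intro exI[of _ "\<phi> ` W"]) (auto simp: smooth_on_def o_def)
    qed
  qed
qed (use assms in \<open>auto simp: smooth_at_def\<close>)

lemma smooth_at_iff:
  "smooth_at M x f \<longleftrightarrow> (\<exists>W. open W \<and> x \<in> W \<and> W \<subseteq> fst (chart_at M x) \<and>
     smooth_on (snd (chart_at M x) ` W) (\<lambda>p. f (inv_into (fst (chart_at M x)) (snd (chart_at M x)) p)))"
  by (rule chart_atE[of x]) (simp add: smooth_at_chart_iff)

text \<open>All closure properties of smooth functions reduce to a single chart.\<close>

lemma smooth_at_transfer2:
  assumes "\<And>S p q. open S \<Longrightarrow> smooth_on S p \<Longrightarrow> smooth_on S q \<Longrightarrow>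
      (\<And>y. y \<in> S \<Longrightarrow> \<exists>x \<in> V. p y = f x \<and> q y = g x) \<Longrightarrow> smooth_on S (\<lambda>y::real^3. H (p y) (q y))"
    and "open V" "x \<in> V" "smooth_at M x f" "smooth_at M x g"
  shows "smooth_at M x (\<lambda>y. H (f y) (g y))"
proof -
  obtain U \<phi> where c: "(U, \<phi>) \<in> atlas M" "x \<in> U" using chart_ex by blast
  obtain W1 where W1: "open W1" "x \<in> W1" "W1 \<subseteq> U" "smooth_on (\<phi> ` W1) (\<lambda>p. f (inv_into U \<phi> p))"
    using assms(4) smooth_at_chart_iff[OF c, of f] by auto
  obtain W2 where W2: "open W2" "x \<in> W2" "W2 \<subseteq> U" "smooth_on (\<phi> ` W2) (\<lambda>p. g (inv_into U \<phi> p))"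
    using assms(5) smooth_at_chart_iff[OF c, of g] by auto
  let ?W = "W1 \<inter> W2 \<inter> V"
  have W: "open ?W" "x \<in> ?W" "?W \<subseteq> U" using W1 W2 assms(2,3) by auto
  have "smooth_on (\<phi> ` ?W) (\<lambda>p. H (f (inv_into U \<phi> p)) (g (inv_into U \<phi> p)))"
  proof (rule assms(1))
    show "open (\<phi> ` ?W)" using chart_image_open[OF c(1) W(1,3)] .
    show "smooth_on (\<phi> ` ?W) (\<lambda>p. f (inv_into U \<phi> p))" by (rule smooth_on_subset[OF W1(4)]) auto
    show "smooth_on (\<phi> ` ?W) (\<lambda>p. g (inv_into U \<phi> p))" by (rule smooth_on_subset[OF W2(4)]) auto
    show "\<exists>x\<in>V. f (inv_into U \<phi> y) = f x \<and> g (inv_into U \<phi> y) = g x" if "y \<in> \<phi> ` ?W" for y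
      using that W(3) chart_inv[OF c(1)] by force
  qed
  then show ?thesis using W by (intro iffD2[OF smooth_at_chart_iff[OF c]] exI[of _ ?W]) auto
qed

lemma smooth_at_cong:
  assumes "\<forall>\<^sub>F y in nhds x. f y = g y" "smooth_at M x f"
  shows "smooth_at M x g"
proof -
  obtain V where V: "open V" "x \<in> V" "\<And>y. y \<in> V \<Longrightarrow> f y = g y" by (rule eventually_nhdsE[OF assms(1)]) blast
  obtain U \<phi> where c: "(U, \<phi>) \<in> atlas M" "x \<in> U" using chart_ex by blast
  obtain W where W: "open W" "x \<in> W" "W \<subseteq> U" "smooth_on (\<phi> ` W) (\<lambda>p. f (inv_into U \<phi> p))"
    using assms(2) smooth_at_chart_iff[OF c, of f] by auto
  have "smooth_on (\<phi> ` (W \<inter> V)) (\<lambda>p. g (inv_into U \<phi> p))"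
  proof (rule smooth_on_cong)
    show "open (\<phi> ` (W \<inter> V))" using chart_image_open[OF c(1)] W V by auto
    show "smooth_on (\<phi> ` (W \<inter> V)) (\<lambda>p. f (inv_into U \<phi> p))" by (rule smooth_on_subset[OF W(4)]) auto
    show "f (inv_into U \<phi> p) = g (inv_into U \<phi> p)" if "p \<in> \<phi> ` (W \<inter> V)" for p
      using that chart_inv[OF c(1)] W(3) V(3) by auto
  qed
  then show ?thesis using W V by (intro iffD2[OF smooth_at_chart_iff[OF c]] exI[of _ "W \<inter> V"]) auto
qed

lemma smooth_at_const: "smooth_at M x (\<lambda>y. c)"
  by (auto simp: smooth_at_def smooth_map_def o_def smooth_on_const intro: exI[of _ UNIV])

lemma smooth_at_bilinear:
  assumes "bounded_bilinear P" "smooth_at M x f" "smooth_at M x g"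
  shows "smooth_at M x (\<lambda>y. P (f y) (g y))"
  by (rule smooth_at_transfer2[where V = UNIV]) (use assms in \<open>simp_all add: smooth_on_bilinear\<close>)

lemma smooth_at_linear:
  assumes "bounded_linear L" "smooth_at M x f"
  shows "smooth_at M x (\<lambda>y. L (f y))"
  by (rule smooth_at_transfer2[where V = UNIV and H = "\<lambda>p q. L p" and g = f])
    (use assms in \<open>simp_all add: smooth_on_bounded_linear\<close>)

lemma smooth_at_add:
  assumes "smooth_at M x f" "smooth_at M x g"
  shows "smooth_at M x (\<lambda>y. f y + g y)"
  by (rule smooth_at_transfer2[where V = UNIV]) (use assms in \<open>simp_all add: smooth_on_add\<close>)

lemma smooth_at_sum:
  "(\<And>i. i \<in> I \<Longrightarrow> smooth_at M x (f i)) \<Longrightarrow> smooth_at M x (\<lambda>y. \<Sum>i\<in>I. f i y)"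
proof (induction I rule: infinite_finite_induct)
  case (insert i I)
  have "smooth_at M x (\<lambda>y. f i y + (\<Sum>i\<in>I. f i y))"
    using insert by (intro smooth_at_add) simp_all
  then show ?case using insert.hyps by simp
qed (simp_all add: smooth_at_const)

lemma smooth_at_isCont:
  assumes "smooth_at M x f"
  shows "isCont f x"
proof -
  obtain U \<phi> where c: "(U, \<phi>) \<in> atlas M" "x \<in> U" using chart_ex by blast
  obtain W where W: "open W" "x \<in> W" "W \<subseteq> U" "smooth_on (\<phi> ` W) (\<lambda>p. f (inv_into U \<phi> p))"
    using assms smooth_at_chart_iff[OF c, of f] by auto
  have "continuous_on W \<phi>" using chart_homeo[OF c(1)] W(3) by (auto simp: homeomorphism_def intro: continuous_on_subset)
  then have "continuous_on W (\<lambda>y. f (inv_into U \<phi> (\<phi> y)))"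
    by (rule continuous_on_compose2[OF smooth_on_continuous[OF W(4)]]) auto
  then have "continuous_on W f" by (rule continuous_on_eq) (use chart_inv[OF c(1)] W(3) in auto)
  then show ?thesis using W(1,2) by (simp add: continuous_on_eq_continuous_at)
qed

lemma smooth_at_inverse:
  fixes f :: "'m \<Rightarrow> 'b::{real_normed_field, euclidean_space}"
  assumes "smooth_at M x f" "f x \<noteq> 0"
  shows "smooth_at M x (\<lambda>y. inverse (f y))"
proof -
  have ev: "\<forall>\<^sub>F y in nhds x. f y \<noteq> 0"
    using tendsto_imp_eventually_ne[OF smooth_at_isCont[OF assms(1), unfolded isCont_def] assms(2)] assms(2)
    by (simp add: eventually_nhds_conv_at)
  then obtain V where V: "open V" "x \<in> V" "\<And>y. y \<in> V \<Longrightarrow> f y \<noteq> 0" by (rule eventually_nhdsE) blast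
  show ?thesis
    by (rule smooth_at_transfer2[where V = V and H = "\<lambda>p q. inverse p" and g = f])
      (use assms V in \<open>auto intro!: smooth_on_inverse, metis\<close>)
qed

lemma smooth_at_sqrt:
  assumes "smooth_at M x f" "f x > 0"
  shows "smooth_at M x (\<lambda>y. sqrt (f y))"
proof -
  have ev: "\<forall>\<^sub>F y in nhds x. f y > 0"
    using order_tendstoD(1)[OF smooth_at_isCont[OF assms(1), unfolded isCont_def] assms(2)] assms(2)
    by (simp add: eventually_nhds_conv_at)
  then obtain V where V: "open V" "x \<in> V" "\<And>y. y \<in> V \<Longrightarrow> f y > 0" by (rule eventually_nhdsE) blast
  show ?thesis
    by (rule smooth_at_transfer2[where V = V and H = "\<lambda>p q. sqrt p" and g = f])
      (use assms V in \<open>auto intro!: smooth_on_sqrt, metis\<close>)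
qed

lemma smooth_at_chart:
  assumes c: "(U, \<phi>) \<in> atlas M" "x \<in> U"
  shows "smooth_at M x \<phi>"
proof (rule iffD2[OF smooth_at_chart_iff[OF c]], intro exI[of _ U] conjI)
  show "smooth_on (\<phi> ` U) (\<lambda>p. \<phi> (inv_into U \<phi> p))" using chart_transition[OF c(1) c(1)] by simp
qed (use c chart_open[OF c(1)] in auto)

subsection \<open>Derivatives\<close>

text \<open>The relational counterpart of \<open>mderiv\<close>: being a statement about
  \<open>has_derivative\<close> in the preferred chart at \<open>x\<close>, it inherits the sum,
  product and chain rules.\<close>

definition has_mderiv :: "('m \<Rightarrow> 'b::real_normed_vector) \<Rightarrow> (real^3 \<Rightarrow> 'b) \<Rightarrow> 'm \<Rightarrow> bool" where
  "has_mderiv f f' x \<longleftrightarrow>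
     ((\<lambda>p. f (inv_into (fst (chart_at M x)) (snd (chart_at M x)) p)) has_derivative f') (at (snd (chart_at M x) x))"

lemma mderiv_eqI: "has_mderiv f f' x \<Longrightarrow> mderiv M f x = f'"
  unfolding has_mderiv_def mderiv_def o_def
  by (auto simp: case_prod_beta Let_def frechet_derivative_eqI)

lemma chart_inv_at: "inv_into (fst (chart_at M x)) (snd (chart_at M x)) (snd (chart_at M x) x) = x"
  by (rule chart_atE[of x]) (simp add: chart_inv)

lemma smooth_at_has_mderiv: "smooth_at M x f \<Longrightarrow> has_mderiv f (mderiv M f x) x"
  unfolding smooth_at_iff has_mderiv_def mderiv_def o_def
  by (auto simp: case_prod_beta Let_def intro!: smooth_on_has_derivative)

lemma smooth_at_has_derivative:
  assumes "smooth_at M x f"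
  shows "((\<lambda>p. f (inv_into (fst (chart_at M x)) (snd (chart_at M x)) p))
     has_derivative mderiv M f x) (at (snd (chart_at M x) x))"
  using smooth_at_has_mderiv[OF assms] by (simp only: has_mderiv_def)

lemma mderiv_cong:
  assumes "\<forall>\<^sub>F y in nhds x. f y = g y"
  shows "mderiv M f x = mderiv M g x"
proof -
  obtain V where V: "open V" "x \<in> V" "\<And>y. y \<in> V \<Longrightarrow> f y = g y" by (rule eventually_nhdsE[OF assms]) blast
  obtain U \<phi> where c: "chart_at M x = (U, \<phi>)" "(U, \<phi>) \<in> atlas M" "x \<in> U" by (rule chart_atE)
  have "frechet_derivative (f \<circ> inv_into U \<phi>) (at (\<phi> x)) = frechet_derivative (g \<circ> inv_into U \<phi>) (at (\<phi> x))"
  proof (rule frechet_derivative_cong_open)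
    show "open (\<phi> ` (U \<inter> V))" using chart_image_open[OF c(2)] chart_open[OF c(2)] V(1) by auto
    show "(f \<circ> inv_into U \<phi>) y = (g \<circ> inv_into U \<phi>) y" if "y \<in> \<phi> ` (U \<inter> V)" for y
      using that chart_inv[OF c(2)] V(3) by auto
  qed (use c V in auto)
  then show ?thesis by (simp add: mderiv_def c fun_eq_iff)
qed

lemma mderiv_const: "mderiv M (\<lambda>y. c) x v = 0"
  by (simp add: mderiv_def o_def case_prod_beta Let_def)

lemma mderiv_bilinear:
  assumes "bounded_bilinear P" "smooth_at M x f" "smooth_at M x g"
  shows "mderiv M (\<lambda>y. P (f y) (g y)) x v = P (f x) (mderiv M g x v) + P (mderiv M f x v) (g x)"
proof -
  have "has_mderiv (\<lambda>y. P (f y) (g y)) (\<lambda>v. P (f x) (mderiv M g x v) + P (mderiv M f x v) (g x)) x"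
    unfolding has_mderiv_def
    by (rule has_derivative_eq_rhs, rule bounded_bilinear.FDERIV[OF assms(1)],
        rule smooth_at_has_derivative[OF assms(2)], rule smooth_at_has_derivative[OF assms(3)])
      (simp add: chart_inv_at)
  then show ?thesis by (simp add: mderiv_eqI)
qed

lemma mderiv_linear:
  assumes "bounded_linear L" "smooth_at M x f"
  shows "mderiv M (\<lambda>y. L (f y)) x v = L (mderiv M f x v)"
proof -
  have "has_mderiv (\<lambda>y. L (f y)) (\<lambda>v. L (mderiv M f x v)) x"
    unfolding has_mderiv_def
    by (rule bounded_linear.has_derivative[OF assms(1)], rule smooth_at_has_derivative[OF assms(2)])
  then show ?thesis by (simp add: mderiv_eqI)
qed

lemma mderiv_add:
  assumes "smooth_at M x f" "smooth_at M x g"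
  shows "mderiv M (\<lambda>y. f y + g y) x v = mderiv M f x v + mderiv M g x v"
proof -
  have "has_mderiv (\<lambda>y. f y + g y) (\<lambda>v. mderiv M f x v + mderiv M g x v) x"
    unfolding has_mderiv_def
    by (rule has_derivative_add, rule smooth_at_has_derivative[OF assms(1)], rule smooth_at_has_derivative[OF assms(2)])
  then show ?thesis by (simp add: mderiv_eqI)
qed

lemma mderiv_inverse:
  fixes f :: "'m \<Rightarrow> 'b::{real_normed_field, euclidean_space}"
  assumes "smooth_at M x f" "f x \<noteq> 0"
  shows "mderiv M (\<lambda>y. inverse (f y)) x v = - (mderiv M f x v) / (f x)\<^sup>2"
proof -
  have "has_mderiv (\<lambda>y. inverse (f y)) (\<lambda>v. - (inverse (f x) * mderiv M f x v * inverse (f x))) x"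
    unfolding has_mderiv_def
    using has_derivative_compose[OF smooth_at_has_derivative[OF assms(1)] has_derivative_inverse'] assms(2)
    by (simp add: chart_inv_at)
  then show ?thesis using assms(2) by (simp add: mderiv_eqI field_simps power2_eq_square)
qed

lemma linear_mderiv: "smooth_at M x f \<Longrightarrow> linear (mderiv M f x)"
  by (rule has_derivative_linear[OF smooth_at_has_derivative])

lemma mderiv_chart_self:
  assumes "chart_at M x = (U, \<phi>)"
  shows "mderiv M \<phi> x v = v"
proof -
  have c: "(U, \<phi>) \<in> atlas M" "x \<in> U" using assms by (metis chart_atE prod.inject)+
  have "frechet_derivative (\<phi> \<circ> inv_into U \<phi>) (at (\<phi> x)) = frechet_derivative (\<lambda>p. p) (at (\<phi> x))"
    by (rule frechet_derivative_cong_open[of "\<phi> ` U"]) (use c chart_open_image chart_inv in auto)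
  then show ?thesis by (simp add: mderiv_def assms)
qed

text \<open>Chain rule for the change from the preferred chart at \<open>x\<close> to a fixed chart:
  the derivative of \<open>\<phi>\<close> turns \<open>v\<close> into its components there. The
  preferred chart jumps with \<open>x\<close>, so smooth dependence on the point becomes visible
  only in this form.\<close>

lemma mderiv_in_chart:
  assumes c: "(U, \<phi>) \<in> atlas M" "x \<in> U" and f: "smooth_at M x f"
  shows "mderiv M f x v = frechet_derivative (\<lambda>p. f (inv_into U \<phi> p)) (at (\<phi> x)) (mderiv M \<phi> x v)"
proof -
  obtain U0 \<phi>0 where c0: "chart_at M x = (U0, \<phi>0)" "(U0, \<phi>0) \<in> atlas M" "x \<in> U0" by (rule chart_atE)
  obtain W where W: "open W" "x \<in> W" "W \<subseteq> U" "smooth_on (\<phi> ` W) (\<lambda>p. f (inv_into U \<phi> p))"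
    using f smooth_at_chart_iff[OF c, of f] by auto
  have 1: "((\<lambda>p. \<phi> (inv_into U0 \<phi>0 p)) has_derivative mderiv M \<phi> x) (at (\<phi>0 x))"
    using smooth_at_has_mderiv[OF smooth_at_chart[OF c]] by (simp add: has_mderiv_def c0)
  have 2: "((\<lambda>p. f (inv_into U \<phi> p)) has_derivative frechet_derivative (\<lambda>p. f (inv_into U \<phi> p)) (at (\<phi> x)))
      (at (\<phi> (inv_into U0 \<phi>0 (\<phi>0 x))))"
    using smooth_on_has_derivative[OF W(4), of "\<phi> x"] W(2) chart_inv[OF c0(2,3)] by simp
  have 3: "((\<lambda>p. f (inv_into U \<phi> (\<phi> (inv_into U0 \<phi>0 p)))) has_derivative
      (\<lambda>v. frechet_derivative (\<lambda>p. f (inv_into U \<phi> p)) (at (\<phi> x)) (mderiv M \<phi> x v))) (at (\<phi>0 x))"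
    using diff_chain_at[OF 1 2] by (simp add: o_def)
  have "((\<lambda>p. f (inv_into U0 \<phi>0 p)) has_derivative
      (\<lambda>v. frechet_derivative (\<lambda>p. f (inv_into U \<phi> p)) (at (\<phi> x)) (mderiv M \<phi> x v))) (at (\<phi>0 x))"
  proof (rule has_derivative_transform_within_open[OF 3])
    show "open (\<phi>0 ` (U \<inter> U0))" using chart_image_open[OF c0(2)] chart_open[OF c0(2)] chart_open[OF c(1)] by auto
    show "f (inv_into U \<phi> (\<phi> (inv_into U0 \<phi>0 p))) = f (inv_into U0 \<phi>0 p)" if "p \<in> \<phi>0 ` (U \<inter> U0)" for p
      using that chart_inv[OF c0(2)] chart_inv[OF c(1)] by auto
  qed (use c c0 in auto)
  then have "has_mderiv f (\<lambda>v. frechet_derivative (\<lambda>p. f (inv_into U \<phi> p)) (at (\<phi> x)) (mderiv M \<phi> x v)) x"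
    by (simp add: has_mderiv_def c0)
  then show ?thesis by (simp add: mderiv_eqI)
qed

text \<open>The coordinate change and its inverse compose to the identity near
  \<open>\<phi> x\<close>, so their derivatives are inverse to each other.\<close>

lemma mderiv_chart_coord_vector:
  assumes c: "(U, \<phi>) \<in> atlas M" "x \<in> U"
  shows "mderiv M \<phi> x (coord_vector M (U, \<phi>) x v) = v"
proof -
  obtain U0 \<phi>0 where c0: "chart_at M x = (U0, \<phi>0)" "(U0, \<phi>0) \<in> atlas M" "x \<in> U0" by (rule chart_atE)
  have 1: "((\<lambda>p. \<phi>0 (inv_into U \<phi> p)) has_derivative coord_vector M (U, \<phi>) x) (at (\<phi> x))"
  proof -
    have "coord_vector M (U, \<phi>) x = frechet_derivative (\<lambda>p. \<phi>0 (inv_into U \<phi> p)) (at (\<phi> x))"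
      by (simp add: coord_vector_def o_def c0 fun_eq_iff)
    then show ?thesis
      using smooth_on_has_derivative[OF chart_transition[OF c(1) c0(2)], of "\<phi> x"] c c0 by simp
  qed
  have 2: "((\<lambda>p. \<phi> (inv_into U0 \<phi>0 p)) has_derivative mderiv M \<phi> x) (at (\<phi>0 (inv_into U \<phi> (\<phi> x))))"
    using smooth_at_has_mderiv[OF smooth_at_chart[OF c]] chart_inv[OF c] by (simp add: has_mderiv_def c0)
  have 3: "((\<lambda>p. \<phi> (inv_into U0 \<phi>0 (\<phi>0 (inv_into U \<phi> p)))) has_derivative
      (\<lambda>v. mderiv M \<phi> x (coord_vector M (U, \<phi>) x v))) (at (\<phi> x))"
    using diff_chain_at[OF 1 2] by (simp add: o_def)
  have "((\<lambda>p. p) has_derivative (\<lambda>v. mderiv M \<phi> x (coord_vector M (U, \<phi>) x v))) (at (\<phi> x))"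
  proof (rule has_derivative_transform_within_open[OF 3])
    show "open (\<phi> ` (U \<inter> U0))" using chart_image_open[OF c(1)] chart_open[OF c0(2)] chart_open[OF c(1)] by auto
    show "\<phi> (inv_into U0 \<phi>0 (\<phi>0 (inv_into U \<phi> p))) = p" if "p \<in> \<phi> ` (U \<inter> U0)" for p
      using that chart_inv[OF c0(2)] chart_inv[OF c(1)] by auto
  qed (use c c0 in auto)
  then show ?thesis using has_derivative_unique[OF _ has_derivative_ident] by metis
qed

lemma mderiv_coord_vector:
  assumes "(U, \<phi>) \<in> atlas M" "x \<in> U" "smooth_at M x f"
  shows "mderiv M f x (coord_vector M (U, \<phi>) x v) = frechet_derivative (\<lambda>p. f (inv_into U \<phi> p)) (at (\<phi> x)) v"
  by (simp only: mderiv_in_chart[OF assms] mderiv_chart_coord_vector[OF assms(1,2)])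

lemma smooth_at_chart_derivative:
  assumes c: "(U, \<phi>) \<in> atlas M" "x \<in> U" and f: "smooth_at M x f"
  shows "smooth_at M x (\<lambda>y. frechet_derivative (\<lambda>p. f (inv_into U \<phi> p)) (at (\<phi> y)) v)"
proof -
  obtain W where W: "open W" "x \<in> W" "W \<subseteq> U" "smooth_on (\<phi> ` W) (\<lambda>p. f (inv_into U \<phi> p))"
    using f smooth_at_chart_iff[OF c, of f] by auto
  have "smooth_on (\<phi> ` W) (\<lambda>p. frechet_derivative (\<lambda>p. f (inv_into U \<phi> p)) (at (\<phi> (inv_into U \<phi> p))) v)"
    by (rule smooth_on_cong[OF chart_image_open[OF c(1) W(1,3)] _ smooth_on_frechet[OF W(4)]])
      (use chart_inv[OF c(1)] W(3) in auto)
  then show ?thesis using W by (intro iffD2[OF smooth_at_chart_iff[OF c]] exI[of _ W]) auto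
qed

lemma smooth_at_mderiv_coord_vector:
  assumes c: "c \<in> atlas M" "x \<in> fst c" and f: "smooth_at M x f"
  shows "smooth_at M x (\<lambda>y. mderiv M f y (coord_vector M c y v))"
proof -
  obtain U \<phi> where U: "c = (U, \<phi>)" by force
  have c': "(U, \<phi>) \<in> atlas M" "x \<in> U" using c U by auto
  have "\<forall>\<^sub>F y in nhds x. y \<in> U" using c' chart_open eventually_nhds by blast
  then have "\<forall>\<^sub>F y in nhds x. frechet_derivative (\<lambda>p. f (inv_into U \<phi> p)) (at (\<phi> y)) v = mderiv M f y (coord_vector M c y v)"
    using smooth_at_eventually[OF f] 
    by eventually_elim (simp only: mderiv_coord_vector[OF c'(1)] U)
  then show ?thesis by (rule smooth_at_cong[OF _ smooth_at_chart_derivative[OF c' f]])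
qed

section \<open>Vector fields, Lie brackets and curves\<close>

lemma smooth_at_vector_field:
  assumes "smooth_vector_field M U X" "open U" "x \<in> U" "(V, \<phi>) \<in> atlas M" "x \<in> V"
  shows "smooth_at M x (\<lambda>y. mderiv M \<phi> y (X y))"
proof -
  have "smooth_map M (U \<inter> V) (\<lambda>y. mderiv M \<phi> y (X y))" using assms(1,4) by (auto simp: smooth_vector_field_def)
  then show ?thesis using assms(2,3,5) chart_open[OF assms(4)] by (auto simp: smooth_at_def)
qed

text \<open>The expansion of a vector field in coordinate fields: coefficients and partial
  derivatives are taken in one chart for all nearby points, so both depend smoothly on the point
  when \<open>X\<close> is smooth.\<close>

lemma mderiv_field_in_chart:
  assumes c: "(U, \<phi>) \<in> atlas M" "x \<in> U" and f: "smooth_at M x f"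
  shows "\<forall>\<^sub>F y in nhds x. mderiv M f y (X y)
     = (\<Sum>i\<in>UNIV. (mderiv M \<phi> y (X y) $ i) *\<^sub>R frechet_derivative (\<lambda>p. f (inv_into U \<phi> p)) (at (\<phi> y)) (axis i 1))"
proof -
  have "\<forall>\<^sub>F y in nhds x. y \<in> U" using c chart_open eventually_nhds by blast
  then show ?thesis using smooth_at_eventually[OF f]
  proof eventually_elim
    case (elim y)
    have y: "(U, \<phi>) \<in> atlas M" "y \<in> U" using c elim by auto
    let ?D = "frechet_derivative (\<lambda>p. f (inv_into U \<phi> p)) (at (\<phi> y))"
    obtain W where W: "open W" "y \<in> W" "W \<subseteq> U" "smooth_on (\<phi> ` W) (\<lambda>p. f (inv_into U \<phi> p))"
      using elim(2) smooth_at_chart_iff[OF y, of f] by auto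
    have "linear ?D" by (rule linear_frechet_derivative, rule smooth_on_differentiable[OF W(4)]) (use W(2) in auto)
    from linear_eq_sum_axis[OF this, of "mderiv M \<phi> y (X y)"] show ?case using mderiv_in_chart[OF y elim(2)] by simp
  qed
qed

lemma smooth_at_nth: "smooth_at M x f \<Longrightarrow> smooth_at M x (\<lambda>y. f y $ i)"
  by (rule smooth_at_linear[OF bounded_linear_vec_nth])

lemma smooth_at_mderiv_field:
  assumes X: "smooth_vector_field M U X" "open U" "x \<in> U" and f: "smooth_at M x f"
  shows "smooth_at M x (\<lambda>y. mderiv M f y (X y))"
proof -
  obtain V \<phi> where c: "(V, \<phi>) \<in> atlas M" "x \<in> V" using chart_ex by blast
  have "smooth_at M x (\<lambda>y. \<Sum>i\<in>UNIV. (mderiv M \<phi> y (X y) $ i) *\<^sub>R frechet_derivative (\<lambda>p. f (inv_into V \<phi> p)) (at (\<phi> y)) (axis i 1))"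
    by (intro smooth_at_sum smooth_at_bilinear[OF bounded_bilinear_scaleR] smooth_at_nth
        smooth_at_vector_field[OF X c] smooth_at_chart_derivative[OF c f])
  then show ?thesis
    by (rule smooth_at_cong[OF eventually_mono[OF mderiv_field_in_chart[OF c f, of X]], rotated]) simp
qed

lemma mderiv_sum:
  "(\<And>i. i \<in> I \<Longrightarrow> smooth_at M x (f i)) \<Longrightarrow> mderiv M (\<lambda>y. \<Sum>i\<in>I. f i y) x v = (\<Sum>i\<in>I. mderiv M (f i) x v)"
proof (induction I rule: infinite_finite_induct)
  case (insert i I)
  have "mderiv M (\<lambda>y. f i y + (\<Sum>i\<in>I. f i y)) x v = mderiv M (f i) x v + mderiv M (\<lambda>y. \<Sum>i\<in>I. f i y) x v"
    using insert by (intro mderiv_add smooth_at_sum) simp_all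
  then show ?case using insert by simp
qed (simp_all add: mderiv_const)

text \<open>In the chart the product rule yields second derivatives of \<open>f\<close>, which
  cancel by symmetry, and first derivatives of the components of the fields, which form
  \<open>lie_bracket\<close>.\<close>

lemma mderiv_lie_bracket:
  fixes f :: "'m \<Rightarrow> 'b::euclidean_space"
  assumes X: "smooth_vector_field M U X" and Y: "smooth_vector_field M U Y" and U: "open U" "x \<in> U"
    and f: "smooth_at M x f"
  shows "mderiv M (\<lambda>y. mderiv M f y (Y y)) x (X x) - mderiv M (\<lambda>y. mderiv M f y (X y)) x (Y x)
    = mderiv M f x (lie_bracket M X Y x)"
proof -
  obtain V \<phi> where c: "chart_at M x = (V, \<phi>)" "(V, \<phi>) \<in> atlas M" "x \<in> V" by (rule chart_atE)
  note c' = c(2,3)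
  let ?F = "\<lambda>p. f (inv_into V \<phi> p)"
  let ?D = "\<lambda>y. frechet_derivative ?F (at (\<phi> y))"
  obtain W where W: "open W" "x \<in> W" "W \<subseteq> V" "smooth_on (\<phi> ` W) ?F"
    using f smooth_at_chart_iff[OF c', of f] by auto
  have Wo: "open (\<phi> ` W)" "\<phi> x \<in> \<phi> ` W" using chart_image_open[OF c(2) W(1,3)] W(2) by auto
  let ?H = "\<lambda>u w. frechet_derivative (\<lambda>p. frechet_derivative ?F (at p) u) (at (\<phi> x)) w"
  \<comment> \<open>At \<open>x\<close> itself the chart is the preferred one, so components need no
    conversion.\<close>
  have D: "?D x = mderiv M f x"
    using mderiv_in_chart[OF c' f] mderiv_chart_self[OF c(1)] by (simp add: fun_eq_iff)
  have DD: "mderiv M (\<lambda>y. ?D y u) x w = ?H u w" for u w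
  proof -
    have "frechet_derivative (\<lambda>p. frechet_derivative ?F (at (\<phi> (inv_into V \<phi> p))) u) (at (\<phi> x))
        = frechet_derivative (\<lambda>p. frechet_derivative ?F (at p) u) (at (\<phi> x))"
      by (rule frechet_derivative_cong_open[OF Wo]) (use chart_inv[OF c(2)] W(3) in auto)
    then show ?thesis by (simp add: mderiv_def c o_def)
  qed
  have Hsum: "(\<Sum>i\<in>UNIV. (w $ i) *\<^sub>R ?H u (axis i 1)) = ?H u w" for u and w :: "real^3"
  proof -
    have "linear (?H u)"
      by (intro linear_frechet_derivative smooth_on_differentiable[OF smooth_on_frechet[OF W(4)]] Wo)
    from linear_eq_sum_axis[OF this, of w] show ?thesis by simp
  qed
  have Hsum': "(\<Sum>i\<in>UNIV. (u $ i) *\<^sub>R ?H (axis i 1) w) = ?H w u" for u w :: "real^3"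
    using Hsum[of u w] second_derivative_symmetric[OF Wo W(4)] by simp
  have Dsum: "(\<Sum>i\<in>UNIV. (w $ i) *\<^sub>R ?D x (axis i 1)) = ?D x w" for w :: "real^3"
  proof -
    have "linear (?D x)" by (intro linear_frechet_derivative smooth_on_differentiable[OF W(4)] Wo)
    from linear_eq_sum_axis[OF this, of w] show ?thesis by simp
  qed
  have main: "mderiv M (\<lambda>y. mderiv M f y (Y y)) x v
      = ?H (mderiv M \<phi> x (Y x)) v + ?D x (mderiv M (\<lambda>y. mderiv M \<phi> y (Y y)) x v)"
    if Y: "smooth_vector_field M U Y" for Y v
  proof -
    have sm: "smooth_at M x (\<lambda>y. mderiv M \<phi> y (Y y))" by (rule smooth_at_vector_field[OF Y U c'])
    have smi: "smooth_at M x (\<lambda>y. mderiv M \<phi> y (Y y) $ i)" for i by (rule smooth_at_nth[OF sm])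
    note smD = smooth_at_chart_derivative[OF c' f]
    have nth: "mderiv M (\<lambda>y. mderiv M \<phi> y (Y y) $ i) x v = mderiv M (\<lambda>y. mderiv M \<phi> y (Y y)) x v $ i" for i
      by (rule mderiv_linear[OF bounded_linear_vec_nth sm])
    have "mderiv M (\<lambda>y. mderiv M f y (Y y)) x v
      = mderiv M (\<lambda>y. \<Sum>i\<in>UNIV. (mderiv M \<phi> y (Y y) $ i) *\<^sub>R ?D y (axis i 1)) x v"
      using mderiv_cong[OF mderiv_field_in_chart[OF c' f, of Y]] by simp
    also have "\<dots> = (\<Sum>i\<in>UNIV. mderiv M (\<lambda>y. (mderiv M \<phi> y (Y y) $ i) *\<^sub>R ?D y (axis i 1)) x v)"
      by (intro mderiv_sum smooth_at_bilinear[OF bounded_bilinear_scaleR] smi smD)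
    also have "\<dots> = (\<Sum>i\<in>UNIV. (mderiv M \<phi> x (Y x) $ i) *\<^sub>R ?H (axis i 1) v
        + (mderiv M (\<lambda>y. mderiv M \<phi> y (Y y)) x v $ i) *\<^sub>R ?D x (axis i 1))"
      by (simp only: mderiv_bilinear[OF bounded_bilinear_scaleR smi smD] DD nth)
    also have "\<dots> = ?H v (mderiv M \<phi> x (Y x)) + ?D x (mderiv M (\<lambda>y. mderiv M \<phi> y (Y y)) x v)"
      by (simp only: sum.distrib Hsum' Dsum)
    also have "?H v (mderiv M \<phi> x (Y x)) = ?H (mderiv M \<phi> x (Y x)) v"
      by (rule second_derivative_symmetric[OF Wo W(4)])
    finally show ?thesis .
  qed
  have lb: "lie_bracket M X Y x
    = mderiv M (\<lambda>y. mderiv M \<phi> y (Y y)) x (X x) - mderiv M (\<lambda>y. mderiv M \<phi> y (X y)) x (Y x)"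
    by (simp add: lie_bracket_def c)
  have "mderiv M (\<lambda>y. mderiv M f y (Y y)) x (X x) - mderiv M (\<lambda>y. mderiv M f y (X y)) x (Y x)
     = ?D x (mderiv M (\<lambda>y. mderiv M \<phi> y (Y y)) x (X x)) - ?D x (mderiv M (\<lambda>y. mderiv M \<phi> y (X y)) x (Y x))"
    unfolding main[OF Y] main[OF X] mderiv_chart_self[OF c(1)]
    using second_derivative_symmetric[OF Wo W(4), of "Y x" "X x"] by simp
  then show ?thesis using linear_diff[OF linear_mderiv[OF f]] by (simp add: lb D)
qed

lemma has_vector_derivative_along_curve:
  fixes c :: "real \<Rightarrow> 'm"
  assumes c: "piecewise_C1_curve M T c" and t: "t \<in> {0<..<1} - T" and f: "smooth_at M (c t) f"
  shows "((\<lambda>t. f (c t)) has_vector_derivative mderiv M f (c t) (velocity M c t)) (at t)"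
proof -
  obtain U \<phi> where ch: "chart_at M (c t) = (U, \<phi>)" "(U, \<phi>) \<in> atlas M" "c t \<in> U" by (rule chart_atE)
  have "(\<phi> \<circ> c) C1_differentiable_on ({t \<in> {0<..<1}. c t \<in> U} - T)"
    using c ch(2) by (auto simp: piecewise_C1_curve_def)
  then obtain D where D: "\<And>t. t \<in> {t \<in> {0<..<1}. c t \<in> U} - T \<Longrightarrow> (\<phi> \<circ> c has_vector_derivative D t) (at t)"
    unfolding C1_differentiable_on_def by blast
  have d: "(\<phi> \<circ> c has_vector_derivative velocity M c t) (at t)"
    using D[of t] t ch(3) by (auto simp: velocity_def ch(1) vector_derivative_at)
  have "((\<lambda>p. f (inv_into U \<phi> p)) has_derivative mderiv M f (c t)) (at (\<phi> (c t)))"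
    using smooth_at_has_mderiv[OF f] by (simp add: has_mderiv_def ch)
  then have "((\<lambda>s. f (inv_into U \<phi> ((\<phi> \<circ> c) s))) has_vector_derivative mderiv M f (c t) (velocity M c t)) (at t)"
    using vector_derivative_diff_chain_within[OF d, of "\<lambda>p. f (inv_into U \<phi> p)" "mderiv M f (c t)"]
    by (simp add: o_def has_derivative_at_withinI)
  \<comment> \<open>Near \<open>t\<close> the curve stays in the chart, so the chart expression may
    be replaced by \<open>f\<close> along the curve in a two-sided neighbourhood of
    \<open>t\<close>.\<close>
  moreover have "open {s \<in> {0<..<1}. c s \<in> U}"
  proof -
    have "continuous_on {0<..<1} c"
      using c unfolding piecewise_C1_curve_def by (auto intro: continuous_on_subset)
    then have "open ({0<..<1} \<inter> c -` U)" by (intro continuous_open_preimage chart_open[OF ch(2)]) auto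
    moreover have "{s \<in> {0<..<1}. c s \<in> U} = {0<..<1} \<inter> c -` U" by auto
    ultimately show ?thesis by simp
  qed
  ultimately show ?thesis
    by (rule has_vector_derivative_transform_within_open) (use t ch chart_inv[OF ch(2)] in auto)
qed

end

section \<open>Hermitian matrices and Clifford matrices\<close>

lemma matrix_eq_columnI: "(\<And>j. column j A = column j B) \<Longrightarrow> A = B"
  by (simp add: vec_eq_iff column_def)

lemma column_matrix_mult: "column j (A ** B) = A *v column j (B :: complex^'n^'m)"
  by (simp add: vec_eq_iff column_def matrix_matrix_mult_def matrix_vector_mult_def)

lemma column_mscale: "column j (mscale c A) = c *s column j A"
  by (simp add: vec_eq_iff column_def mscale_def)

lemma adj_nth: "adj A $ i $ j = cnj (A $ j $ i)"
  by (simp add: adj_def)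

lemma adj_mult: "adj (A ** B) = adj B ** adj A"
  by (simp add: vec_eq_iff adj_def matrix_matrix_mult_def mult.commute)

lemma adj_adj [simp]: "adj (adj A) = A"
  by (simp add: vec_eq_iff adj_def)

lemma adj_mat_1 [simp]: "adj (mat 1) = mat 1"
  by (simp add: vec_eq_iff adj_def mat_def)

lemma adj_add: "adj (A + B) = adj A + adj B"
  by (simp add: vec_eq_iff adj_def)

lemma adj_diff: "adj (A - B) = adj A - adj B"
  by (simp add: vec_eq_iff adj_def)

lemma adj_scaleR: "adj (r *\<^sub>R A) = r *\<^sub>R adj A"
  by (simp add: vec_eq_iff adj_def complex_cnj_scaleR)

lemma adj_mscale: "adj (mscale c A) = mscale (cnj c) (adj A)"
  by (simp add: vec_eq_iff adj_def mscale_def)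

lemma mscale_nth: "mscale c A $ i $ j = c * A $ i $ j"
  by (simp add: mscale_def)

lemma mscale_mult_left: "mscale c A ** B = mscale c (A ** B)"
  by (simp add: vec_eq_iff mscale_def matrix_matrix_mult_def sum_distrib_left mult.assoc)

lemma mscale_mult_right: "A ** mscale c B = mscale c (A ** B)"
  by (simp add: vec_eq_iff mscale_def matrix_matrix_mult_def sum_distrib_left mult.left_commute)

lemma mscale_mscale: "mscale c (mscale d A) = mscale (c * d) A"
  by (simp add: vec_eq_iff mscale_def mult.assoc)

lemma mscale_1 [simp]: "mscale 1 A = A"
  by (simp add: vec_eq_iff mscale_def)

lemma mscale_0 [simp]: "mscale 0 A = 0" "mscale c 0 = 0"
  by (simp_all add: vec_eq_iff mscale_def)

lemma mscale_add_right: "mscale c (A + B) = mscale c A + mscale c B"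
  by (simp add: vec_eq_iff mscale_def distrib_left)

lemma mscale_vector: "mscale c A *v v = c *s (A *v v)"
  by (simp add: vec_eq_iff mscale_def matrix_vector_mult_def sum_distrib_left mult.assoc)

lemma matrix_vector_smult: "A *v (c *s v) = c *s (A *v (v :: complex^'n))"
  by (simp add: vec_eq_iff matrix_vector_mult_def sum_distrib_left mult.left_commute)

lemma matrix_sum_right: "A ** (\<Sum>i\<in>I. B i) = (\<Sum>i\<in>I. A ** (B i :: complex^'n^'m))"
  by (induction I rule: infinite_finite_induct) (simp_all add: matrix_add_ldistrib)

lemma matrix_mult_add_left: "(A + B) ** C = A ** C + B ** (C :: complex^'n^'m)"
  by (simp add: vec_eq_iff matrix_matrix_mult_def distrib_right sum.distrib)

lemma matrix_mult_diff_left: "(A - B) ** C = A ** C - B ** (C :: complex^'n^'m)"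
  by (simp add: vec_eq_iff matrix_matrix_mult_def left_diff_distrib sum_subtractf)

lemma matrix_mult_diff_right: "A ** (B - C) = A ** B - A ** (C :: complex^'n^'m)"
  by (simp add: vec_eq_iff matrix_matrix_mult_def right_diff_distrib sum_subtractf)

lemma matrix_sum_left: "(\<Sum>i\<in>I. B i) ** A = (\<Sum>i\<in>I. (B i :: complex^'n^'m) ** A)"
  by (induction I rule: infinite_finite_induct) (simp_all add: matrix_mult_add_left)

lemma mscale_sum: "mscale c (\<Sum>i\<in>I. B i) = (\<Sum>i\<in>I. mscale c (B i))"
  by (induction I rule: infinite_finite_induct) (simp_all add: mscale_add_right)

lemma scaleR_eq_mscale: "r *\<^sub>R A = mscale (of_real r) A"
  by (simp add: vec_eq_iff mscale_def complex_eq_iff)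

lemma scaleR_eq_smult: "r *\<^sub>R v = of_real r *s (v :: complex^'n)"
  by (simp add: vec_eq_iff complex_eq_iff)

lemma trace_mscale: "trace (mscale c A) = c * trace A"
  by (simp add: trace_def mscale_def sum_distrib_left)

lemma trace_adj: "trace (adj A) = cnj (trace A)"
  by (simp add: trace_def adj_def)

lemma hinner_adj: "hinner (A *v v) w = hinner v (adj A *v w)"
proof -
  have "hinner (A *v v) w = (\<Sum>i\<in>UNIV. \<Sum>j\<in>UNIV. cnj (A $ i $ j) * cnj (v $ j) * w $ i)"
    by (simp add: hinner_def matrix_vector_mult_def sum_distrib_right)
  also have "\<dots> = (\<Sum>j\<in>UNIV. \<Sum>i\<in>UNIV. cnj (A $ i $ j) * cnj (v $ j) * w $ i)" by (rule sum.swap)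
  also have "\<dots> = hinner v (adj A *v w)"
    by (simp add: hinner_def matrix_vector_mult_def adj_def sum_distrib_left algebra_simps)
  finally show ?thesis .
qed

lemma hinner_smult_right: "hinner v (c *s w) = c * hinner v w"
  by (simp add: hinner_def sum_distrib_left mult.left_commute)

lemma hinner_smult_left: "hinner (c *s v) w = cnj c * hinner v w"
  by (simp add: hinner_def sum_distrib_left mult.assoc)

lemma hinner_diff_right: "hinner v (w - w') = hinner v w - hinner v w'"
  by (simp add: hinner_def right_diff_distrib sum_subtractf)

lemma hinner_self: "hinner v v = of_real ((norm v)\<^sup>2)"
proof -
  have "hinner v v = of_real (\<Sum>i\<in>UNIV. (norm (v $ i))\<^sup>2)"
    by (simp only: hinner_def of_real_sum complex_norm_square mult.commute)
  then show ?thesis by (simp add: norm_vec_def L2_set_def sum_nonneg)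
qed

lemma hinner_columns: "hinner (column i A) (column j B) = (adj A ** B) $ i $ j"
  by (simp add: hinner_def column_def adj_def matrix_matrix_mult_def)

lemma isometry_square:
  fixes a :: "complex^'n^'n"
  shows "adj a ** a = mat 1 \<Longrightarrow> a ** adj a = mat 1"
  using matrix_left_right_inverse by blast

lemma isometry_vector: "adj e ** e = mat 1 \<Longrightarrow> adj e *v (e *v c) = (c :: complex^'r)"
  by (simp add: matrix_vector_mul_assoc)

lemma isometry_range:
  assumes "adj e ** e = mat 1" "v \<in> range ((*v) e)"
  shows "e *v (adj e *v v) = (v :: complex^'k)"
  using assms isometry_vector by fastforce

text \<open>\<open>e ** adj e\<close> is the orthogonal projection onto the range of
  \<open>e\<close>, hence the identity there.\<close>

lemma isometry_range_matrix:
  fixes e :: "complex^'r^'k" and e' :: "complex^'s^'k"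
  assumes "adj e ** e = mat 1" "range ((*v) e') \<subseteq> range ((*v) e)"
  shows "e ** (adj e ** e') = e'"
proof -
  have "(e ** (adj e ** e')) *v c = e' *v c" for c
    using isometry_range[OF assms(1), of "e' *v c"] assms(2) by (auto simp: matrix_vector_mul_assoc[symmetric])
  then show ?thesis by (simp add: matrix_eq)
qed

lemma isometry_transition:
  fixes e e' :: "complex^'r^'k"
  assumes "adj e ** e = mat 1" "adj e' ** e' = mat 1" "range ((*v) e') = range ((*v) e)"
  shows "adj (adj e ** e') ** (adj e ** e') = mat 1" "e' = e ** (adj e ** e')" "e ** adj e = e' ** adj e'"
proof -
  show 1: "e' = e ** (adj e ** e')" using isometry_range_matrix[of e e'] assms by simp
  show 2: "adj (adj e ** e') ** (adj e ** e') = mat 1"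
    using assms(2) 1 by (simp add: adj_mult) (metis matrix_mul_assoc)
  have "e' ** adj e' = e ** ((adj e ** e') ** adj (adj e ** e')) ** adj e"
    by (subst (1 2) 1) (simp add: adj_mult matrix_mul_assoc)
  then show "e ** adj e = e' ** adj e'" using isometry_square[OF 2] by simp
qed

lemma range_mult_square:
  fixes m :: "complex^'r^'r"
  assumes "adj m ** m = mat 1"
  shows "range ((*v) (e ** m)) = range ((*v) (e :: complex^'r^'k))"
proof safe
  fix c show "(e ** m) *v c \<in> range ((*v) e)" by (auto simp: matrix_vector_mul_assoc[symmetric])
  have "e *v c = (e ** m) *v (adj m *v c)"
    using isometry_square[OF assms] by (simp add: matrix_vector_mul_assoc matrix_mul_assoc[symmetric])
  then show "e *v c \<in> range ((*v) (e ** m))" by blast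
qed

lemma isometry_mult:
  fixes m :: "complex^'r^'r"
  assumes "adj e ** e = mat 1" "adj m ** m = mat 1"
  shows "adj (e ** m) ** (e ** m) = mat 1"
proof -
  have "adj (e ** m) ** (e ** m) = adj m ** (adj e ** e) ** m" by (simp add: adj_mult matrix_mul_assoc)
  then show ?thesis using assms by simp
qed

lemma range_mscale:
  assumes "c \<noteq> 0"
  shows "range ((*v) (mscale c e)) = range ((*v) e)"
proof safe
  fix v show "mscale c e *v v \<in> range ((*v) e)" by (auto simp: mscale_vector matrix_vector_smult[symmetric])
  have "e *v v = mscale c e *v (inverse c *s v)"
    using assms by (simp add: mscale_vector matrix_vector_smult vector_smult_assoc)
  then show "e *v v \<in> range ((*v) (mscale c e))" by blast
qed

lemma isometry_mscale:
  assumes "cnj c * c = 1" "adj e ** e = mat 1"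
  shows "adj (mscale c e) ** mscale c e = mat 1"
  using assms by (simp add: adj_mscale mscale_mult_left mscale_mult_right mscale_mscale mult.commute)

lemma det_adj_2: "det (adj (A :: complex^2^2)) = cnj (det A)"
  by (simp add: det_2 adj_def mult.commute)

lemma det_mscale_2: "det (mscale c (A :: complex^2^2)) = c\<^sup>2 * det A"
  by (simp add: det_2 mscale_def power2_eq_square algebra_simps)

subsection \<open>Wedge products\<close>

lemma wedge_nth: "wedge v w $ p = (v $ fst p * w $ snd p - v $ snd p * w $ fst p) / complex_of_real (sqrt 2)"
  by (simp add: wedge_def)

lemma wedge_add_left: "wedge (v + v') w = wedge v w + wedge v' w"
  and wedge_add_right: "wedge v (w + w') = wedge v w + wedge v w'"
  and wedge_smult_left: "wedge (c *s v) w = c *s wedge v w"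
  and wedge_smult_right: "wedge v (c *s w) = c *s wedge v w"
  by (simp_all add: vec_eq_iff wedge_nth add_divide_distrib[symmetric] algebra_simps)

lemma wedge_self: "wedge v v = 0"
  by (simp add: vec_eq_iff wedge_nth)

lemma wedge_commute: "wedge w v = - wedge v w"
  by (simp add: vec_eq_iff wedge_nth) (metis minus_diff_eq minus_divide_left mult.commute)

abbreviation wedge2 :: "complex^2^'k \<Rightarrow> complex^('k \<times> 'k)" where
  "wedge2 f \<equiv> wedge (column 1 f) (column 2 f)"

lemma matrix_vector_2: "f *v (c :: complex^2) = c $ 1 *s column 1 f + c $ 2 *s column 2 f"
  by (simp add: vec_eq_iff matrix_vector_mult_def column_def sum_2 mult.commute)

text \<open>Bilinearity and \<open>wedge v v = 0\<close> leave only the two mixed products, which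
  are the terms of the determinant.\<close>

lemma wedge2_mult: "wedge2 (f ** m) = det m *s wedge2 f"
proof -
  have "wedge2 (f ** m) = (m $ 1 $ 1 * m $ 2 $ 2) *s wedge2 f + (m $ 2 $ 1 * m $ 1 $ 2) *s wedge (column 2 f) (column 1 f)"
    unfolding column_matrix_mult matrix_vector_2
    by (simp add: wedge_add_left wedge_add_right wedge_smult_left wedge_smult_right wedge_self vector_smult_assoc)
      (simp add: column_def mult.commute add.commute)
  also have "wedge (column 2 f) (column 1 f) = - wedge2 f" by (rule wedge_commute)
  finally show ?thesis by (simp add: det_2 vec_eq_iff algebra_simps)
qed

lemma wedge2_mscale: "wedge2 (mscale c f) = c\<^sup>2 *s wedge2 f"
  by (simp add: column_mscale wedge_smult_left wedge_smult_right vector_smult_assoc power2_eq_square)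

text \<open>The Gram determinant. The sum over ordered pairs \<open>(i, j)\<close> counts every term
  twice, which the factor \<open>sqrt 2\<close> in \<open>wedge\<close> compensates.\<close>

lemma hinner_wedge:
  "hinner (wedge a b) (wedge c d) = hinner a c * hinner b d - hinner a d * hinner b c"
proof -
  have s2: "complex_of_real (sqrt 2) * complex_of_real (sqrt 2) = 2"
    by (metis of_real_mult of_real_numeral real_sqrt_mult_self abs_numeral)
  have eq: "cnj (wedge a b $ (i, j)) * wedge c d $ (i, j)
      = (cnj (a$i) * c$i * (cnj (b$j) * d$j) + cnj (b$i) * d$i * (cnj (a$j) * c$j)
       - cnj (a$i) * d$i * (cnj (b$j) * c$j) - cnj (b$i) * c$i * (cnj (a$j) * d$j)) / 2" for i j
    using s2 by (simp add: wedge_nth field_simps)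
  have "hinner (wedge a b) (wedge c d) = (\<Sum>i\<in>UNIV. \<Sum>j\<in>UNIV. cnj (wedge a b $ (i, j)) * wedge c d $ (i, j))"
    unfolding hinner_def UNIV_Times_UNIV[symmetric] by (simp add: sum.cartesian_product)
  also have "\<dots> = (hinner a c * hinner b d + hinner b d * hinner a c - hinner a d * hinner b c - hinner b c * hinner a d) / 2"
    unfolding eq hinner_def sum_product
    by (simp add: sum.distrib sum_subtractf sum_divide_distrib[symmetric])
  also have "\<dots> = hinner a c * hinner b d - hinner a d * hinner b c"
  proof -
    have "(p + q - r - s) / 2 = p - r" if "q = p" "s = r" for p q r s :: complex using that by simp
    then show ?thesis by (simp only: mult.commute)
  qed
  finally show ?thesis .
qed

lemma hinner_wedge2: "hinner (wedge2 f) (wedge2 g) = det (adj f ** g)"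
  by (simp add: hinner_wedge hinner_columns det_2)

lemma columnvector_vector: "(columnvector (k :: complex^'p) :: complex^1^'p) *v c = c $ 1 *s k"
  by (simp add: vec_eq_iff columnvector_def matrix_vector_mult_def sum_1 mult.commute)

lemma range_columnvector: "v \<in> range ((*v) (columnvector k :: complex^1^'p)) \<longleftrightarrow> (\<exists>c. v = c *s (k :: complex^'p))"
proof
  assume "\<exists>c. v = c *s k"
  then obtain c where "v = c *s k" by blast
  then have "v = (columnvector k :: complex^1^'p) *v (\<chi> i. c)" by (simp add: columnvector_vector)
  then show "v \<in> range ((*v) (columnvector k :: complex^1^'p))" by blast
qed (auto simp: columnvector_vector)

lemma adj_columnvector: "adj (columnvector k) *v v = (\<chi> i. hinner k v)"
  by (simp add: vec_eq_iff columnvector_def matrix_vector_mult_def adj_def hinner_def)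

subsection \<open>Coisometries\<close>

text \<open>The range of the adjoint is always orthogonal to the kernel. Conversely, as
  \<open>P ** adj P\<close> is the scalar \<open>c\<close>, the matrix \<open>adj P ** P\<close>
  divided by \<open>c\<close> is the orthogonal projection onto that range.\<close>

lemma perp_ker_eq_range:
  fixes P :: "complex^'k^'l"
  assumes "P ** adj P = mscale c (mat 1)" "c \<noteq> 0"
  shows "perp {v. P *v v = 0} = range ((*v) (adj P))"
proof safe
  fix w show "adj P *v w \<in> perp {v. P *v v = 0}"
    by (auto simp: perp_def hinner_adj[of P _ w, symmetric]) (simp add: hinner_def)
next
  fix w assume w: "w \<in> perp {v. P *v v = 0}"
  \<comment> \<open>The component of \<open>w\<close> in the kernel of \<open>P\<close>; it is
    orthogonal both to \<open>w\<close> and to the range of \<open>adj P\<close>, hence to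
    itself.\<close>
  define z where "z = w - adj P *v (inverse c *s (P *v w))"
  have "P *v z = P *v w - (P ** adj P) *v (inverse c *s (P *v w))"
    by (simp add: z_def matrix_vector_mult_diff_distrib matrix_vector_mul_assoc)
  also have "\<dots> = 0" using assms by (simp add: mscale_vector vector_smult_assoc)
  finally have z: "P *v z = 0" .
  have "hinner z z = hinner z w - hinner z (adj P *v (inverse c *s (P *v w)))"
    by (subst (2) z_def) (simp add: hinner_diff_right)
  also have "hinner z w = 0" using w z by (simp add: perp_def)
  also have "hinner z (adj P *v (inverse c *s (P *v w))) = 0"
    using z by (simp add: hinner_adj[symmetric]) (simp add: hinner_def)
  finally have "z = 0" by (simp add: hinner_self)
  then show "w \<in> range ((*v) (adj P))" by (auto simp: z_def)
qed

subsection \<open>Clifford matrices\<close>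

lemma gam_entries:
  "gam 1 $ 1 $ 1 = 0" "gam 1 $ 1 $ 2 = - \<i>" "gam 1 $ 2 $ 1 = - \<i>" "gam 1 $ 2 $ 2 = 0"
  "gam 2 $ 1 $ 1 = 0" "gam 2 $ 1 $ 2 = - 1" "gam 2 $ 2 $ 1 = 1" "gam 2 $ 2 $ 2 = 0"
  "gam 3 $ 1 $ 1 = - \<i>" "gam 3 $ 1 $ 2 = 0" "gam 3 $ 2 $ 1 = 0" "gam 3 $ 2 $ 2 = \<i>"
  by (simp_all add: gam_def vector_2)

lemma matrix_2_eq_iff:
  "A = (B :: complex^2^2) \<longleftrightarrow> A$1$1 = B$1$1 \<and> A$1$2 = B$1$2 \<and> A$2$1 = B$2$1 \<and> A$2$2 = B$2$2"
  by (auto simp: vec_eq_iff forall_2)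

lemma matrix_mult_2: "((A :: complex^2^'n) ** B) $ i $ j = A $ i $ 1 * B $ 1 $ j + A $ i $ 2 * B $ 2 $ j"
  by (simp add: matrix_matrix_mult_def sum_2)

lemma trace_2: "trace (A :: complex^2^2) = A$1$1 + A$2$2"
  by (simp add: trace_def sum_2)

text \<open>Products of two distinct \<open>gam\<close> lie in su(2), which makes the spin
  connection skew and trace free in a spin frame.\<close>

lemma gam_gam:
  assumes "i \<noteq> j"
  shows "adj (gam i ** gam j) = - (gam i ** gam j)" "trace (gam i ** gam j) = 0"
  using exhaust_3[of i] exhaust_3[of j] assms
  by (auto simp: matrix_2_eq_iff adj_nth matrix_mult_2 gam_entries trace_2)

text \<open>The Clifford relations turn the vanishing of \<open>\<Sum>i. \<gamma>\<^sub>i X\<^sub>i\<close> into a system whose anti-selfadjoint scalar part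
  decouples: this is what makes the connection on the determinant line flat.\<close>

lemma gam_sum_trace_real:
  fixes X :: "3 \<Rightarrow> complex^2^2"
  assumes herm: "\<And>i. X i + adj (X i) = mscale (of_real (r i)) (mat 1)"
    and dirac: "(\<Sum>i\<in>UNIV. gam i ** X i) = 0"
  shows "trace (X i) = of_real (r i)"
proof -
  have h: "(X i + adj (X i)) $ a $ b = mscale (of_real (r i)) (mat 1) $ a $ b" for i a b
    by (simp add: herm)
  have e: "Re (X i$1$1) * 2 = r i" "Re (X i$2$2) * 2 = r i" "Re (X i$2$1) = - Re (X i$1$2)" "Im (X i$2$1) = Im (X i$1$2)" for i
    using arg_cong[OF h[of i 1 1], of Re] arg_cong[OF h[of i 2 2], of Re]
      arg_cong[OF h[of i 2 1], of Re] arg_cong[OF h[of i 2 1], of Im]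
    by (simp_all add: adj_nth mscale_nth mat_def)
  have "(\<Sum>i\<in>UNIV. gam i ** X i) $ a $ b = 0" for a b by (simp add: dirac)
  then have d: "Re ((gam 1 ** X 1) $ a $ b) + Re ((gam 2 ** X 2) $ a $ b) + Re ((gam 3 ** X 3) $ a $ b) = 0"
    "Im ((gam 1 ** X 1) $ a $ b) + Im ((gam 2 ** X 2) $ a $ b) + Im ((gam 3 ** X 3) $ a $ b) = 0" for a b
    by (simp_all add: sum_3 complex_eq_iff)
  \<comment> \<open>Real parts of the diagonal entries and both parts of the off-diagonal ones. They
    form three pairs, which serve the indices 3, 1 and 2 in this order: on adding or subtracting the
    members of a pair, the relations \<open>e\<close> cancel the contributions of the two other
    matrices and leave the imaginary part of the trace.\<close>
  have d': "Im (X 1$2$1) - Re (X 2$2$1) + Im (X 3$1$1) = 0" "Im (X 1$1$2) + Re (X 2$1$2) - Im (X 3$2$2) = 0"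
    "Im (X 1$1$1) + Re (X 2$1$1) - Im (X 3$2$1) = 0" "Im (X 1$2$2) - Re (X 2$2$2) + Im (X 3$1$2) = 0"
    "- Re (X 1$1$1) + Im (X 2$1$1) + Re (X 3$2$1) = 0" "- Re (X 1$2$2) - Im (X 2$2$2) - Re (X 3$1$2) = 0"
    using d(1)[of 1 1] d(1)[of 2 2] d(1)[of 2 1] d(1)[of 1 2] d(2)[of 2 1] d(2)[of 1 2]
    by (simp_all add: matrix_mult_2 gam_entries)
  have "Im (X i$1$1) + Im (X i$2$2) = 0"
    using exhaust_3[of i] d' e(1)[of 1] e(2)[of 1] e(3)[of 1] e(4)[of 1]
      e(1)[of 2] e(2)[of 2] e(3)[of 2] e(4)[of 2] e(1)[of 3] e(2)[of 3] e(3)[of 3] e(4)[of 3]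
    by (elim disjE; hypsubst; linarith)
  then show ?thesis using e[of i] by (simp add: trace_2 complex_eq_iff)
qed

text \<open>Jacobi's formula, in which the adjugate of \<open>m\<close> is \<open>(det m / c) m\<^sup>*\<close>.\<close>

lemma det_derivative_conformal:
  fixes m dm :: "complex^2^2"
  assumes "adj m ** m = mscale c (mat 1)"
  shows "c * (dm$1$1 * m$2$2 + m$1$1 * dm$2$2 - dm$1$2 * m$2$1 - m$1$2 * dm$2$1) = det m * trace (dm ** adj m)"
proof -
  define a :: "complex^2^2" where "a = vector [vector [m$2$2, - m$1$2], vector [- m$2$1, m$1$1]]"
  have a: "a$1$1 = m$2$2" "a$1$2 = - m$1$2" "a$2$1 = - m$2$1" "a$2$2 = m$1$1" by (simp_all add: a_def vector_2)
  have "m ** a = mscale (det m) (mat 1)"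
    by (simp add: matrix_2_eq_iff matrix_mult_2 a mscale_nth mat_def det_2 algebra_simps)
  then have "adj m ** (m ** a) = mscale (det m) (adj m)" by (simp add: mscale_mult_right)
  moreover have "adj m ** (m ** a) = mscale c a" using assms by (simp add: matrix_mul_assoc mscale_mult_left)
  ultimately have "trace (dm ** mscale c a) = trace (dm ** mscale (det m) (adj m))" by simp
  then show ?thesis by (simp add: mscale_mult_right trace_mscale) (simp add: trace_2 matrix_mult_2 a algebra_simps)
qed

section \<open>Smooth matrix-valued functions\<close>

lemma bounded_bilinear_matrix_mult:
  "bounded_bilinear ((**) :: complex^'n^'m \<Rightarrow> complex^'p^'n \<Rightarrow> complex^'p^'m)"
  unfolding bilinear_conv_bounded_bilinear[symmetric] bilinear_def linear_iff
  by (auto simp: matrix_add_ldistrib matrix_mult_add_left scaleR_eq_mscale mscale_mult_left mscale_mult_right)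

lemma bounded_bilinear_matrix_vector:
  "bounded_bilinear ((*v) :: complex^'n^'m \<Rightarrow> complex^'n \<Rightarrow> complex^'m)"
  unfolding bilinear_conv_bounded_bilinear[symmetric] bilinear_def linear_iff
  by (auto simp: matrix_vector_right_distrib matrix_vector_mult_add_rdistrib
      scaleR_eq_smult scaleR_eq_mscale mscale_vector matrix_vector_smult)

lemma bounded_bilinear_mscale: "bounded_bilinear (mscale :: complex \<Rightarrow> complex^'n^'m \<Rightarrow> _)"
  unfolding bilinear_conv_bounded_bilinear[symmetric] bilinear_def linear_iff
  by (auto simp: vec_eq_iff mscale_def algebra_simps)

lemma bounded_bilinear_smult: "bounded_bilinear ((*s) :: complex \<Rightarrow> complex^'n \<Rightarrow> _)"
  unfolding bilinear_conv_bounded_bilinear[symmetric] bilinear_def linear_iff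
  by (auto simp: vec_eq_iff algebra_simps)

lemma bounded_linear_adj: "bounded_linear (adj :: complex^'n^'m \<Rightarrow> complex^'m^'n)"
  unfolding linear_conv_bounded_linear[symmetric] linear_iff by (simp add: adj_add adj_scaleR)

lemma bounded_linear_column: "bounded_linear (column j :: complex^'n^'m \<Rightarrow> complex^'m)"
  unfolding linear_conv_bounded_linear[symmetric] linear_iff by (simp add: column_def vec_eq_iff)

lemma bounded_linear_trace: "bounded_linear (trace :: complex^'n^'n \<Rightarrow> complex)"
  unfolding linear_conv_bounded_linear[symmetric] linear_iff
  by (simp add: trace_def sum.distrib scaleR_sum_right)

lemma bounded_linear_axis: "bounded_linear (axis i :: 'a::euclidean_space \<Rightarrow> 'a^'n)"
  unfolding linear_conv_bounded_linear[symmetric] linear_iff by (auto simp: axis_def vec_eq_iff)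

context manifold
begin

named_theorems smooth_intros

lemmas [smooth_intros] = smooth_at_const smooth_at_add smooth_at_sum smooth_at_nth
  smooth_at_bilinear[OF bounded_bilinear_matrix_mult] smooth_at_bilinear[OF bounded_bilinear_matrix_vector]
  smooth_at_bilinear[OF bounded_bilinear_mscale] smooth_at_bilinear[OF bounded_bilinear_smult]
  smooth_at_bilinear[OF bounded_bilinear_mult] smooth_at_bilinear[OF bounded_bilinear_scaleR]
  smooth_at_linear[OF bounded_linear_adj] smooth_at_linear[OF bounded_linear_column]
  smooth_at_linear[OF bounded_linear_trace] smooth_at_linear[OF bounded_linear_cnj]
  smooth_at_linear[OF bounded_linear_Re] smooth_at_linear[OF bounded_linear_of_real]
  smooth_at_linear[OF bounded_linear_minus[OF bounded_linear_ident]]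

lemma smooth_at_diff [smooth_intros]:
  assumes "smooth_at M x f" "smooth_at M x g"
  shows "smooth_at M x (\<lambda>y. f y - g y)"
proof -
  have "smooth_at M x (\<lambda>y. f y + - g y)" by (intro smooth_intros assms)
  then show ?thesis by simp
qed

lemma smooth_at_vec [smooth_intros]:
  fixes f :: "'n::finite \<Rightarrow> 'm \<Rightarrow> 'a::euclidean_space"
  assumes "\<And>i. smooth_at M x (f i)"
  shows "smooth_at M x (\<lambda>y. \<chi> i. f i y)"
proof -
  have "smooth_at M x (\<lambda>y. \<Sum>i\<in>UNIV. axis i (f i y))"
    by (intro smooth_at_sum smooth_at_linear[OF bounded_linear_axis] assms)
  moreover have "(\<Sum>i\<in>UNIV. axis i (f i y)) = (\<chi> i. f i y)" for y
    by (simp add: vec_eq_iff axis_def sum.delta)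
  ultimately show ?thesis by simp
qed

lemma smooth_at_det_2 [smooth_intros]:
  fixes f :: "'m \<Rightarrow> complex^2^2"
  assumes "smooth_at M x f"
  shows "smooth_at M x (\<lambda>y. det (f y))"
  unfolding det_2 by (intro smooth_intros assms)

lemmas mderiv_mmul = mderiv_bilinear[OF bounded_bilinear_matrix_mult]
  and mderiv_mvec = mderiv_bilinear[OF bounded_bilinear_matrix_vector]
  and mderiv_mscale = mderiv_bilinear[OF bounded_bilinear_mscale]
  and mderiv_smult = mderiv_bilinear[OF bounded_bilinear_smult]
  and mderiv_mult = mderiv_bilinear[OF bounded_bilinear_mult]
  and mderiv_scaleR = mderiv_bilinear[OF bounded_bilinear_scaleR]
  and mderiv_adj = mderiv_linear[OF bounded_linear_adj]
  and mderiv_column = mderiv_linear[OF bounded_linear_column]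
  and mderiv_nth = mderiv_linear[OF bounded_linear_vec_nth]
  and mderiv_cnj = mderiv_linear[OF bounded_linear_cnj]
  and mderiv_of_real = mderiv_linear[OF bounded_linear_of_real]

lemma mderiv_minus:
  assumes "smooth_at M x f"
  shows "mderiv M (\<lambda>y. - f y) x v = - mderiv M f x v"
  by (rule mderiv_linear[OF bounded_linear_minus[OF bounded_linear_ident] assms])

lemma mderiv_diff:
  assumes "smooth_at M x f" "smooth_at M x g"
  shows "mderiv M (\<lambda>y. f y - g y) x v = mderiv M f x v - mderiv M g x v"
proof -
  have "mderiv M (\<lambda>y. f y + - g y) x v = mderiv M f x v + mderiv M (\<lambda>y. - g y) x v"
    by (intro mderiv_add smooth_intros assms)
  then show ?thesis by (simp add: mderiv_minus[OF assms(2)])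
qed

end

section \<open>Bundles and connections in local frames\<close>

lemma G_bundleD:
  assumes "G_bundle M W G \<E>" "(U, e) \<in> \<E>"
  shows "open U" "U \<subseteq> W" "\<And>x. x \<in> U \<Longrightarrow> adj (e x) ** e x = mat 1"
  using assms by (auto simp: G_bundle_def)

lemma G_bundle_near:
  "G_bundle M W G \<E> \<Longrightarrow> (U, e) \<in> \<E> \<Longrightarrow> x \<in> U \<Longrightarrow> \<forall>\<^sub>F y in nhds x. y \<in> U"
  by (rule eventually_nhds_in_open[OF G_bundleD(1)])

lemma G_bundle_transition:
  assumes "G_bundle M W G \<E>" "(U, e) \<in> \<E>" "(V, f) \<in> \<E>" "x \<in> U" "x \<in> V"
  shows "range ((*v) (e x)) = range ((*v) (f x))" "adj (e x) ** f x \<in> G"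
    "smooth_at M x (\<lambda>x. adj (e x) ** f x)"
proof -
  have *: "\<forall>(U, e)\<in>\<E>. \<forall>(V, f)\<in>\<E>.
        (\<forall>x\<in>U \<inter> V. range ((*v) (e x)) = range ((*v) (f x)) \<and> adj (e x) ** f x \<in> G) \<and>
        smooth_map M (U \<inter> V) (\<lambda>x. adj (e x) ** f x)"
    using assms(1) unfolding G_bundle_def by (elim conjE)
  note ** = bspec[OF bspec[OF * assms(2), unfolded prod.case] assms(3), unfolded prod.case]
  note 1 = conjunct1[OF **] conjunct2[OF **]
  show "range ((*v) (e x)) = range ((*v) (f x))" "adj (e x) ** f x \<in> G" using 1(1) assms(4,5) by auto
  show "smooth_at M x (\<lambda>x. adj (e x) ** f x)"
    using 1(2) assms(4,5) G_bundleD(1)[OF assms(1,2)] G_bundleD(1)[OF assms(1,3)]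
    unfolding smooth_at_def by (intro exI[of _ "U \<inter> V"]) auto
qed

lemma G_bundle_frame_ex:
  assumes "G_bundle M W G \<E>" "x \<in> W"
  obtains U e where "(U, e) \<in> \<E>" "x \<in> U"
  using assms by (auto simp: G_bundle_def)

lemma frame_atE:
  assumes "G_bundle M W G \<E>" "x \<in> W"
  obtains U where "(U, frame_at \<E> x) \<in> \<E>" "x \<in> U"
proof -
  obtain U e where "(U, e) \<in> \<E>" "x \<in> U" using G_bundle_frame_ex[OF assms] .
  then have ex: "\<exists>f. f \<in> \<E> \<and> x \<in> fst f" by force
  define p where "p = (SOME f. f \<in> \<E> \<and> x \<in> fst f)"
  have "p \<in> \<E> \<and> x \<in> fst p" unfolding p_def by (rule someI_ex[OF ex])
  then show ?thesis by (intro that[of "fst p"]) (simp_all add: frame_at_def p_def[symmetric])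
qed

lemma fibre_eq:
  assumes "G_bundle M W G \<E>" "(U, e) \<in> \<E>" "x \<in> U"
  shows "fibre \<E> x = range ((*v) (e x))" "fibre_proj \<E> x = e x ** adj (e x)"
proof -
  have "x \<in> W" using G_bundleD(2)[OF assms(1,2)] assms(3) by auto
  then obtain V where V: "(V, frame_at \<E> x) \<in> \<E>" "x \<in> V" using frame_atE[OF assms(1)] by blast
  show 1: "fibre \<E> x = range ((*v) (e x))"
    using G_bundle_transition(1)[OF assms(1) V(1) assms(2) V(2) assms(3)] by (simp add: fibre_def)
  show "fibre_proj \<E> x = e x ** adj (e x)"
    using isometry_transition(3)[OF G_bundleD(3)[OF assms] G_bundleD(3)[OF assms(1) V]] 1
    by (simp add: fibre_proj_def fibre_def)
qed

text \<open>Columns are differentiated one by one, so that frames and homomorphisms obey matrix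
  identities instead of families of vector identities.\<close>

definition dmat :: "('m, 'k::finite) conn \<Rightarrow> ('m \<Rightarrow> complex^'r^'k) \<Rightarrow> 'm \<Rightarrow> real^3 \<Rightarrow> complex^'r^'k" where
  "dmat D S x v = (\<chi> i j. D (\<lambda>y. column j (S y)) x v $ i)"

lemma dmat_nth: "dmat D S x v $ i $ j = D (\<lambda>y. column j (S y)) x v $ i"
  by (simp add: dmat_def)

lemma matrix_mult_nth: "(A ** B) $ i $ j = (A *v column j (B :: complex^'n^'m)) $ i"
  by (simp add: column_def matrix_matrix_mult_def matrix_vector_mult_def)

lemma matrix_vector_axis: "(A :: complex^'n^'m) *v axis j 1 = column j A"
  by (simp add: vec_eq_iff column_def matrix_vector_mult_def axis_def if_distrib cong: if_cong)

lemma column_dmat: "column j (dmat D S x v) = D (\<lambda>y. column j (S y)) x v"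
  by (simp add: vec_eq_iff column_def dmat_def)

lemma conn_form_dmat: "conn_form D e x v = adj (e x) ** dmat D e x v"
  by (rule matrix_eq_columnI) (simp add: column_matrix_mult column_dmat, simp add: vec_eq_iff column_def conn_form_def)

lemma hom_conn_dmat:
  "hom_conn \<E> DE DT \<Psi> x v
    = (dmat DT (\<lambda>y. \<Psi> y ** frame_at \<E> x y) x v - \<Psi> x ** dmat DE (frame_at \<E> x) x v) ** adj (frame_at \<E> x x)"
proof -
  let ?e = "frame_at \<E> x"
  have "(\<chi> i j. (DT (\<lambda>y. \<Psi> y *v column j (?e y)) x v - \<Psi> x *v DE (\<lambda>y. column j (?e y)) x v) $ i)
    = dmat DT (\<lambda>y. \<Psi> y ** ?e y) x v - \<Psi> x ** dmat DE ?e x v"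
    by (simp add: vec_eq_iff dmat_nth column_matrix_mult matrix_mult_nth column_dmat)
  then show ?thesis by (simp add: hom_conn_def Let_def)
qed

lemma column_add: "column j (A + B) = column j A + column j B"
  by (simp add: vec_eq_iff column_def)

context manifold
begin

text \<open>A pointwise notion, since the frames chosen by \<open>frame_at\<close> and \<open>spin_frame_at\<close>, through which the
  induced connections are defined, vary with the point.\<close>

definition cov_at :: "('m, 'k::finite) conn \<Rightarrow> ('m \<Rightarrow> complex^'r::finite^'k) \<Rightarrow> 'm \<Rightarrow> bool" where
  "cov_at D e x \<longleftrightarrow> (\<forall>c s v. smooth_at M x c \<longrightarrow> (\<forall>\<^sub>F y in nhds x. s y = e y *v c y) \<longrightarrow>
     D s x v = e x *v (mderiv M c x v + conn_form D e x v *v c x))"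

lemma cov_atD:
  "cov_at D e x \<Longrightarrow> smooth_at M x c \<Longrightarrow> (\<forall>\<^sub>F y in nhds x. s y = e y *v c y) \<Longrightarrow>
     D s x v = e x *v (mderiv M c x v + conn_form D e x v *v c x)"
  by (simp add: cov_at_def)

text \<open>Constant coefficients isolate the columns of \<open>a\<close>, so a matrix that serves
  as connection matrix must be \<open>conn_form\<close>.\<close>

lemma cov_atI:
  fixes e :: "'m \<Rightarrow> complex^'r^'k"
  assumes "adj (e x) ** e x = mat 1"
    and D: "\<And>c s v. smooth_at M x c \<Longrightarrow> (\<forall>\<^sub>F y in nhds x. s y = e y *v c y) \<Longrightarrow>
      D s x v = e x *v (mderiv M c x v + a v *v c x)"
  shows "cov_at D e x" "conn_form D e x v = a v"
proof -
  have "conn_form D e x v = a v" for v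
  proof (rule matrix_eq_columnI)
    fix j
    have "D (\<lambda>y. column j (e y)) x v = e x *v (mderiv M (\<lambda>y. axis j 1 :: complex^'r) x v + a v *v axis j 1)"
      by (rule D[OF smooth_at_const]) (simp add: matrix_vector_axis)
    then have "D (\<lambda>y. column j (e y)) x v = e x *v column j (a v)"
      by (simp add: mderiv_const matrix_vector_axis)
    then show "column j (conn_form D e x v) = column j (a v)"
      by (simp add: conn_form_dmat column_matrix_mult column_dmat isometry_vector[OF assms(1)])
  qed
  then show "conn_form D e x v = a v" "cov_at D e x" using D by (simp_all add: cov_at_def)
qed

lemma cov_at_matrix:
  assumes "cov_at D e x" "smooth_at M x C" "\<forall>\<^sub>F y in nhds x. S y = e y ** C y"
  shows "dmat D S x v = e x ** (mderiv M C x v + conn_form D e x v ** C x)"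
proof (rule matrix_eq_columnI)
  fix j
  have "D (\<lambda>y. column j (S y)) x v
      = e x *v (mderiv M (\<lambda>y. column j (C y)) x v + conn_form D e x v *v column j (C x))"
    by (rule cov_atD[OF assms(1)])
      (use assms(2,3) in \<open>auto intro!: smooth_intros simp: column_matrix_mult elim: eventually_mono\<close>)
  then show "column j (dmat D S x v) = column j (e x ** (mderiv M C x v + conn_form D e x v ** C x))"
    by (simp add: column_dmat column_matrix_mult column_add mderiv_column[OF assms(2)])
qed

text \<open>The gauge transformation law. As \<open>m x\<close> is unitary, the inverse in the usual
  formula is the adjoint.\<close>

lemma cov_at_change:
  fixes m :: "'m \<Rightarrow> complex^'r^'r"
  assumes D: "cov_at D e x" and e: "adj (e x) ** e x = mat 1" and m: "smooth_at M x m" "adj (m x) ** m x = mat 1"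
    and e': "\<forall>\<^sub>F y in nhds x. e' y = e y ** m y"
  shows "cov_at D e' x" "conn_form D e' x v = adj (m x) ** (mderiv M m x v + conn_form D e x v ** m x)"
proof -
  have e'x: "e' x = e x ** m x" using e' eventually_nhds_x_imp_x by blast
  have iso: "adj (e' x) ** e' x = mat 1" unfolding e'x by (rule isometry_mult[OF e m(2)])
  have mm: "m x ** adj (m x) = mat 1" by (rule isometry_square[OF m(2)])
  have "D s x v = e' x *v (mderiv M c x v + (adj (m x) ** (mderiv M m x v + conn_form D e x v ** m x)) *v c x)"
    if c: "smooth_at M x c" and s: "\<forall>\<^sub>F y in nhds x. s y = e' y *v c y" for c s v
  proof -
    have ev: "\<forall>\<^sub>F y in nhds x. s y = e y *v (m y *v c y)"
      using s e' by eventually_elim (simp add: matrix_vector_mul_assoc)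
    have "D s x v = e x *v (mderiv M (\<lambda>y. m y *v c y) x v + conn_form D e x v *v (m x *v c x))"
      by (rule cov_atD[OF D _ ev]) (intro smooth_intros m c)
    also have "mderiv M (\<lambda>y. m y *v c y) x v = m x *v mderiv M c x v + mderiv M m x v *v c x"
      by (rule mderiv_mvec[OF m(1) c])
    also have "e x *v (m x *v mderiv M c x v + mderiv M m x v *v c x + conn_form D e x v *v (m x *v c x))
      = e x *v (m x *v mderiv M c x v + (m x ** adj (m x)) *v ((mderiv M m x v + conn_form D e x v ** m x) *v c x))"
      unfolding mm by (simp add: matrix_vector_mul_assoc matrix_vector_mult_add_rdistrib add.assoc)
    finally show ?thesis
      unfolding e'x by (simp add: matrix_vector_right_distrib matrix_vector_mul_assoc matrix_mul_assoc)
  qed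
  note res = cov_atI[of e' x D "\<lambda>v. adj (m x) ** (mderiv M m x v + conn_form D e x v ** m x)", OF iso this]
  show "cov_at D e' x" "conn_form D e' x v = adj (m x) ** (mderiv M m x v + conn_form D e x v ** m x)"
    by (rule res; assumption)+
qed

subsection \<open>One-forms\<close>

text \<open>Smoothness of a one-form as a germ, tested on the coordinate fields of every chart
  around \<open>x\<close>. Values in the Lie algebra are treated separately, as the intermediate
  forms are general matrices.\<close>

definition form_at :: "('m \<Rightarrow> real^3 \<Rightarrow> 'b::real_normed_vector) \<Rightarrow> 'm \<Rightarrow> bool" where
  "form_at a x \<longleftrightarrow> linear (a x) \<and>
     (\<forall>c\<in>atlas M. x \<in> fst c \<longrightarrow> (\<forall>i. smooth_at M x (\<lambda>y. a y (coord_vector M c y (axis i 1)))))"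

lemma smooth_one_form_iff:
  assumes "open U"
  shows "smooth_one_form M U \<gg> a \<longleftrightarrow> (\<forall>x\<in>U. form_at a x \<and> range (a x) \<subseteq> \<gg>)"
proof -
  have "smooth_map M (U \<inter> fst c) f \<longleftrightarrow> (\<forall>x\<in>U. x \<in> fst c \<longrightarrow> smooth_at M x f)" if "c \<in> atlas M" for c and f :: "'m \<Rightarrow> complex^'a^'a"
  proof -
    have "open (fst c)" using chart_open[of "fst c" "snd c"] that by simp
    then show ?thesis using smooth_map_iff[of "U \<inter> fst c" f] assms by auto
  qed
  then show ?thesis unfolding smooth_one_form_def form_at_def by blast
qed

lemma form_at_cong:
  assumes "\<forall>\<^sub>F y in nhds x. a y = b y" "form_at a x"
  shows "form_at b x"
proof -
  have "a x = b x" using eventually_nhds_x_imp_x[OF assms(1)] .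
  moreover have "smooth_at M x (\<lambda>y. b y (coord_vector M c y (axis i 1)))" if "c \<in> atlas M" "x \<in> fst c" for c i
  proof (rule smooth_at_cong)
    show "\<forall>\<^sub>F y in nhds x. a y (coord_vector M c y (axis i 1)) = b y (coord_vector M c y (axis i 1))"
      using assms(1) by eventually_elim simp
    show "smooth_at M x (\<lambda>y. a y (coord_vector M c y (axis i 1)))" using assms(2) that by (simp add: form_at_def)
  qed
  ultimately show ?thesis using assms(2) by (simp add: form_at_def)
qed

lemma form_at_mderiv: "smooth_at M x f \<Longrightarrow> form_at (\<lambda>y v. mderiv M f y v) x"
  by (auto simp: form_at_def intro: linear_mderiv smooth_at_mderiv_coord_vector)

lemma form_at_add: "form_at a x \<Longrightarrow> form_at b x \<Longrightarrow> form_at (\<lambda>y v. a y v + b y v) x"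
  by (simp add: form_at_def linear_compose_add smooth_at_add)

lemma form_at_linear:
  assumes "bounded_linear L" "form_at a x"
  shows "form_at (\<lambda>y v. L (a y v)) x"
  using assms linear_compose[of "a x" L, unfolded o_def] smooth_at_linear[OF assms(1)]
  by (simp add: form_at_def bounded_linear.linear)

lemma form_at_bilinear_left:
  assumes "bounded_bilinear P" "smooth_at M x f" "form_at a x"
  shows "form_at (\<lambda>y v. P (f y) (a y v)) x"
  using assms linear_compose[of "a x" "P (f x)", unfolded o_def] smooth_at_bilinear[OF assms(1,2)]
  by (simp add: form_at_def bounded_linear.linear[OF bounded_bilinear.bounded_linear_right])

lemma form_at_bilinear_right:
  assumes "bounded_bilinear P" "form_at a x" "smooth_at M x f"
  shows "form_at (\<lambda>y v. P (a y v) (f y)) x"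
  using assms linear_compose[of "a x" "\<lambda>z. P z (f x)", unfolded o_def] smooth_at_bilinear[OF assms(1) _ assms(3)]
  by (simp add: form_at_def bounded_linear.linear[OF bounded_bilinear.bounded_linear_left])

lemmas form_intros = form_at_mderiv form_at_add form_at_bilinear_left[OF bounded_bilinear_matrix_mult]
  form_at_bilinear_right[OF bounded_bilinear_matrix_mult] form_at_bilinear_right[OF bounded_bilinear_mscale]
  form_at_linear[OF bounded_linear_trace] form_at_linear[OF bounded_linear_vec_nth]

subsection \<open>Connections as local data\<close>

lemma section_of_frame:
  assumes E: "G_bundle M W G \<E>" "(U, e) \<in> \<E>" and V: "open V" "V \<subseteq> U"
    and c: "\<And>y. y \<in> V \<Longrightarrow> smooth_at M y c" and s: "\<And>y. y \<in> V \<Longrightarrow> s y = e y *v c y"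
  shows "smooth_section M \<E> V s"
  unfolding smooth_section_def
proof safe
  fix V' e' assume e': "(V', e') \<in> \<E>"
  note op = G_bundleD(1)[OF E(1) e']
  { fix y assume y: "y \<in> V" "y \<in> V'"
    then have yU: "y \<in> U" using V by auto
    show "s y \<in> range ((*v) (e' y))"
      using s[OF y(1)] G_bundle_transition(1)[OF E e' yU y(2)] by auto }
  show "smooth_map M (V \<inter> V') (\<lambda>x. adj (e' x) *v s x)"
    unfolding smooth_map_iff[OF open_Int[OF V(1) op]]
  proof safe
    fix y assume y: "y \<in> V" "y \<in> V'"
    then have yU: "y \<in> U" using V by auto
    have "\<forall>\<^sub>F z in nhds y. (adj (e' z) ** e z) *v c z = adj (e' z) *v s z"
      using y V s by (auto simp: eventually_nhds matrix_vector_mul_assoc intro!: exI[of _ V])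
    moreover have "smooth_at M y (\<lambda>z. (adj (e' z) ** e z) *v c z)"
      by (intro smooth_intros G_bundle_transition(3)[OF E(1) e' E(2) y(2) yU] c y)
    ultimately show "smooth_at M y (\<lambda>x. adj (e' x) *v s x)" by (rule smooth_at_cong)
  qed
qed

text \<open>A germ of smooth coefficients gives a smooth section over a small open set, to which the
  definition of a connection applies; the formula in a frame thus needs only information near the
  point.\<close>

lemma connectionD:
  assumes E: "G_bundle M W G \<E>" "(U, e) \<in> \<E>" and D: "connection M \<gg> \<E> D"
  shows "\<And>x. x \<in> U \<Longrightarrow> cov_at D e x" "\<And>x. x \<in> U \<Longrightarrow> form_at (conn_form D e) x"
    "\<And>x v. x \<in> U \<Longrightarrow> conn_form D e x v \<in> \<gg>"
proof -
  have "\<exists>a. smooth_one_form M U \<gg> a \<and>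
        (\<forall>V s x v. open V \<and> V \<subseteq> U \<and> smooth_section M \<E> V s \<and> x \<in> V \<longrightarrow>
           D s x v = e x *v (mderiv M (\<lambda>y. adj (e y) *v s y) x v + a x v *v (adj (e x) *v s x)))"
    using D E(2) unfolding connection_def by (auto dest!: bspec)
  then obtain a where a: "smooth_one_form M U \<gg> a"
    and Da: "\<And>V s x v. open V \<Longrightarrow> V \<subseteq> U \<Longrightarrow> smooth_section M \<E> V s \<Longrightarrow> x \<in> V \<Longrightarrow>
           D s x v = e x *v (mderiv M (\<lambda>y. adj (e y) *v s y) x v + a x v *v (adj (e x) *v s x))" by auto
  note op = G_bundleD(1)[OF E] and iso = G_bundleD(3)[OF E]
  have *: "D s x v = e x *v (mderiv M c x v + a x v *v c x)"
    if x: "x \<in> U" and c: "smooth_at M x c" and s: "\<forall>\<^sub>F y in nhds x. s y = e y *v c y" for x c s v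
  proof -
    have "\<forall>\<^sub>F y in nhds x. smooth_at M y c \<and> s y = e y *v c y \<and> y \<in> U"
      using smooth_at_eventually[OF c] s eventually_nhds_in_open[OF op x] by eventually_elim simp
    then obtain V where V: "open V" "x \<in> V" "\<And>y. y \<in> V \<Longrightarrow> smooth_at M y c \<and> s y = e y *v c y \<and> y \<in> U"
      by (rule eventually_nhdsE) blast
    have eq: "adj (e y) *v s y = c y" if "y \<in> V" for y
      using V(3)[OF that] isometry_vector[OF iso, of y] by simp
    have "smooth_section M \<E> V s" by (rule section_of_frame[OF E]) (use V in auto)
    then have "D s x v = e x *v (mderiv M (\<lambda>y. adj (e y) *v s y) x v + a x v *v (adj (e x) *v s x))"
      using Da[of V s x v] V by blast
    moreover have "mderiv M (\<lambda>y. adj (e y) *v s y) x = mderiv M c x"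
      by (rule mderiv_cong) (use V eq in \<open>auto simp: eventually_nhds\<close>)
    ultimately show ?thesis using eq[OF V(2)] by simp
  qed
  show "cov_at D e x" if "x \<in> U" for x by (rule cov_atI(1)[of e x D "a x", OF iso[OF that] *[OF that]])
  have cf: "conn_form D e x v = a x v" if "x \<in> U" for x v by (rule cov_atI(2)[of e x D "a x", OF iso[OF that] *[OF that]])
  show "conn_form D e x v \<in> \<gg>" if "x \<in> U" for x v
    using a that by (auto simp: cf smooth_one_form_iff[OF op])
  show "form_at (conn_form D e) x" if x: "x \<in> U" for x
  proof (rule form_at_cong)
    show "\<forall>\<^sub>F y in nhds x. a y = conn_form D e y"
      using eventually_nhds_in_open[OF op x] by eventually_elim (simp add: cf fun_eq_iff)
    show "form_at a x" using a x by (simp add: smooth_one_form_iff[OF op])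
  qed
qed

lemma connectionI:
  assumes E: "G_bundle M W G \<E>"
    and D: "\<And>U e x. (U, e) \<in> \<E> \<Longrightarrow> x \<in> U \<Longrightarrow>
      cov_at D e x \<and> form_at (conn_form D e) x \<and> (\<forall>v. conn_form D e x v \<in> \<gg>)"
  shows "connection M \<gg> \<E> D"
  unfolding connection_def
proof safe
  fix U e assume e: "(U, e) \<in> \<E>"
  note op = G_bundleD(1)[OF E e] and iso = G_bundleD(3)[OF E e]
  have "smooth_one_form M U \<gg> (conn_form D e)"
    unfolding smooth_one_form_iff[OF op] using D[OF e] by blast
  moreover have "D s x v = e x *v (mderiv M (\<lambda>y. adj (e y) *v s y) x v + conn_form D e x v *v (adj (e x) *v s x))"
    if V: "open V" "V \<subseteq> U" "smooth_section M \<E> V s" "x \<in> V" for V s x v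
  proof (rule cov_atD)
    have sm: "(\<forall>x\<in>V \<inter> U. s x \<in> range ((*v) (e x)))" "smooth_map M (V \<inter> U) (\<lambda>x. adj (e x) *v s x)"
      using V(3) e by (auto simp: smooth_section_def)
    show "cov_at D e x" using D[OF e] V by auto
    show "smooth_at M x (\<lambda>y. adj (e y) *v s y)" using sm(2) smooth_map_iff[of "V \<inter> U"] op V by auto
    show "\<forall>\<^sub>F y in nhds x. s y = e y *v (adj (e y) *v s y)"
      using eventually_nhds_in_open[OF V(1,4)]
      by eventually_elim (use isometry_range[OF iso] sm(1) V(2) in \<open>auto simp: subset_iff\<close>)
  qed
  ultimately show "\<exists>a. smooth_one_form M U \<gg> a \<and>
        (\<forall>V s x v. open V \<and> V \<subseteq> U \<and> smooth_section M \<E> V s \<and> x \<in> V \<longrightarrow>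
           D s x v = e x *v (mderiv M (\<lambda>y. adj (e y) *v s y) x v + a x v *v (adj (e x) *v s x)))"
    by blast
qed

subsection \<open>Induced connections\<close>

lemma matrix_1_vector: "(A :: complex^1^1) *v c = (A $ 1 $ 1) *s c"
  by (simp add: vec_eq_iff matrix_vector_mult_def forall_1 sum_1)

lemma matrix_1_mult: "((A :: complex^1^1) ** B) $ 1 $ 1 = A $ 1 $ 1 * B $ 1 $ 1"
  by (simp add: matrix_matrix_mult_def sum_1)

lemma matrix_1_eq_iff: "A = (B :: complex^1^1) \<longleftrightarrow> A $ 1 $ 1 = B $ 1 $ 1"
  by (simp add: vec_eq_iff forall_1)

lemma matrix_1_mat_nth [simp]: "(mat a :: complex^1^1) $ 1 $ 1 = a"
  by (simp add: mat_def)

lemma frame_1_unit: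
  fixes l :: "complex^1^1"
  assumes "adj l ** l = mat 1"
  shows "cnj (l $ 1 $ 1) * l $ 1 $ 1 = 1" "l $ 1 $ 1 \<noteq> 0" "inverse (l $ 1 $ 1) = cnj (l $ 1 $ 1)"
proof -
  show 1: "cnj (l $ 1 $ 1) * l $ 1 $ 1 = 1"
    using arg_cong[OF assms, of "\<lambda>A. A $ 1 $ 1"] by (simp add: matrix_1_mult adj_nth)
  then show 2: "l $ 1 $ 1 \<noteq> 0" by auto
  show "inverse (l $ 1 $ 1) = cnj (l $ 1 $ 1)" using 1 2 by (simp add: field_simps)
qed

text \<open>\<open>tensor_conn\<close> differentiates with the frame chosen at \<open>x\<close>,
  while \<open>l\<close> is any frame. The two differ by a unit function whose derivative enters
  once through the coefficients of the section and once through the line frame, with opposite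
  signs.\<close>

lemma tensor_conn_cov:
  fixes \<L> :: "('m, 1, 1) frames" and e :: "'m \<Rightarrow> complex^'r^'k"
  assumes L: "G_bundle M W G \<L>" "(V, l) \<in> \<L>" "x \<in> V"
    and DL: "cov_at DL l x" and D: "cov_at D e x" and e: "adj (e x) ** e x = mat 1"
  shows "cov_at (tensor_conn \<L> D DL) (\<lambda>y. mscale (l y $ 1 $ 1) (e y)) x"
    "conn_form (tensor_conn \<L> D DL) (\<lambda>y. mscale (l y $ 1 $ 1) (e y)) x v
     = conn_form D e x v + mscale (conn_form DL l x v $ 1 $ 1) (mat 1)"
proof -
  have xW: "x \<in> W" using G_bundleD(2)[OF L(1,2)] L(3) by auto
  obtain V' where V': "(V', frame_at \<L> x) \<in> \<L>" "x \<in> V'" using frame_atE[OF L(1) xW] .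
  define l' where "l' = frame_at \<L> x"
  have l': "(V', l') \<in> \<L>" using V' by (simp add: l'_def)
  \<comment> \<open>The transition function: \<open>l\<close> is \<open>l'\<close> times
    \<open>u\<close>.\<close>
  define u where "u y = cnj (l' y $ 1 $ 1) * l y $ 1 $ 1" for y
  have u_eq: "u y = (adj (l' y) ** l y) $ 1 $ 1" for y by (simp add: u_def matrix_1_mult adj_nth)
  have su: "smooth_at M x u"
    unfolding u_eq by (intro smooth_intros G_bundle_transition(3)[OF L(1) l' L(2) V'(2) L(3)])
  note unit = frame_1_unit[OF G_bundleD(3)[OF L(1,2)]] and unit' = frame_1_unit[OF G_bundleD(3)[OF L(1) l']]
  have u0: "u x \<noteq> 0" using unit(2)[OF L(3)] unit'(2)[OF V'(2)] by (simp add: u_def)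
  have lu: "l' x $ 1 $ 1 * u x = l x $ 1 $ 1" 
  proof -
    have "l' x $ 1 $ 1 * u x = (cnj (l' x $ 1 $ 1) * l' x $ 1 $ 1) * l x $ 1 $ 1" by (simp add: u_def ac_simps)
    then show ?thesis using unit'(1)[OF V'(2)] by simp
  qed
  let ?\<theta> = "\<lambda>v. conn_form DL l x v $ 1 $ 1"
  have iso: "adj (mscale (l x $ 1 $ 1) (e x)) ** mscale (l x $ 1 $ 1) (e x) = mat 1"
    by (rule isometry_mscale[OF unit(1)[OF L(3)] e])
  have nV: "\<forall>\<^sub>F y in nhds x. y \<in> V \<and> y \<in> V'"
    using eventually_nhds_in_open[OF G_bundleD(1)[OF L(1,2)] L(3)] G_bundle_near[OF L(1) l' V'(2)]
    by eventually_elim simp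
  have "\<forall>\<^sub>F y in nhds x. column 1 (l' y) = l y *v (\<chi> i. inverse (u y))"
    using nV
  proof eventually_elim
    case (elim y)
    have "l y $ 1 $ 1 * inverse (u y) = (cnj (l y $ 1 $ 1) * l y $ 1 $ 1) * l' y $ 1 $ 1"
      using elim unit(3)[of y] inverse_unique[OF unit'(1)[of y]] by (simp add: u_def ac_simps)
    then show ?case using elim unit(1)[of y]
      by (simp add: matrix_1_vector vec_eq_iff forall_1 column_def)
  qed
  then have DLl': "DL (\<lambda>y. column 1 (l' y)) x v
      = l x *v (mderiv M (\<lambda>y. \<chi> i. inverse (u y)) x v + conn_form DL l x v *v (\<chi> i. inverse (u x)))" for v
    by (intro cov_atD[OF DL] smooth_intros smooth_at_inverse su u0)
  have du: "mderiv M (\<lambda>y. (\<chi> i. inverse (u y)) :: complex^1) x v $ 1 = - mderiv M u x v / (u x)\<^sup>2" for v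
  proof -
    have "mderiv M (\<lambda>y. (\<chi> i. inverse (u y)) :: complex^1) x v $ 1
        = mderiv M (\<lambda>y. ((\<chi> i. inverse (u y)) :: complex^1) $ 1) x v"
      by (rule mderiv_nth[symmetric]) (intro smooth_intros smooth_at_inverse su u0)
    then show ?thesis by (simp add: mderiv_inverse[OF su u0])
  qed
  have DLl: "DL (\<lambda>y. column 1 (l' y)) x v $ 1 = l x $ 1 $ 1 * (?\<theta> v / u x - mderiv M u x v / (u x)\<^sup>2)" for v
    unfolding DLl' by (simp add: matrix_1_vector du) (simp add: divide_inverse algebra_simps)
  have main: "tensor_conn \<L> D DL s x v = mscale (l x $ 1 $ 1) (e x) *v
      (mderiv M c x v + (conn_form D e x v + mscale (?\<theta> v) (mat 1)) *v c x)"
    if c: "smooth_at M x c" and s: "\<forall>\<^sub>F y in nhds x. s y = mscale (l y $ 1 $ 1) (e y) *v c y" for c s v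
  proof -
    let ?t = "\<lambda>y. inverse (l' y $ 1 $ 1) *s s y"
    have t: "\<forall>\<^sub>F y in nhds x. ?t y = e y *v (u y *s c y)"
      using s nV
    proof eventually_elim
      case (elim y)
      then show ?case using unit'(3)[of y]
        by (simp add: mscale_vector matrix_vector_smult vector_smult_assoc u_def)
    qed
    have tx: "?t x = e x *v (u x *s c x)" using eventually_nhds_x_imp_x[OF t] .
    have "D ?t x v = e x *v (mderiv M (\<lambda>y. u y *s c y) x v + conn_form D e x v *v (u x *s c x))"
      by (rule cov_atD[OF D _ t]) (intro smooth_intros su c)
    also have "mderiv M (\<lambda>y. u y *s c y) x v = u x *s mderiv M c x v + mderiv M u x v *s c x"
      by (rule mderiv_smult[OF su c])
    finally have Dt: "D ?t x v = u x *s (e x *v mderiv M c x v) + mderiv M u x v *s (e x *v c x)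
        + u x *s (e x *v (conn_form D e x v *v c x))"
      by (simp add: matrix_vector_right_distrib matrix_vector_smult)
    have "tensor_conn \<L> D DL s x v = (l' x $ 1 $ 1) *s D ?t x v + (DL (\<lambda>y. column 1 (l' y)) x v $ 1) *s ?t x"
      by (simp add: tensor_conn_def Let_def l'_def column_def)
    also have "\<dots> = (l' x $ 1 $ 1 * u x) *s (e x *v mderiv M c x v)
        + (l' x $ 1 $ 1 * mderiv M u x v) *s (e x *v c x)
        + (l' x $ 1 $ 1 * u x) *s (e x *v (conn_form D e x v *v c x))
        + (l x $ 1 $ 1 * (?\<theta> v / u x - mderiv M u x v / (u x)\<^sup>2) * u x) *s (e x *v c x)"
      unfolding DLl tx Dt by (simp add: vector_add_ldistrib vector_smult_assoc matrix_vector_smult)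
    \<comment> \<open>The second summand cancels the derivative of \<open>u\<close> that comes from
      the coefficients.\<close>
    also have "l x $ 1 $ 1 * (?\<theta> v / u x - mderiv M u x v / (u x)\<^sup>2) * u x
        = l x $ 1 $ 1 * ?\<theta> v - l' x $ 1 $ 1 * mderiv M u x v"
      unfolding lu[symmetric] using u0 by (simp add: field_simps power2_eq_square)
    finally show ?thesis
      unfolding lu
      by (simp add: mscale_vector matrix_vector_right_distrib matrix_vector_mult_add_rdistrib matrix_vector_smult
          vector_add_ldistrib vector_smult_assoc vector_sub_rdistrib)
  qed
  note res = cov_atI[of "\<lambda>y. mscale (l y $ 1 $ 1) (e y)" x "tensor_conn \<L> D DL"
      "\<lambda>v. conn_form D e x v + mscale (?\<theta> v) (mat 1)", OF iso main]
  show "cov_at (tensor_conn \<L> D DL) (\<lambda>y. mscale (l y $ 1 $ 1) (e y)) x"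
    by (rule res(1))
  show "conn_form (tensor_conn \<L> D DL) (\<lambda>y. mscale (l y $ 1 $ 1) (e y)) x v
     = conn_form D e x v + mscale (?\<theta> v) (mat 1)"
    by (rule res(2))
qed

text \<open>The dual is the conjugate line, so coefficients, frame and connection form are all
  conjugated; for a 1 x 1 matrix the conjugate is the adjoint.\<close>

lemma dual_conn_cov:
  fixes n :: "'m \<Rightarrow> complex^1^1"
  assumes D: "cov_at D n x" and n: "adj (n x) ** n x = mat 1"
  shows "cov_at (dual_conn D) (\<lambda>y. \<chi> i j. cnj (n y $ i $ j)) x"
    "conn_form (dual_conn D) (\<lambda>y. \<chi> i j. cnj (n y $ i $ j)) x v = adj (conn_form D n x v)"
proof -
  let ?n = "\<lambda>y. (\<chi> i j. cnj (n y $ i $ j)) :: complex^1^1"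
  have iso: "adj (?n x) ** ?n x = mat 1"
    using frame_1_unit(1)[OF n] by (simp add: matrix_1_eq_iff matrix_1_mult adj_nth mult.commute)
  have main: "dual_conn D s x v = ?n x *v (mderiv M c x v + adj (conn_form D n x v) *v c x)"
    if c: "smooth_at M x c" and s: "\<forall>\<^sub>F y in nhds x. s y = ?n y *v c y" for c s v
  proof -
    let ?c = "\<lambda>y. (\<chi> i. cnj (c y $ i)) :: complex^1"
    have sc: "smooth_at M x ?c" by (intro smooth_intros c)
    have ev: "\<forall>\<^sub>F y in nhds x. (\<chi> j. cnj (s y $ j)) = n y *v ?c y"
      using s by eventually_elim (simp add: vec_eq_iff forall_1 matrix_1_vector)
    have dc: "mderiv M ?c x v $ 1 = cnj (mderiv M c x v $ 1)"
    proof -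
      have "mderiv M ?c x v $ 1 = mderiv M (\<lambda>y. ?c y $ 1) x v" by (rule mderiv_nth[OF sc, symmetric])
      also have "\<dots> = mderiv M (\<lambda>y. cnj (c y $ 1)) x v" by simp
      also have "\<dots> = cnj (mderiv M (\<lambda>y. c y $ 1) x v)" by (rule mderiv_cnj) (intro smooth_intros c)
      also have "mderiv M (\<lambda>y. c y $ 1) x v = mderiv M c x v $ 1" by (rule mderiv_nth[OF c])
      finally show ?thesis .
    qed
    show ?thesis
      unfolding dual_conn_def cov_atD[OF D sc ev]
      by (simp add: vec_eq_iff forall_1 matrix_1_vector dc adj_nth)
  qed
  note res = cov_atI[of ?n x "dual_conn D" "\<lambda>v. adj (conn_form D n x v)", OF iso main]
  show "cov_at (dual_conn D) ?n x" by (rule res(1))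
  show "conn_form (dual_conn D) ?n x v = adj (conn_form D n x v)" by (rule res(2))
qed

text \<open>Written in the ambient frame \<open>e\<close>, the frame \<open>f\<close> becomes the
  isometry \<open>g\<close>, and the projection to its range amounts to multiplication by
  \<open>adj g\<close>. Only the tangential part of \<open>dg + a ** g\<close> remains, for
  \<open>a\<close> the form of \<open>D\<close> in \<open>e\<close>.\<close>

lemma proj_conn_cov:
  fixes e :: "'m \<Rightarrow> complex^'k^'k" and f :: "'m \<Rightarrow> complex^'r^'k"
  assumes D: "cov_at D e x" and e: "\<forall>\<^sub>F y in nhds x. adj (e y) ** e y = mat 1"
    and g: "smooth_at M x (\<lambda>y. adj (e y) ** f y)" and f: "adj (f x) ** f x = mat 1"
    and P: "fibre_proj \<F> x = f x ** adj (f x)"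
  shows "cov_at (proj_conn \<F> D) f x"
    "conn_form (proj_conn \<F> D) f x v = adj (adj (e x) ** f x) **
       (mderiv M (\<lambda>y. adj (e y) ** f y) x v + conn_form D e x v ** (adj (e x) ** f x))"
proof -
  define g where "g y = adj (e y) ** f y" for y
  have sg: "smooth_at M x g" using g by (simp add: g_def[abs_def])
  have eg: "\<forall>\<^sub>F y in nhds x. f y = e y ** g y"
    using e by eventually_elim (simp add: g_def matrix_mul_assoc isometry_square)
  have fx: "f x = e x ** g x" and ex: "adj (e x) ** e x = mat 1"
    using eventually_nhds_x_imp_x[OF eg] eventually_nhds_x_imp_x[OF e] by auto
  have gg: "adj (g x) ** g x = mat 1"
    using f isometry_square[OF ex] by (simp add: g_def adj_mult matrix_mul_assoc) (metis matrix_mul_assoc matrix_mul_rid)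
  have fe: "adj (f x) ** e x = adj (g x)" by (simp add: g_def adj_mult)
  have main: "proj_conn \<F> D s x v = f x *v (mderiv M c x v + (adj (g x) ** (mderiv M g x v + conn_form D e x v ** g x)) *v c x)"
    if c: "smooth_at M x c" and s: "\<forall>\<^sub>F y in nhds x. s y = f y *v c y" for c s v
  proof -
    have ev: "\<forall>\<^sub>F y in nhds x. s y = e y *v (g y *v c y)"
      using s eg by eventually_elim (simp add: matrix_vector_mul_assoc)
    have "D s x v = e x *v (mderiv M (\<lambda>y. g y *v c y) x v + conn_form D e x v *v (g x *v c x))"
      by (rule cov_atD[OF D _ ev]) (intro smooth_intros sg c)
    also have "mderiv M (\<lambda>y. g y *v c y) x v = g x *v mderiv M c x v + mderiv M g x v *v c x"
      by (rule mderiv_mvec[OF sg c])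
    finally have "proj_conn \<F> D s x v = f x *v ((adj (f x) ** e x) *v
        (g x *v mderiv M c x v + mderiv M g x v *v c x + conn_form D e x v *v (g x *v c x)))"
      by (simp add: proj_conn_def P matrix_vector_mul_assoc matrix_mul_assoc)
    also have "\<dots> = f x *v ((adj (g x) ** g x) *v mderiv M c x v
        + (adj (g x) ** (mderiv M g x v + conn_form D e x v ** g x)) *v c x)"
      unfolding fe by (simp add: matrix_vector_right_distrib matrix_vector_mult_add_rdistrib matrix_vector_mul_assoc
          matrix_add_ldistrib matrix_mul_assoc add.assoc)
    finally show ?thesis unfolding gg by simp
  qed
  note res = cov_atI[of f x "proj_conn \<F> D" "\<lambda>v. adj (g x) ** (mderiv M g x v + conn_form D e x v ** g x)", OF f main]
  show "cov_at (proj_conn \<F> D) f x" by (rule res(1))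
  show "conn_form (proj_conn \<F> D) f x v = adj (adj (e x) ** f x) **
       (mderiv M (\<lambda>y. adj (e y) ** f y) x v + conn_form D e x v ** (adj (e x) ** f x))"
    using res(2) by (simp add: g_def[abs_def])
qed

text \<open>Differentiating \<open>adj g ** g = mat 1\<close> shows that \<open>adj g\<close> times
  the derivative of \<open>g\<close> is skew.\<close>

lemma skew_form_pullback:
  fixes g :: "'m \<Rightarrow> complex^'r^'k"
  assumes g: "smooth_at M x g" "\<forall>\<^sub>F y in nhds x. adj (g y) ** g y = mat 1" and a: "adj a = - a"
  shows "adj (adj (g x) ** (mderiv M g x v + a ** g x)) = - (adj (g x) ** (mderiv M g x v + a ** g x))"
proof -
  have "mderiv M (\<lambda>y. adj (g y) ** g y) x v = 0"
    using mderiv_cong[OF g(2)] by (simp add: mderiv_const)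
  moreover have "mderiv M (\<lambda>y. adj (g y) ** g y) x v = adj (g x) ** mderiv M g x v + adj (mderiv M g x v) ** g x"
    by (subst mderiv_mmul) (auto intro!: smooth_intros g simp: mderiv_adj[OF g(1)])
  ultimately have "adj (mderiv M g x v) ** g x = - (adj (g x) ** mderiv M g x v)"
    by (simp add: eq_neg_iff_add_eq_0 add.commute)
  moreover have "adj (g x) ** (- a) ** g x = - (adj (g x) ** a ** g x)"
    by (simp add: vec_eq_iff matrix_matrix_mult_def sum_negf)
  ultimately show ?thesis by (simp add: adj_mult adj_add a matrix_add_ldistrib matrix_mult_add_left matrix_mul_assoc)
qed

lemma smooth_at_matrix_iff: "smooth_at M x f \<longleftrightarrow> (\<forall>j. smooth_at M x (\<lambda>y. column j (f y :: complex^'r^'k)))"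
proof
  assume *: "\<forall>j. smooth_at M x (\<lambda>y. column j (f y))"
  have "smooth_at M x (\<lambda>y. \<chi> i j. column j (f y) $ i)" 
    by (intro smooth_at_vec smooth_at_nth spec[OF *])
  moreover have "(\<chi> i j. column j (f y) $ i) = f y" for y by (simp add: vec_eq_iff column_def)
  ultimately show "smooth_at M x f" by simp
qed (auto intro!: smooth_intros)

lemma range_subset_iff_columns:
  fixes h :: "complex^'r^'k" and e :: "complex^'s^'k"
  shows "range ((*v) h) \<subseteq> range ((*v) e) \<longleftrightarrow> (\<forall>j. column j h \<in> range ((*v) e))"
proof
  assume "range ((*v) h) \<subseteq> range ((*v) e)"
  then show "\<forall>j. column j h \<in> range ((*v) e)" by (metis matrix_vector_axis rangeI subsetD)
next
  assume "\<forall>j. column j h \<in> range ((*v) e)"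
  then have "\<forall>j. \<exists>c. column j h = e *v c" by blast
  then obtain c where c: "\<And>j. column j h = e *v c j" by metis
  have "h = e ** (\<chi> i j. c j $ i)"
  proof (rule matrix_eq_columnI)
    have "column j (\<chi> i j. c j $ i) = c j" for j by (simp add: vec_eq_iff column_def)
    then show "column j h = column j (e ** (\<chi> i j. c j $ i))" for j by (simp only: column_matrix_mult c)
  qed
  then show "range ((*v) h) \<subseteq> range ((*v) e)" by (auto simp: matrix_vector_mul_assoc[symmetric])
qed

text \<open>Turns smoothness of the single columns as sections into smoothness of whole transition
  matrices near each point, the form in which frames are compared.\<close>

lemma unitary_frames_iff:
  fixes \<E> :: "('m, 'q::finite, 'k::finite) frames" and f :: "'m \<Rightarrow> complex^'r::finite^'k"
  assumes op: "\<And>V e. (V, e) \<in> \<E> \<Longrightarrow> open V"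
  shows "(U, f) \<in> unitary_frames M W \<E> F \<longleftrightarrow> open U \<and> U \<subseteq> W \<and>
    (\<forall>x\<in>U. \<forall>(V, e)\<in>\<E>. x \<in> V \<longrightarrow> range ((*v) (f x)) \<subseteq> range ((*v) (e x)) \<and> smooth_at M x (\<lambda>y. adj (e y) ** f y)) \<and>
    (\<forall>x\<in>U. adj (f x) ** f x = mat 1 \<and> range ((*v) (f x)) = F x)"
proof -
  have eq: "(\<forall>j. smooth_section M \<E> U (\<lambda>y. column j (f y))) \<longleftrightarrow> (\<forall>x\<in>U. \<forall>(V, e)\<in>\<E>. x \<in> V \<longrightarrow>
      range ((*v) (f x)) \<subseteq> range ((*v) (e x)) \<and> smooth_at M x (\<lambda>y. adj (e y) ** f y))" if U: "open U"
  proof -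
    have "smooth_map M (U \<inter> V) (\<lambda>x. adj (e x) *v column j (f x)) \<longleftrightarrow>
        (\<forall>x\<in>U \<inter> V. smooth_at M x (\<lambda>x. column j (adj (e x) ** f x)))" if "(V, e) \<in> \<E>" for V e j
      using smooth_map_iff[of "U \<inter> V"] op[OF that] U by (auto simp: column_matrix_mult)
    then show ?thesis
      unfolding smooth_section_def range_subset_iff_columns
        smooth_at_matrix_iff[of _ "\<lambda>y. adj (_ y) ** f y"]
      by fastforce
  qed
  show ?thesis
    by (cases "open U") (simp_all only: unitary_frames_def mem_Collect_eq prod.case eq simp_thms)
qed

end

context manifold
begin

lemma cov_at_cong:
  assumes "cov_at D e x" "adj (e x) ** e x = mat 1" "\<forall>\<^sub>F y in nhds x. e' y = e y"
  shows "cov_at D e' x" "conn_form D e' x v = conn_form D e x v"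
  using cov_at_change[OF assms(1,2), of "\<lambda>y. mat 1" e'] assms(3) by (auto simp: smooth_at_const mderiv_const)

lemma mderiv_det_2:
  fixes m :: "'m \<Rightarrow> complex^2^2"
  assumes m: "smooth_at M x m"
  shows "mderiv M (\<lambda>y. det (m y)) x v = mderiv M m x v $1$1 * m x $2$2 + m x $1$1 * mderiv M m x v $2$2
     - mderiv M m x v $1$2 * m x $2$1 - m x $1$2 * mderiv M m x v $2$1"
proof -
  have n: "mderiv M (\<lambda>y. m y $ i $ j) x v = mderiv M m x v $ i $ j" for i j
    using mderiv_nth[OF smooth_at_nth[OF m, of i], of j] mderiv_nth[OF m, of i] by simp
  have s: "smooth_at M x (\<lambda>y. m y $ i $ j)" for i j by (intro smooth_intros m)
  have p: "smooth_at M x (\<lambda>y. m y $ i $ j * m y $ i' $ j')" for i j i' j' by (intro smooth_intros m)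
  show ?thesis
    unfolding det_2 mderiv_diff[OF p p] mderiv_mult[OF s s] n by simp
qed

lemma dmat_frame:
  assumes "cov_at D e x"
  shows "dmat D e x v = e x ** conn_form D e x v"
  using cov_at_matrix[OF assms, of "\<lambda>y. mat 1" e v] by (simp add: smooth_at_const mderiv_const)

end

definition conj_frame :: "('m \<Rightarrow> complex^1^1) \<Rightarrow> 'm \<Rightarrow> complex^1^1" where
  "conj_frame n = (\<lambda>y. \<chi> i j. cnj (n y $ i $ j))"

lemma conj_frame_nth [simp]: "conj_frame n y $ i $ j = cnj (n y $ i $ j)"
  by (simp add: conj_frame_def)

context manifold
begin

section \<open>Tensor products, restrictions and duals of bundles\<close>

lemma G_bundleI:
  assumes "\<And>x. x \<in> W \<Longrightarrow> \<exists>U e. (U, e) \<in> \<E> \<and> x \<in> U"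
    and 1: "\<And>U e. (U, e) \<in> \<E> \<Longrightarrow> open U" "\<And>U e. (U, e) \<in> \<E> \<Longrightarrow> U \<subseteq> W"
      "\<And>U e x. (U, e) \<in> \<E> \<Longrightarrow> x \<in> U \<Longrightarrow> adj (e x) ** e x = mat 1"
    and 2: "\<And>U e V f x. (U, e) \<in> \<E> \<Longrightarrow> (V, f) \<in> \<E> \<Longrightarrow> x \<in> U \<Longrightarrow> x \<in> V \<Longrightarrow>
      range ((*v) (e x)) = range ((*v) (f x)) \<and> adj (e x) ** f x \<in> G \<and> smooth_at M x (\<lambda>x. adj (e x) ** f x)"
  shows "G_bundle M W G \<E>"
  unfolding G_bundle_def
proof (intro conjI ballI)
  show "(\<Union>(U, e)\<in>\<E>. U) = W"
  proof
    show "(\<Union>(U, e)\<in>\<E>. U) \<subseteq> W" using 1(2) by auto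
    show "W \<subseteq> (\<Union>(U, e)\<in>\<E>. U)"
    proof
      fix x assume "x \<in> W"
      then obtain U e where "(U, e) \<in> \<E>" "x \<in> U" using assms(1) by metis
      then show "x \<in> (\<Union>(U, e)\<in>\<E>. U)" by (intro UN_I[of "(U, e)"]) simp_all
    qed
  qed
  show "case p of (U, e) \<Rightarrow> open U \<and> (\<forall>x\<in>U. adj (e x) ** e x = mat 1)" if "p \<in> \<E>" for p
    using 1 that by (cases p) simp
  show "case p of (U, e) \<Rightarrow> \<forall>(V, f)\<in>\<E>.
        (\<forall>x\<in>U \<inter> V. range ((*v) (e x)) = range ((*v) (f x)) \<and> adj (e x) ** f x \<in> G) \<and>
        smooth_map M (U \<inter> V) (\<lambda>x. adj (e x) ** f x)" if p: "p \<in> \<E>" for p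
  proof -
    obtain U e where e: "p = (U, e)" by (cases p)
    have "(\<forall>x\<in>U \<inter> V. range ((*v) (e x)) = range ((*v) (f x)) \<and> adj (e x) ** f x \<in> G) \<and>
        smooth_map M (U \<inter> V) (\<lambda>x. adj (e x) ** f x)" if f: "(V, f) \<in> \<E>" for V f
    proof -
      have "open (U \<inter> V)" using 1(1) p e f by auto
      then show ?thesis using 2[of U e V f] p e f by (simp add: smooth_map_iff)
    qed
    then have "\<forall>q\<in>\<E>. case q of (V, f) \<Rightarrow>
        (\<forall>x\<in>U \<inter> V. range ((*v) (e x)) = range ((*v) (f x)) \<and> adj (e x) ** f x \<in> G) \<and>
        smooth_map M (U \<inter> V) (\<lambda>x. adj (e x) ** f x)"
      by (intro ballI, case_tac q) (simp only: prod.case)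
    then show ?thesis unfolding e prod.case .
  qed
qed

lemma U_group_transition:
  "adj e ** e = mat 1 \<Longrightarrow> adj f ** f = mat 1 \<Longrightarrow> range ((*v) e) = range ((*v) f) \<Longrightarrow> adj e ** f \<in> U_group"
  using isometry_transition(1)[of e f] by (simp add: U_group_def)

lemma tensor_lineE:
  assumes "(T, t) \<in> tensor_line \<E> \<L>"
  obtains U e V l where "(U, e) \<in> \<E>" "(V, l) \<in> \<L>" "T = U \<inter> V" "t = (\<lambda>x. mscale (l x $ 1 $ 1) (e x))"
  using assms by (auto simp: tensor_line_def)

lemma tensor_lineI:
  "(U, e) \<in> \<E> \<Longrightarrow> (V, l) \<in> \<L> \<Longrightarrow> (U \<inter> V, \<lambda>x. mscale (l x $ 1 $ 1) (e x)) \<in> tensor_line \<E> \<L>"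
  by (auto simp: tensor_line_def)

lemma tensor_frame_isometry:
  fixes l :: "complex^1^1"
  assumes "adj e ** e = mat 1" "adj l ** l = mat 1"
  shows "adj (mscale (l $ 1 $ 1) e) ** mscale (l $ 1 $ 1) e = mat 1"
  by (rule isometry_mscale[OF frame_1_unit(1)[OF assms(2)] assms(1)])

lemma G_bundle_tensor:
  fixes \<E> :: "('m, 'r::finite, 'k::finite) frames"
  assumes E: "G_bundle M W U_group \<E>" and L: "G_bundle M W U_group \<L>"
  shows "G_bundle M W U_group (tensor_line \<E> \<L>)"
proof (rule G_bundleI)
  fix x assume "x \<in> W"
  obtain U e where e: "(U, e) \<in> \<E>" "x \<in> U" by (rule G_bundle_frame_ex[OF E \<open>x \<in> W\<close>])
  obtain V l where l: "(V, l) \<in> \<L>" "x \<in> V" by (rule G_bundle_frame_ex[OF L \<open>x \<in> W\<close>])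
  show "\<exists>U e. (U, e) \<in> tensor_line \<E> \<L> \<and> x \<in> U" using tensor_lineI[OF e(1) l(1)] e(2) l(2) by blast
next
  fix T t assume t: "(T, t) \<in> tensor_line \<E> \<L>"
  obtain U e V l where k: "(U, e) \<in> \<E>" "(V, l) \<in> \<L>" "T = U \<inter> V" "t = (\<lambda>x. mscale (l x $ 1 $ 1) (e x))"
    by (rule tensor_lineE[OF t]) (rule that)
  show "open T" using G_bundleD(1)[OF E k(1)] G_bundleD(1)[OF L k(2)] k(3) by auto
  show "T \<subseteq> W" using G_bundleD(2)[OF E k(1)] k(3) by auto
  show "adj (t x) ** t x = mat 1" if "x \<in> T" for x
    using that unfolding k(3,4) by (intro tensor_frame_isometry G_bundleD(3)[OF E k(1)] G_bundleD(3)[OF L k(2)]) auto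
next
  fix T t T' t' x
  assume t: "(T, t) \<in> tensor_line \<E> \<L>" and t': "(T', t') \<in> tensor_line \<E> \<L>" and x: "x \<in> T" "x \<in> T'"
  obtain U e V l where k: "(U, e) \<in> \<E>" "(V, l) \<in> \<L>" "T = U \<inter> V" "t = (\<lambda>x. mscale (l x $ 1 $ 1) (e x))"
    by (rule tensor_lineE[OF t]) (rule that)
  obtain U' e' V' l' where k': "(U', e') \<in> \<E>" "(V', l') \<in> \<L>" "T' = U' \<inter> V'" "t' = (\<lambda>x. mscale (l' x $ 1 $ 1) (e' x))"
    by (rule tensor_lineE[OF t']) (rule that)
  have X: "x \<in> U" "x \<in> V" "x \<in> U'" "x \<in> V'" using x k k' by auto
  note l = frame_1_unit[OF G_bundleD(3)[OF L k(2) X(2)]] and l' = frame_1_unit[OF G_bundleD(3)[OF L k'(2) X(4)]]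
  have eq: "adj (t y) ** t' y = mscale ((adj (l y) ** l' y) $ 1 $ 1) (adj (e y) ** e' y)" for y
    unfolding k k' by (simp add: adj_mscale mscale_mult_left mscale_mult_right mscale_mscale matrix_1_mult adj_nth mult.commute)
  have "smooth_at M x (\<lambda>x. adj (t x) ** t' x)"
    unfolding eq
    by (rule smooth_at_bilinear[OF bounded_bilinear_mscale smooth_at_nth[OF smooth_at_nth[OF
            G_bundle_transition(3)[OF L k(2) k'(2) X(2,4)]]] G_bundle_transition(3)[OF E k(1) k'(1) X(1,3)]])
  moreover have r: "range ((*v) (t x)) = range ((*v) (t' x))"
    unfolding k k' using G_bundle_transition(1)[OF E k(1) k'(1) X(1,3)] by (simp add: range_mscale l(2) l'(2))
  moreover have "adj (t x) ** t' x \<in> U_group"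
    by (rule U_group_transition[OF _ _ r]; unfold k k', rule tensor_frame_isometry)
      (rule G_bundleD(3)[OF E k(1) X(1)] G_bundleD(3)[OF L k(2) X(2)] G_bundleD(3)[OF E k'(1) X(3)] G_bundleD(3)[OF L k'(2) X(4)])+
  ultimately show "range ((*v) (t x)) = range ((*v) (t' x)) \<and> adj (t x) ** t' x \<in> U_group
      \<and> smooth_at M x (\<lambda>x. adj (t x) ** t' x)" by simp
qed

lemma bundle_restrictE:
  assumes "(T, t) \<in> bundle_restrict V \<E>"
  obtains U where "(U, t) \<in> \<E>" "T = U \<inter> V"
  using assms by (auto simp: bundle_restrict_def)

lemma bundle_restrictI: "(U, e) \<in> \<E> \<Longrightarrow> (U \<inter> V, e) \<in> bundle_restrict V \<E>"
  by (force simp: bundle_restrict_def)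

lemma G_bundle_restrict:
  assumes E: "G_bundle M W G \<E>" and V: "open V" "V \<subseteq> W"
  shows "G_bundle M V G (bundle_restrict V \<E>)"
proof (rule G_bundleI)
  fix x assume x: "x \<in> V"
  then have "x \<in> W" using V by auto
  then obtain U e where e: "(U, e) \<in> \<E>" "x \<in> U" by (rule G_bundle_frame_ex[OF E])
  show "\<exists>U e. (U, e) \<in> bundle_restrict V \<E> \<and> x \<in> U" using bundle_restrictI[OF e(1), of V] e(2) x by blast
next
  fix T t assume t: "(T, t) \<in> bundle_restrict V \<E>"
  obtain U where k: "(U, t) \<in> \<E>" "T = U \<inter> V" by (rule bundle_restrictE[OF t]) (rule that)
  show "open T" "T \<subseteq> V" "\<And>x. x \<in> T \<Longrightarrow> adj (t x) ** t x = mat 1"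
    using G_bundleD(1,3)[OF E k(1)] V(1) k(2) by auto
next
  fix T t T' t' x
  assume t: "(T, t) \<in> bundle_restrict V \<E>" and t': "(T', t') \<in> bundle_restrict V \<E>" and x: "x \<in> T" "x \<in> T'"
  obtain U where k: "(U, t) \<in> \<E>" "T = U \<inter> V" by (rule bundle_restrictE[OF t]) (rule that)
  obtain U' where k': "(U', t') \<in> \<E>" "T' = U' \<inter> V" by (rule bundle_restrictE[OF t']) (rule that)
  show "range ((*v) (t x)) = range ((*v) (t' x)) \<and> adj (t x) ** t' x \<in> G \<and> smooth_at M x (\<lambda>x. adj (t x) ** t' x)"
    using G_bundle_transition[OF E k(1) k'(1)] x k(2) k'(2) by simp
qed

lemma conj_frame_isometry: "adj (n x) ** n x = mat 1 \<Longrightarrow> adj (conj_frame n x) ** conj_frame n x = mat 1"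
  using frame_1_unit(1)[of "n x"] by (simp add: matrix_1_eq_iff matrix_1_mult adj_nth mult.commute)

lemma dual_lineE:
  assumes "(T, t) \<in> dual_line \<N>"
  obtains n where "(T, n) \<in> \<N>" "t = conj_frame n"
  using assms by (auto simp: dual_line_def conj_frame_def)

lemma dual_lineI: "(U, n) \<in> \<N> \<Longrightarrow> (U, conj_frame n) \<in> dual_line \<N>"
  by (auto simp: dual_line_def conj_frame_def)

lemma range_frame_square: "adj (n :: complex^'r^'r) ** n = mat 1 \<Longrightarrow> range ((*v) n) = UNIV"
  using isometry_square[of n] by (metis matrix_right_invertible_surjective)

lemma G_bundle_dual:
  assumes N: "G_bundle M W U_group \<N>"
  shows "G_bundle M W U_group (dual_line \<N>)"
proof (rule G_bundleI)
  fix x assume x: "x \<in> W"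
  then obtain U n where n: "(U, n) \<in> \<N>" "x \<in> U" by (rule G_bundle_frame_ex[OF N])
  show "\<exists>U e. (U, e) \<in> dual_line \<N> \<and> x \<in> U" using dual_lineI[OF n(1)] n(2) by blast
next
  fix T t assume t: "(T, t) \<in> dual_line \<N>"
  obtain n where k: "(T, n) \<in> \<N>" "t = conj_frame n" by (rule dual_lineE[OF t]) (rule that)
  show "open T" "T \<subseteq> W" using G_bundleD(1,2)[OF N k(1)] by auto
  show "adj (t x) ** t x = mat 1" if "x \<in> T" for x
    unfolding k(2) by (rule conj_frame_isometry[of n x, OF G_bundleD(3)[OF N k(1) that]])
next
  fix T t T' t' x
  assume t: "(T, t) \<in> dual_line \<N>" and t': "(T', t') \<in> dual_line \<N>" and x: "x \<in> T" "x \<in> T'"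
  obtain n where k: "(T, n) \<in> \<N>" "t = conj_frame n" by (rule dual_lineE[OF t]) (rule that)
  obtain n' where k': "(T', n') \<in> \<N>" "t' = conj_frame n'" by (rule dual_lineE[OF t']) (rule that)
  have eq: "adj (conj_frame n x) ** conj_frame n' x = conj_frame (\<lambda>x. adj (n x) ** n' x) x" for x
    by (simp add: matrix_1_eq_iff matrix_1_mult adj_nth)
  have eq': "(\<lambda>x. adj (t x) ** t' x) = (\<lambda>y. \<chi> i j. cnj ((adj (n y) ** n' y) $ i $ j))"
    by (simp add: k(2) k'(2) eq fun_eq_iff vec_eq_iff)
  have i: "adj (t x) ** t x = mat 1" "adj (t' x) ** t' x = mat 1"
    unfolding k(2) k'(2)
    by (rule conj_frame_isometry[of n x, OF G_bundleD(3)[OF N k(1) x(1)]]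
        conj_frame_isometry[of n' x, OF G_bundleD(3)[OF N k'(1) x(2)]])+
  have "smooth_at M x (\<lambda>x. adj (t x) ** t' x)"
    unfolding eq'
    by (intro smooth_at_vec smooth_at_linear[OF bounded_linear_cnj] smooth_at_nth G_bundle_transition(3)[OF N k(1) k'(1) x])
  then show "range ((*v) (t x)) = range ((*v) (t' x)) \<and> adj (t x) ** t' x \<in> U_group \<and> smooth_at M x (\<lambda>x. adj (t x) ** t' x)"
    using range_frame_square[OF i(1)] range_frame_square[OF i(2)] U_group_transition[OF i] by simp
qed

end

section \<open>The coimage of a solution\<close>

locale solution_setup =
  fixes M :: "'m::t2_space spin_manifold"
    and \<E> :: "('m, 'n::finite, 'n) frames" and B :: "('m, 'n) conn"
    and \<L> :: "('m, 1, 1) frames" and A :: "('m, 1) conn"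
    and \<Psi> :: "'m \<Rightarrow> complex^'n^2"
  assumes closed: "closed_spin_manifold M"
    and E: "G_bundle M UNIV SU_group \<E>" and B: "connection M su_alg \<E> B"
    and L: "G_bundle M UNIV U_group \<L>" and A: "connection M u_alg \<L> A"
    and sol: "solution M UNIV \<E> B \<L> A \<Psi>"
begin

sublocale manifold M
  using closed by unfold_locales (simp add: closed_spin_manifold_def)

definition W where "W = - {x. \<Psi> x = 0}"
definition F where "F = (\<lambda>x. perp {v. \<Psi> x *v v = 0})"
definition FF :: "('m, 2, 'n) frames" where "FF = unitary_frames M W (bundle_restrict W \<E>) F"
definition BF where "BF = proj_conn FF B"
definition KK where "KK = det_bundle FF"
definition BK where "BK = det_conn M FF BF"
text \<open>The scalar value of \<open>\<Psi> x ** adj (\<Psi> x)\<close>; the half comes from the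
  rank 2 of the spinors. Unlike the norm it is smooth across the zeros.\<close>

definition h2 where "h2 x = (norm (\<Psi> x))\<^sup>2 / 2"

abbreviation "\<S> \<equiv> spinor_bundle M"

lemma S: "G_bundle M UNIV SU_group \<S>"
  using closed by (auto simp: closed_spin_manifold_def spin_structure_def spinor_bundle_def)

lemma Psi_adj: "\<Psi> x ** adj (\<Psi> x) = mscale (of_real (h2 x)) (mat 1)"
  using sol by (simp add: solution_def mu_def h2_def scaleR_eq_mscale)

lemma h2_pos: "x \<in> W \<longleftrightarrow> h2 x > 0"
  by (simp add: W_def h2_def)

text \<open>The conjugate of \<open>l\<close> appears because \<Psi> is expressed in the frame
  \<open>s \<otimes> l\<close>, whose adjoint is \<open>cnj l\<close> times
  \<open>adj s\<close>.\<close>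

lemma smooth_Psi:
  assumes e: "(U, e) \<in> \<E>" "x \<in> U" and s: "(V, s) \<in> \<S>" "x \<in> V" and l: "(V', l) \<in> \<L>" "x \<in> V'"
  shows "smooth_at M x (\<lambda>y. mscale (cnj (l y $ 1 $ 1)) (adj (s y) ** \<Psi> y ** e y))"
proof -
  have t: "(V \<inter> V', \<lambda>y. mscale (l y $ 1 $ 1) (s y)) \<in> tensor_line \<S> \<L>" using s l by (auto simp: tensor_line_def)
  have "\<forall>(U, e)\<in>\<E>. \<forall>(V, t)\<in>tensor_line \<S> \<L>. smooth_map M (UNIV \<inter> U \<inter> V) (\<lambda>x. adj (t x) ** \<Psi> x ** e x)"
    using sol unfolding solution_def smooth_hom_def by (elim conjE)
  from bspec[OF bspec[OF this e(1), unfolded prod.case] t, unfolded prod.case]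
  have "smooth_map M (U \<inter> (V \<inter> V')) (\<lambda>y. mscale (cnj (l y $ 1 $ 1)) (adj (s y) ** \<Psi> y ** e y))"
    by (simp add: adj_mscale mscale_mult_left)
  then show ?thesis
    using e s l G_bundleD(1)[OF E e(1)] G_bundleD(1)[OF S s(1)] G_bundleD(1)[OF L l(1)]
    unfolding smooth_at_def by (intro exI[of _ "U \<inter> (V \<inter> V')"]) auto
qed

text \<open>In unitary frames the equation \<open>mu = 0\<close> says that \<open>m ** adj m\<close>
  is \<open>h2\<close> times the identity, so \<open>h2\<close> is a diagonal entry of a product of
  smooth matrices.\<close>

lemma smooth_h2: "smooth_at M x h2"
proof -
  obtain U e where e: "(U, e) \<in> \<E>" "x \<in> U" using G_bundle_frame_ex[OF E] by blast
  obtain V s where s: "(V, s) \<in> \<S>" "x \<in> V" using G_bundle_frame_ex[OF S] by blast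
  obtain V' l where l: "(V', l) \<in> \<L>" "x \<in> V'" using G_bundle_frame_ex[OF L] by blast
  define m where "m y = mscale (cnj (l y $ 1 $ 1)) (adj (s y) ** \<Psi> y ** e y)" for y
  have "\<forall>\<^sub>F y in nhds x. Re ((m y ** adj (m y)) $ 1 $ 1) = h2 y"
    using G_bundle_near[OF E e(1) e(2)] G_bundle_near[OF S s(1) s(2)]
      G_bundle_near[OF L l(1) l(2)]
  proof eventually_elim
    case (elim y)
    have "m y ** adj (m y) = mscale (cnj (l y $ 1 $ 1) * l y $ 1 $ 1)
        (adj (s y) ** (\<Psi> y ** (e y ** adj (e y)) ** adj (\<Psi> y)) ** s y)"
      by (simp add: m_def mult.commute adj_mscale adj_mult mscale_mult_left mscale_mult_right mscale_mscale matrix_mul_assoc)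
    also have "\<dots> = mscale (of_real (h2 y)) (mat 1)"
      using isometry_square[OF G_bundleD(3)[OF E e(1) elim(1)]] G_bundleD(3)[OF S s(1) elim(2)]
        frame_1_unit(1)[OF G_bundleD(3)[OF L l(1) elim(3)]]
      by (simp add: Psi_adj mscale_mult_left mscale_mult_right)
    finally show ?case by (simp add: mscale_nth mat_def)
  qed
  moreover have "smooth_at M x (\<lambda>y. Re ((m y ** adj (m y)) $ 1 $ 1))"
    unfolding m_def by (intro smooth_intros smooth_Psi[OF e s l])
  ultimately show ?thesis by (rule smooth_at_cong)
qed

lemma cont_h2: "continuous_on UNIV h2"
  using smooth_at_isCont[OF smooth_h2] by (simp add: continuous_on_eq_continuous_at)

lemma cont_norm_Psi: "continuous_on UNIV (\<lambda>x. norm (\<Psi> x))"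
proof -
  have "norm (\<Psi> x) = sqrt (2 * h2 x)" for x by (simp add: h2_def)
  then show ?thesis using cont_h2 by (auto intro!: continuous_intros)
qed

lemma W_open: "open W"
proof -
  have "W = h2 -` {0<..}" using h2_pos by auto
  then show ?thesis using open_vimage[OF _ cont_h2, of "{0<..}"] by simp
qed

lemma F_eq: "x \<in> W \<Longrightarrow> F x = range ((*v) (adj (\<Psi> x)))"
  unfolding F_def using h2_pos[of x] by (intro perp_ker_eq_range[OF Psi_adj]) auto

lemma E_range: "(V, e) \<in> \<E> \<Longrightarrow> x \<in> V \<Longrightarrow> range ((*v) (e x)) = UNIV"
  using isometry_square[OF G_bundleD(3)[OF E]] by (metis matrix_right_invertible_surjective)

text \<open>The frames of \<open>\<E>\<close> are square, so their ranges are the whole space and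
  membership in the fibres is automatic; what remains is smoothness of the transition
  matrices.\<close>

lemma FF_iff:
  "(U, f) \<in> FF \<longleftrightarrow> open U \<and> U \<subseteq> W \<and>
    (\<forall>x\<in>U. \<forall>(V, e)\<in>\<E>. x \<in> V \<longrightarrow> smooth_at M x (\<lambda>y. adj (e y) ** f y)) \<and>
    (\<forall>x\<in>U. adj (f x) ** f x = mat 1 \<and> range ((*v) (f x)) = F x)"
proof -
  have op: "open V" if "(V, e) \<in> bundle_restrict W \<E>" for V e
    using that W_open G_bundleD(1)[OF E] by (auto simp: bundle_restrict_def)
  have *: "(\<forall>(V, e)\<in>bundle_restrict W \<E>. x \<in> V \<longrightarrow> range ((*v) (f x)) \<subseteq> range ((*v) (e x)) \<and> smooth_at M x (\<lambda>y. adj (e y) ** f y))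
     \<longleftrightarrow> (\<forall>(V, e)\<in>\<E>. x \<in> V \<longrightarrow> smooth_at M x (\<lambda>y. adj (e y) ** f y))" if "x \<in> W" for x
    using that E_range by (auto simp: bundle_restrict_def)
  have eq: "(\<forall>x\<in>U. \<forall>(V, e)\<in>bundle_restrict W \<E>. x \<in> V \<longrightarrow> range ((*v) (f x)) \<subseteq> range ((*v) (e x)) \<and> smooth_at M x (\<lambda>y. adj (e y) ** f y))
     \<longleftrightarrow> (\<forall>x\<in>U. \<forall>(V, e)\<in>\<E>. x \<in> V \<longrightarrow> smooth_at M x (\<lambda>y. adj (e y) ** f y))" if "U \<subseteq> W"
    by (rule ball_cong[OF refl], rule *) (use that in auto)
  note iff = unitary_frames_iff[of "bundle_restrict W \<E>" U f W F]
  show ?thesis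
  proof (cases "U \<subseteq> W")
    case True
    show ?thesis unfolding FF_def by (subst iff[OF op], assumption) (simp only: eq[OF True])
  next
    case False
    show ?thesis unfolding FF_def by (subst iff[OF op], assumption) (simp only: False simp_thms)
  qed
qed

lemma FF_D:
  assumes "(U, f) \<in> FF"
  shows "open U" "U \<subseteq> W" "\<And>V e x. x \<in> U \<Longrightarrow> (V, e) \<in> \<E> \<Longrightarrow> x \<in> V \<Longrightarrow> smooth_at M x (\<lambda>y. adj (e y) ** f y)"
    "\<And>x. x \<in> U \<Longrightarrow> adj (f x) ** f x = mat 1" "\<And>x. x \<in> U \<Longrightarrow> range ((*v) (f x)) = F x"
  using assms unfolding FF_iff by auto

text \<open>The frame \<open>s \<otimes> l\<close> carried over by the adjoint of \<Psi>, which
  scales lengths by the square root of \<open>h2\<close>. Dividing by this factor gives a unitary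
  frame of F, and with it the rank and smoothness of F.\<close>

lemma FF_adapted:
  assumes s: "(V, s) \<in> \<S>" and l: "(V', l) \<in> \<L>"
  shows "(V \<inter> V' \<inter> W, \<lambda>y. mscale (l y $ 1 $ 1 * of_real (inverse (sqrt (h2 y)))) (adj (\<Psi> y) ** s y)) \<in> FF"
  unfolding FF_iff
proof (intro conjI ballI)
  show "open (V \<inter> V' \<inter> W)" using G_bundleD(1)[OF S s] G_bundleD(1)[OF L l] W_open by auto
  fix x assume x: "x \<in> V \<inter> V' \<inter> W"
  note lx = frame_1_unit[OF G_bundleD(3)[OF L l]]
  have h: "h2 x > 0" using x h2_pos by auto
  show "case p of (U, e) \<Rightarrow> x \<in> U \<longrightarrow> smooth_at M x
      (\<lambda>y. adj (e y) ** mscale (l y $ 1 $ 1 * of_real (inverse (sqrt (h2 y)))) (adj (\<Psi> y) ** s y))" if "p \<in> \<E>" for p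
  proof -
    obtain U e where e: "p = (U, e)" by force
    have "smooth_at M x (\<lambda>y. mscale (of_real (inverse (sqrt (h2 y))))
        (adj (mscale (cnj (l y $ 1 $ 1)) (adj (s y) ** \<Psi> y ** e y))))" if "x \<in> U"
      using x h that \<open>p \<in> \<E>\<close> e by (intro smooth_intros smooth_Psi[OF _ _ s _ l] smooth_at_inverse smooth_at_sqrt smooth_h2) auto
    then show ?thesis
      by (simp add: e adj_mscale adj_mult mscale_mult_right mscale_mscale matrix_mul_assoc mult.commute)
  qed
  have c: "cnj (l x $ 1 $ 1 * of_real (inverse (sqrt (h2 x)))) * (l x $ 1 $ 1 * of_real (inverse (sqrt (h2 x))))
      = of_real (inverse (h2 x))"
  proof -
    define r where "r = inverse (sqrt (h2 x))"
    have "r * r = inverse (h2 x)" using h by (simp add: r_def inverse_mult_distrib[symmetric])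
    then have rr: "complex_of_real r * of_real r = of_real (inverse (h2 x))" by (simp flip: of_real_mult)
    have "cnj (l x $ 1 $ 1 * of_real r) * (l x $ 1 $ 1 * of_real r)
      = (cnj (l x $ 1 $ 1) * l x $ 1 $ 1) * (of_real r * of_real r)" by (simp add: ac_simps)
    also have "\<dots> = of_real (inverse (h2 x))" using lx(1)[of x] x rr by simp
    finally show ?thesis unfolding r_def .
  qed
  have "adj (s x) ** (\<Psi> x ** adj (\<Psi> x)) ** s x = mscale (of_real (h2 x)) (mat 1)"
    using G_bundleD(3)[OF S s, of x] x by (simp add: Psi_adj mscale_mult_left mscale_mult_right)
  show "adj (mscale (l x $ 1 $ 1 * of_real (inverse (sqrt (h2 x)))) (adj (\<Psi> x) ** s x)) **
      mscale (l x $ 1 $ 1 * of_real (inverse (sqrt (h2 x)))) (adj (\<Psi> x) ** s x) = mat 1"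
  proof -
    have "adj (mscale k X) ** mscale k X = mscale (cnj k * k) (adj X ** X)" for k and X :: "complex^2^'n"
      by (simp add: adj_mscale mscale_mult_left mscale_mult_right mscale_mscale mult.commute)
    moreover have "of_real (inverse (h2 x)) * complex_of_real (h2 x) = 1" using h by simp
    ultimately show ?thesis
      using \<open>adj (s x) ** (\<Psi> x ** adj (\<Psi> x)) ** s x = _\<close>
      by (simp only: c adj_mult adj_adj matrix_mul_assoc mscale_mscale mscale_1)
  qed
  have "l x $ 1 $ 1 * of_real (inverse (sqrt (h2 x))) \<noteq> 0" using lx(2)[of x] x h by auto
  then show "range ((*v) (mscale (l x $ 1 $ 1 * of_real (inverse (sqrt (h2 x)))) (adj (\<Psi> x) ** s x))) = F x"
    using x F_eq[of x] range_mult_square[OF G_bundleD(3)[OF S s], of x "adj (\<Psi> x)"] by (simp add: range_mscale)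
qed auto

lemma FF_frame_ex:
  assumes "x \<in> W"
  obtains U f where "(U, f) \<in> FF" "x \<in> U"
proof -
  obtain V s where s: "(V, s) \<in> \<S>" "x \<in> V" using G_bundle_frame_ex[OF S] by blast
  obtain V' l where l: "(V', l) \<in> \<L>" "x \<in> V'" using G_bundle_frame_ex[OF L] by blast
  show ?thesis using that[OF FF_adapted[OF s(1) l(1)]] s l assms by auto
qed

text \<open>A frame \<open>e\<close> of the surrounding bundle mediates between the two frames, as
  \<open>e ** adj e\<close> is the identity.\<close>

lemma FF_transition:
  assumes "(U, f) \<in> FF" "(V, f') \<in> FF" "x \<in> U" "x \<in> V"
  shows "smooth_at M x (\<lambda>y. adj (f y) ** f' y)"
proof -
  obtain U' e where e: "(U', e) \<in> \<E>" "x \<in> U'" using G_bundle_frame_ex[OF E] by blast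
  have "smooth_at M x (\<lambda>y. adj (adj (e y) ** f y) ** (adj (e y) ** f' y))"
    by (rule smooth_at_bilinear[OF bounded_bilinear_matrix_mult smooth_at_linear[OF bounded_linear_adj
          FF_D(3)[OF assms(1,3) e]] FF_D(3)[OF assms(2,4) e]])
  moreover have "\<forall>\<^sub>F y in nhds x. adj (adj (e y) ** f y) ** (adj (e y) ** f' y) = adj (f y) ** f' y"
    using G_bundle_near[OF E e(1) e(2)]
  proof eventually_elim
    case (elim y)
    have "adj (adj (e y) ** f y) ** (adj (e y) ** f' y) = adj (f y) ** (e y ** adj (e y)) ** f' y"
      by (simp add: adj_mult matrix_mul_assoc)
    then show ?case using isometry_square[OF G_bundleD(3)[OF E e(1) elim]] by simp
  qed
  ultimately show ?thesis by (rule smooth_at_cong[rotated])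
qed

lemma FF_bundle: "G_bundle M W U_group FF"
proof (rule G_bundleI)
  show "\<exists>U e. (U, e) \<in> FF \<and> x \<in> U" if "x \<in> W" for x using FF_frame_ex[OF that] by metis
  fix U f V f' x assume f: "(U, f) \<in> FF" "(V, f') \<in> FF" "x \<in> U" "x \<in> V"
  have "range ((*v) (f x)) = range ((*v) (f' x))" using FF_D(5) f by simp
  then show "range ((*v) (f x)) = range ((*v) (f' x)) \<and> adj (f x) ** f' x \<in> U_group
      \<and> smooth_at M x (\<lambda>x. adj (f x) ** f' x)"
    using FF_transition[OF f] U_group_transition[OF FF_D(4)[OF f(1,3)] FF_D(4)[OF f(2,4)]] by simp
qed (use FF_D in auto)

lemma subbundle: "is_subbundle TYPE(2) M W (bundle_restrict W \<E>) F"
  unfolding is_subbundle_def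
proof
  fix x assume "x \<in> W"
  then obtain U f where f: "(U, f) \<in> FF" "x \<in> U" by (rule FF_frame_ex)
  have "inj ((*v) (f y))" if "y \<in> U" for y
    using isometry_vector[OF FF_D(4)[OF f(1) that]] by (metis injI)
  then show "\<exists>U (f :: 'm \<Rightarrow> complex^2^'n). open U \<and> x \<in> U \<and> U \<subseteq> W \<and>
        (\<forall>j. smooth_section M (bundle_restrict W \<E>) U (\<lambda>y. column j (f y))) \<and>
        (\<forall>y\<in>U. inj ((*v) (f y)) \<and> range ((*v) (f y)) = F y)"
    using f FF_D[OF f(1)] by (intro exI[of _ U] exI[of _ f]) (auto simp: FF_def unitary_frames_def)
qed

lemma FF_mult:
  assumes f: "(U, f) \<in> FF" and "open U'" "U' \<subseteq> U"
    and m: "\<And>x. x \<in> U' \<Longrightarrow> smooth_at M x m" "\<And>x. x \<in> U' \<Longrightarrow> adj (m x) ** m x = mat 1"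
  shows "(U', \<lambda>y. f y ** m y) \<in> FF"
  unfolding FF_iff
proof (intro conjI ballI)
  fix x assume x: "x \<in> U'"
  then have xU: "x \<in> U" using assms by auto
  show "adj (f x ** m x) ** (f x ** m x) = mat 1" by (rule isometry_mult[OF FF_D(4)[OF f xU] m(2)[OF x]])
  show "range ((*v) (f x ** m x)) = F x" unfolding range_mult_square[OF m(2)[OF x]] by (rule FF_D(5)[OF f xU])
  show "case p of (V, e) \<Rightarrow> x \<in> V \<longrightarrow> smooth_at M x (\<lambda>y. adj (e y) ** (f y ** m y))" if "p \<in> \<E>" for p
  proof -
    obtain V e where p: "p = (V, e)" by force
    have "smooth_at M x (\<lambda>y. (adj (e y) ** f y) ** m y)" if "x \<in> V"
      using \<open>p \<in> \<E>\<close> p that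
      by (intro smooth_at_bilinear[OF bounded_bilinear_matrix_mult FF_D(3)[OF f xU, of V e] m(1)] x) auto
    then show ?thesis by (simp add: p matrix_mul_assoc)
  qed
qed (use assms FF_D(2)[OF f] in auto)

text \<open>The adjoint of \<Psi> takes values in F, hence is fixed by the projection onto F; this
  is the adjoint of that identity.\<close>

lemma FF_Psi: "(U, f) \<in> FF \<Longrightarrow> x \<in> U \<Longrightarrow> \<Psi> x ** f x ** adj (f x) = \<Psi> x"
proof -
  assume f: "(U, f) \<in> FF" "x \<in> U"
  have "f x ** (adj (f x) ** adj (\<Psi> x)) = adj (\<Psi> x)"
    using FF_D[OF f(1)] f(2) F_eq[of x] by (intro isometry_range_matrix) auto
  from arg_cong[OF this, of adj] show ?thesis by (simp add: adj_mult matrix_mul_assoc)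
qed

lemma FF_proj: "(U, f) \<in> FF \<Longrightarrow> x \<in> U \<Longrightarrow> fibre_proj FF x = f x ** adj (f x)"
  by (rule fibre_eq(2)[OF FF_bundle])

lemma BF_frame:
  assumes f: "(U, f) \<in> FF" "x \<in> U"
  shows "cov_at BF f x" "form_at (conn_form BF f) x" "adj (conn_form BF f x v) = - conn_form BF f x v"
proof -
  obtain V e where e: "(V, e) \<in> \<E>" "x \<in> V" using G_bundle_frame_ex[OF E] by blast
  note Be = connectionD[OF E e(1) B]
  note nV = eventually_nhds_in_open[OF G_bundleD(1)[OF E e(1)]] and nU = eventually_nhds_in_open[OF FF_D(1)[OF f(1)]]
  have iso: "\<forall>\<^sub>F z in nhds y. adj (e z) ** e z = mat 1" if "y \<in> V" for y
    using nV[OF that] by eventually_elim (rule G_bundleD(3)[OF E e(1)])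
  have *: "cov_at BF f y" "conn_form BF f y v = adj (adj (e y) ** f y) **
       (mderiv M (\<lambda>y. adj (e y) ** f y) y v + conn_form B e y v ** (adj (e y) ** f y))" if "y \<in> U" "y \<in> V" for y v
    unfolding BF_def
    by (rule proj_conn_cov[OF Be(1) iso FF_D(3)[OF f(1) _ e(1)] FF_D(4)[OF f(1)] FF_proj[OF f(1)]]; fact that)+
  show "cov_at BF f x" using * f e by blast
  have g: "smooth_at M x (\<lambda>y. adj (e y) ** f y)" by (rule FF_D(3)[OF f e])
  show "form_at (conn_form BF f) x"
  proof (rule form_at_cong)
    show "\<forall>\<^sub>F y in nhds x. (\<lambda>v. adj (adj (e y) ** f y) **
       (mderiv M (\<lambda>y. adj (e y) ** f y) y v + conn_form B e y v ** (adj (e y) ** f y))) = conn_form BF f y"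
      using nV[OF e(2)] nU[OF f(2)] by eventually_elim (simp add: * fun_eq_iff)
    show "form_at (\<lambda>y v. adj (adj (e y) ** f y) **
       (mderiv M (\<lambda>y. adj (e y) ** f y) y v + conn_form B e y v ** (adj (e y) ** f y))) x"
      by (intro form_intros smooth_at_linear[OF bounded_linear_adj] g Be(2) e)
  qed
  have "adj (conn_form B e x v) = - conn_form B e x v" using Be(3)[OF e(2), of v] by (simp add: su_alg_def)
  moreover have "\<forall>\<^sub>F y in nhds x. adj (adj (e y) ** f y) ** (adj (e y) ** f y) = mat 1"
    using nV[OF e(2)] nU[OF f(2)]
  proof eventually_elim
    case (elim y)
    have "adj (adj (e y) ** f y) ** (adj (e y) ** f y) = adj (f y) ** (e y ** adj (e y)) ** f y"
      by (simp add: adj_mult matrix_mul_assoc)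
    then show ?case using isometry_square[OF G_bundleD(3)[OF E e(1) elim(1)]] FF_D(4)[OF f(1) elim(2)] by simp
  qed
  ultimately show "adj (conn_form BF f x v) = - conn_form BF f x v"
    unfolding *(2)[OF f(2) e(2)] by (intro skew_form_pullback g)
qed

text \<open>On the determinant the connection form is the trace. \<open>det_conn\<close> uses the
  frame chosen at \<open>x\<close>; the change to \<open>f\<close> multiplies the wedge by
  \<open>det m\<close>, and Jacobi's formula matches its derivative with the inhomogeneous term of
  the gauge transformation.\<close>

lemma det_conn_frame:
  assumes f: "(U, f) \<in> FF" "x \<in> U" and s: "\<forall>\<^sub>F y in nhds x. s y = wedge2 (f y)"
  shows "BK s x v = trace (conn_form BF f x v) *s wedge2 (f x)"
proof -
  have xW: "x \<in> W" using FF_D(2)[OF f(1)] f(2) by auto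
  define f' where "f' = frame_at FF x"
  obtain U' where f': "(U', f') \<in> FF" "x \<in> U'" using frame_atE[OF FF_bundle xW] unfolding f'_def .
  define m where "m y = adj (f' y) ** f y" for y
  have sm: "smooth_at M x m" unfolding m_def[abs_def] by (rule FF_transition[OF f'(1) f(1) f'(2) f(2)])
  have fm: "\<forall>\<^sub>F y in nhds x. f y = f' y ** m y"
    using eventually_nhds_in_open[OF FF_D(1)[OF f(1)] f(2)] eventually_nhds_in_open[OF FF_D(1)[OF f'(1)] f'(2)]
  proof eventually_elim
    case (elim y)
    show ?case unfolding m_def
      by (rule isometry_range_matrix[symmetric])
        (use FF_D(4,5)[OF f'(1) elim(2)] FF_D(5)[OF f(1) elim(1)] in simp_all)
  qed
  have mm: "adj (m x) ** m x = mat 1"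
    unfolding m_def using FF_D[OF f(1)] FF_D[OF f'(1)] f f' by (intro isometry_transition) auto
  have fx: "f x = f' x ** m x" using eventually_nhds_x_imp_x[OF fm] .
  note cov' = BF_frame(1)[OF f'] and iso' = FF_D(4)[OF f']
  define a' where "a' = conn_form BF f' x v"
  have a: "conn_form BF f x v = adj (m x) ** (mderiv M m x v + a' ** m x)"
    unfolding a'_def by (rule cov_at_change(2)[OF cov' iso' sm mm fm])
  have ta: "trace (conn_form BF f x v) = trace (mderiv M m x v ** adj (m x)) + trace a'"
  proof -
    have "trace (conn_form BF f x v) = trace ((mderiv M m x v + a' ** m x) ** adj (m x))"
      unfolding a by (rule trace_mul_sym)
    also have "(mderiv M m x v + a' ** m x) ** adj (m x) = mderiv M m x v ** adj (m x) + a' ** (m x ** adj (m x))"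
      by (simp add: matrix_mult_add_left matrix_mul_assoc)
    finally show ?thesis by (simp add: isometry_square[OF mm] trace_add)
  qed
  define c where "c y = hinner (wedge2 (f' y)) (s y)" for y
  have c: "\<forall>\<^sub>F y in nhds x. c y = det (m y)"
    using s by eventually_elim (simp add: c_def hinner_wedge2 m_def)
  \<comment> \<open>\<open>m x\<close> is unitary, so the conformal factor in Jacobi's formula is
    1.\<close>
  have dc: "mderiv M c x v = det (m x) * trace (mderiv M m x v ** adj (m x))"
    using mderiv_cong[OF c] mderiv_det_2[OF sm] det_derivative_conformal[of "m x" 1 "mderiv M m x v"] mm by simp
  have D: "BF (\<lambda>y. column j (f' y)) x v = column j (f' x ** a')" for j
    using dmat_frame[OF cov', of v] column_dmat[of j BF f' x v] by (simp add: a'_def)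
  \<comment> \<open>The Leibniz rule on the wedge: off-diagonal entries of \<open>a'\<close> only
    produce wedges of a vector with itself.\<close>
  have w: "wedge (column 1 (f' x ** a')) (column 2 (f' x)) + wedge (column 1 (f' x)) (column 2 (f' x ** a'))
      = trace a' *s wedge2 (f' x)"
    unfolding column_matrix_mult matrix_vector_2
    by (simp add: wedge_add_left wedge_add_right wedge_smult_left wedge_smult_right wedge_self trace_2 vector_sadd_rdistrib)
      (simp add: column_def)
  have "BK s x v = mderiv M c x v *s wedge2 (f' x) + c x *s (wedge (BF (\<lambda>y. column 1 (f' y)) x v) (column 2 (f' x))
         + wedge (column 1 (f' x)) (BF (\<lambda>y. column 2 (f' y)) x v))"
    by (simp add: BK_def det_conn_def Let_def f'_def c_def[abs_def])
  also have "\<dots> = (det (m x) * (trace (mderiv M m x v ** adj (m x)) + trace a')) *s wedge2 (f' x)"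
    unfolding D w dc eventually_nhds_x_imp_x[OF c] by (simp add: vec_eq_iff algebra_simps)
  finally show ?thesis unfolding ta fx wedge2_mult by (simp add: vec_eq_iff)
qed

end

lemma trace_mat_2 [simp]: "trace (mat 1 :: complex^2^2) = 2"
  by (simp add: trace_2 mat_def)

lemma trace_skew:
  assumes "adj a = - a"
  shows "cnj (trace a) = - trace a"
proof -
  have "cnj (trace a) = trace (- a)" by (simp only: trace_adj[symmetric] assms)
  then show ?thesis by (simp add: trace_def sum_negf)
qed

lemma column_nth: "column j A $ i = A $ i $ j"
  by (simp add: column_def)

lemma frame_at_mem:
  assumes "(U, e) \<in> \<E>" "x \<in> U"
  obtains V where "(V, frame_at \<E> x) \<in> \<E>" "x \<in> V"
proof -
  have ex: "\<exists>f. f \<in> \<E> \<and> x \<in> fst f" using assms by force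
  define p where "p = (SOME f. f \<in> \<E> \<and> x \<in> fst f)"
  have "p \<in> \<E> \<and> x \<in> fst p" unfolding p_def by (rule someI_ex[OF ex])
  then show ?thesis by (intro that[of "fst p"]) (simp_all add: frame_at_def p_def[symmetric])
qed

context solution_setup
begin

section \<open>The determinant line bundle\<close>

lemma KK_iff: "(U, k) \<in> KK \<longleftrightarrow> (\<exists>f. (U, f) \<in> FF \<and> k = (\<lambda>x. columnvector (wedge2 (f x))))"
  by (auto simp: KK_def det_bundle_def)

lemma wedge2_self: "(U, f) \<in> FF \<Longrightarrow> x \<in> U \<Longrightarrow> hinner (wedge2 (f x)) (wedge2 (f x)) = 1"
  using FF_D(4) by (simp add: hinner_wedge2)

lemma wedge2_change:
  assumes f: "(U, f) \<in> FF" "x \<in> U" and g: "adj g ** g = mat 1" "range ((*v) g) = F x"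
  shows "wedge2 g = det (adj (f x) ** g) *s wedge2 (f x)"
proof -
  have "g = f x ** (adj (f x) ** g)"
    by (rule isometry_range_matrix[symmetric]) (use FF_D[OF f(1)] f(2) g in auto)
  then show ?thesis by (metis wedge2_mult)
qed

lemma fibre_KK:
  assumes f: "(U, f) \<in> FF" "x \<in> U"
  shows "w \<in> fibre KK x \<longleftrightarrow> (\<exists>c. w = c *s wedge2 (f x))"
proof -
  have "(U, \<lambda>x. columnvector (wedge2 (f x))) \<in> KK" using f by (auto simp: KK_iff)
  then obtain V where V: "(V, frame_at KK x) \<in> KK" "x \<in> V" using f(2) by (rule frame_at_mem)
  then obtain f' where f': "(V, f') \<in> FF" "frame_at KK x = (\<lambda>x. columnvector (wedge2 (f' x)))" by (auto simp: KK_iff)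
  have 1: "wedge2 (f' x) = det (adj (f x) ** f' x) *s wedge2 (f x)"
    using wedge2_change[OF f] FF_D(4,5)[OF f'(1) V(2)] by blast
  have 2: "wedge2 (f x) = det (adj (f' x) ** f x) *s wedge2 (f' x)"
    using wedge2_change[OF f'(1) V(2)] FF_D(4,5)[OF f] by blast
  have "w \<in> fibre KK x \<longleftrightarrow> (\<exists>c. w = c *s wedge2 (f' x))"
    by (simp add: fibre_def f'(2) range_columnvector)
  also have "\<dots> \<longleftrightarrow> (\<exists>c. w = c *s wedge2 (f x))"
    using 1 2 by (metis vector_smult_assoc)
  finally show ?thesis .
qed

end

section \<open>An arbitrary square root of the determinant line\<close>

locale root_setup = solution_setup M \<E> B \<L> A \<Psi>
  for M :: "'m::t2_space spin_manifold"
    and \<E> :: "('m, 'n::finite, 'n) frames" and B :: "('m, 'n) conn"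
    and \<L> :: "('m, 1, 1) frames" and A :: "('m, 1) conn"
    and \<Psi> :: "'m \<Rightarrow> complex^'n^2" +
  fixes \<N> :: "('m, 1, 1) frames" and \<iota> :: "'m \<Rightarrow> complex^('n \<times> 'n)"
  assumes root: "square_root M W KK \<N> \<iota>"
begin

lemma N: "G_bundle M W U_group \<N>"
  using root by (simp add: square_root_def)

lemma iota_norm: "x \<in> W \<Longrightarrow> hinner (\<iota> x) (\<iota> x) = 1"
  using root by (simp add: square_root_def hinner_self)

lemma iota_scalar:
  assumes f: "(U, f) \<in> FF" "x \<in> U"
  obtains d where "\<iota> x = d *s wedge2 (f x)" "hinner (wedge2 (f x)) (\<iota> x) = d" "cnj d * d = 1"
proof -
  have x: "x \<in> W" using FF_D(2)[OF f(1)] f(2) by auto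
  then have "\<iota> x \<in> fibre KK x" using root by (simp add: square_root_def)
  then obtain d where d: "\<iota> x = d *s wedge2 (f x)" using fibre_KK[OF f] by blast
  moreover have "hinner (wedge2 (f x)) (\<iota> x) = d" by (simp add: d hinner_smult_right wedge2_self[OF f])
  moreover have "cnj d * d = 1" using iota_norm[OF x] by (simp add: d hinner_smult_right hinner_smult_left wedge2_self[OF f] mult.commute)
  ultimately show ?thesis using that by blast
qed

text \<open>\<open>\<iota>\<close> alone need not be continuous; only together with the square of a
  local frame does it become a smooth section of K.\<close>

lemma smooth_iota:
  assumes n: "(U, n) \<in> \<N>" "x \<in> U" and f: "(V, f) \<in> FF" "x \<in> V"
  shows "smooth_at M x (\<lambda>y. hinner (wedge2 (f y)) ((n y $ 1 $ 1)\<^sup>2 *s \<iota> y))"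
proof -
  have k: "(V, \<lambda>x. columnvector (wedge2 (f x))) \<in> KK" using f by (auto simp: KK_iff)
  have "smooth_section M KK U (\<lambda>x. (n x $ 1 $ 1)\<^sup>2 *s \<iota> x)"
    using root n(1) by (auto simp: square_root_def)
  then have "\<forall>(V, e)\<in>KK. (\<forall>x\<in>U \<inter> V. (n x $ 1 $ 1)\<^sup>2 *s \<iota> x \<in> range ((*v) (e x))) \<and>
                 smooth_map M (U \<inter> V) (\<lambda>x. adj (e x) *v ((n x $ 1 $ 1)\<^sup>2 *s \<iota> x))"
    by (simp add: smooth_section_def)
  from conjunct2[OF bspec[OF this k, unfolded prod.case]]
  have "smooth_at M x (\<lambda>x. (\<chi> i. hinner (wedge2 (f x)) ((n x $ 1 $ 1)\<^sup>2 *s \<iota> x)) :: complex^1)"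
    using n(2) f(2) G_bundleD(1)[OF N n(1)] FF_D(1)[OF f(1)]
    by (auto simp: adj_columnvector smooth_at_def intro!: exI[of _ "U \<inter> V"])
  then have "smooth_at M x (\<lambda>x. ((\<chi> i. hinner (wedge2 (f x)) ((n x $ 1 $ 1)\<^sup>2 *s \<iota> x)) :: complex^1) $ 1)"
    by (rule smooth_at_nth)
  then show ?thesis by simp
qed

text \<open>Under the isomorphism from the square of \<open>\<N>\<close> to K,
  \<open>n \<otimes> n\<close> corresponds to the determinant of the frame \<open>f\<close>. Then
  \<open>cnj n\<close> times \<open>f\<close> is a special unitary frame of the twisted bundle, and
  the connection form of \<open>n\<close> is half the trace of that of \<open>f\<close>.\<close>

definition adapted :: "'m set \<Rightarrow> ('m \<Rightarrow> complex^1^1) \<Rightarrow> ('m \<Rightarrow> complex^2^'n) \<Rightarrow> bool" where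
  "adapted V n f \<longleftrightarrow> (V, f) \<in> FF \<and> (\<forall>y\<in>V. wedge2 (f y) = (n y $ 1 $ 1)\<^sup>2 *s \<iota> y)"

lemma adapted_ex:
  assumes n: "(U, n) \<in> \<N>" "x \<in> U"
  obtains V f where "adapted V n f" "x \<in> V" "V \<subseteq> U"
proof -
  have "x \<in> W" using G_bundleD(2)[OF N n(1)] n(2) by auto
  then obtain V0 f where f: "(V0, f) \<in> FF" "x \<in> V0" by (rule FF_frame_ex)
  define d where "d y = hinner (wedge2 (f y)) ((n y $ 1 $ 1)\<^sup>2 *s \<iota> y)" for y
  \<comment> \<open>Rescaling only the first vector by \<open>d\<close> multiplies the determinant
    of the frame by \<open>d\<close>; no square root of \<open>d\<close> has to be chosen.\<close>
  define m :: "'m \<Rightarrow> complex^2^2" where "m y = (\<chi> i j. if i = j then (if i = 1 then d y else 1) else 0)" for y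
  have d: "(n y $ 1 $ 1)\<^sup>2 *s \<iota> y = d y *s wedge2 (f y)" "cnj (d y) * d y = 1" if y: "y \<in> U" "y \<in> V0" for y
  proof -
    obtain c where c: "\<iota> y = c *s wedge2 (f y)" "hinner (wedge2 (f y)) (\<iota> y) = c" "cnj c * c = 1"
      using iota_scalar[OF f(1) y(2)] .
    have dy: "d y = (n y $ 1 $ 1)\<^sup>2 * c" by (simp only: d_def hinner_smult_right c(2))
    show "(n y $ 1 $ 1)\<^sup>2 *s \<iota> y = d y *s wedge2 (f y)" by (simp add: dy c(1) vector_smult_assoc)
    have "cnj (d y) * d y = (cnj (n y $ 1 $ 1) * n y $ 1 $ 1)\<^sup>2 * (cnj c * c)"
      by (simp add: dy power2_eq_square ac_simps)
    then show "cnj (d y) * d y = 1" using frame_1_unit(1)[OF G_bundleD(3)[OF N n(1) y(1)]] c(3) by simp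
  qed
  have "smooth_at M y m" if y: "y \<in> U" "y \<in> V0" for y
  proof -
    have "smooth_at M y (\<lambda>y. if i = j then (if i = 1 then d y else 1) else 0)" for i j :: 2
      using smooth_iota[OF n(1) y(1) f(1) y(2)] by (cases "i = j"; cases "i = 1") (simp_all add: d_def smooth_at_const)
    then show ?thesis unfolding m_def by (intro smooth_at_vec)
  qed
  moreover have "adj (m y) ** m y = mat 1" if "y \<in> U" "y \<in> V0" for y
    using d(2)[OF that] by (simp add: matrix_2_eq_iff matrix_mult_2 adj_nth m_def mat_def)
  moreover have "open (U \<inter> V0)" using G_bundleD(1)[OF N n(1)] FF_D(1)[OF f(1)] by auto
  ultimately have "(U \<inter> V0, \<lambda>y. f y ** m y) \<in> FF" by (intro FF_mult[OF f(1)]) auto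
  moreover have "det (m y) = d y" for y by (simp add: det_2 m_def)
  ultimately have "adapted (U \<inter> V0) n (\<lambda>y. f y ** m y)"
    using d(1) by (auto simp: adapted_def wedge2_mult)
  then show ?thesis using that[of "U \<inter> V0"] n f by auto
qed

section \<open>The connections on the square root and on its dual\<close>

definition SN where "SN = sqrt_conn M \<N> \<iota> BK"

text \<open>The frame \<open>n'\<close> chosen at \<open>x\<close> differs from \<open>n\<close> by
  a unit function \<open>u\<close>, and \<open>f\<close> multiplied by \<open>cnj u\<close> is
  adapted to \<open>n'\<close>. The inhomogeneous term in the trace over F is twice that of the
  line, so after halving the derivatives of \<open>u\<close> cancel.\<close>

lemma sqrt_conn_frame:
  assumes n: "(U, n) \<in> \<N>" "x \<in> U" and f: "adapted V n f" "x \<in> V"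
  shows "cov_at SN n x" "conn_form SN n x v = mscale (trace (conn_form BF f x v) / 2) (mat 1)"
proof -
  have xW: "x \<in> W" using G_bundleD(2)[OF N n(1)] n(2) by auto
  define n' where "n' = frame_at \<N> x"
  obtain U' where n': "(U', n') \<in> \<N>" "x \<in> U'" using frame_atE[OF N xW] unfolding n'_def .
  define u where "u y = cnj (n' y $ 1 $ 1) * n y $ 1 $ 1" for y
  have u_eq: "u y = (adj (n' y) ** n y) $ 1 $ 1" for y by (simp add: u_def matrix_1_mult adj_nth)
  have su: "smooth_at M y u" if "y \<in> U" "y \<in> U'" for y
    unfolding u_eq[abs_def] by (intro smooth_at_nth G_bundle_transition(3)[OF N n'(1) n(1)] that)
  note unit = frame_1_unit[OF G_bundleD(3)[OF N n(1)]] and unit' = frame_1_unit[OF G_bundleD(3)[OF N n'(1)]]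
  have uu: "cnj (u y) * u y = 1" "cnj (u y) * n y $ 1 $ 1 = n' y $ 1 $ 1" if "y \<in> U" "y \<in> U'" for y
  proof -
    have "cnj (u y) * u y = (cnj (n y $ 1 $ 1) * n y $ 1 $ 1) * (cnj (n' y $ 1 $ 1) * n' y $ 1 $ 1)"
      by (simp add: u_def ac_simps)
    then show "cnj (u y) * u y = 1" using unit(1)[OF that(1)] unit'(1)[OF that(2)] by simp
    have "cnj (u y) * n y $ 1 $ 1 = n' y $ 1 $ 1 * (cnj (n y $ 1 $ 1) * n y $ 1 $ 1)" by (simp add: u_def ac_simps)
    then show "cnj (u y) * n y $ 1 $ 1 = n' y $ 1 $ 1" using unit(1)[OF that(1)] by simp
  qed
  note su' = su[OF n(2) n'(2)] and uu' = uu[OF n(2) n'(2)]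
  have fF: "(V, f) \<in> FF" and fw: "\<And>y. y \<in> V \<Longrightarrow> wedge2 (f y) = (n y $ 1 $ 1)\<^sup>2 *s \<iota> y"
    using f(1) by (auto simp: adapted_def)
  \<comment> \<open>A scalar change of the whole frame has determinant
    \<open>(cnj u)\<^sup>2\<close>, which turns the square of \<open>n\<close> into that of
    \<open>n'\<close>.\<close>
  define m :: "'m \<Rightarrow> complex^2^2" where "m y = mscale (cnj (u y)) (mat 1)" for y
  have sm: "smooth_at M y m" if "y \<in> U" "y \<in> U'" for y
    unfolding m_def[abs_def] by (intro smooth_intros su that)
  have mm: "adj (m y) ** m y = mat 1" if "y \<in> U" "y \<in> U'" for y
    using uu(1)[OF that] by (simp add: m_def adj_mscale mscale_mult_left mscale_mult_right mscale_mscale)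
  define f' where "f' y = f y ** m y" for y
  let ?V = "V \<inter> U \<inter> U'"
  have "open ?V" using FF_D(1)[OF fF] G_bundleD(1)[OF N n(1)] G_bundleD(1)[OF N n'(1)] by auto
  then have "(?V, f') \<in> FF" unfolding f'_def[abs_def] by (rule FF_mult[OF fF]) (use sm mm in auto)
  moreover have "x \<in> ?V" using n(2) n'(2) f(2) by simp
  ultimately have f': "(?V, f') \<in> FF" "x \<in> ?V" .
  define k where "k y = (n' y $ 1 $ 1)\<^sup>2 *s \<iota> y" for y
  have k: "k y = wedge2 (f' y)" if "y \<in> ?V" for y
  proof -
    have "det (m y) = (cnj (u y))\<^sup>2" by (simp add: m_def det_mscale_2)
    then have "wedge2 (f' y) = ((cnj (u y) * n y $ 1 $ 1)\<^sup>2) *s \<iota> y"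
      using fw[of y] that by (simp add: f'_def wedge2_mult vector_smult_assoc power_mult_distrib)
    then show ?thesis using uu(2)[of y] that by (simp add: k_def)
  qed
  define a where "a v = conn_form BF f x v" for v
  \<comment> \<open>The derivative of the constant \<open>cnj u * u\<close>: the derivative of
    \<open>u\<close> is \<open>u\<close> times an imaginary number.\<close>
  have du: "cnj (mderiv M u x v) * u x + cnj (u x) * mderiv M u x v = 0" for v
  proof -
    have "mderiv M (\<lambda>y. cnj (u y) * u y) x v = mderiv M (\<lambda>y. 1) x v"
      using eventually_nhds_in_open[OF FF_D(1)[OF f'(1)] f'(2)]
      by (intro fun_cong[OF mderiv_cong], elim eventually_mono) (simp add: uu)
    moreover have "mderiv M (\<lambda>y. cnj (u y) * u y) x v = cnj (u x) * mderiv M u x v + cnj (mderiv M u x v) * u x"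
      by (subst mderiv_mult) (auto intro!: smooth_intros su' simp: mderiv_cnj[OF su'])
    ultimately show ?thesis by (simp add: mderiv_const add.commute)
  qed
  have dm: "mderiv M m x v = mscale (cnj (mderiv M u x v)) (mat 1)" for v
    unfolding m_def[abs_def]
    by (subst mderiv_mscale) (auto intro!: smooth_intros su' simp: mderiv_const mderiv_cnj[OF su'])
  have a': "trace (conn_form BF f' x v) = 2 * u x * cnj (mderiv M u x v) + trace (a v)" for v
  proof -
    have "conn_form BF f' x v = adj (m x) ** (mderiv M m x v + a v ** m x)"
      unfolding a_def
      by (rule cov_at_change(2)[OF BF_frame(1)[OF fF f(2)] FF_D(4)[OF fF f(2)] sm[OF n(2) n'(2)] mm[OF n(2) n'(2)]])
        (simp add: f'_def)
    also have "\<dots> = mscale (u x * cnj (mderiv M u x v)) (mat 1) + mscale (u x * cnj (u x)) (a v)"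
      by (simp add: dm m_def adj_mscale mscale_mult_left mscale_mult_right mscale_mscale mscale_add_right)
    finally have eq: "conn_form BF f' x v = mscale (u x * cnj (mderiv M u x v)) (mat 1) + mscale (u x * cnj (u x)) (a v)" .
    show ?thesis unfolding eq using uu'(1) by (simp add: trace_add trace_mscale mult.commute)
  qed
  have om: "hinner (k x) (BK k x v) = 2 * u x * cnj (mderiv M u x v) + trace (a v)" for v
  proof -
    have "BK k x v = trace (conn_form BF f' x v) *s wedge2 (f' x)"
      by (rule det_conn_frame[OF f'])
        (use eventually_nhds_in_open[OF FF_D(1)[OF f'(1)] f'(2)] k in \<open>auto elim!: eventually_mono\<close>)
    then show ?thesis by (simp only: k[OF f'(2)] wedge2_self[OF f'] a' hinner_smult_right mult_1_right)
  qed
  have main: "SN t x v = n x *v (mderiv M c x v + mscale (trace (a v) / 2) (mat 1) *v c x)"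
    if c: "smooth_at M x c" and t: "\<forall>\<^sub>F y in nhds x. t y = n y *v c y" for c t v
  proof -
    let ?c = "\<lambda>y. hinner (column 1 (n' y)) (t y)"
    have ev: "\<forall>\<^sub>F y in nhds x. ?c y = u y * c y $ 1"
      using t by eventually_elim (simp add: hinner_def sum_1 column_def matrix_1_vector u_def)
    have "mderiv M ?c x v = mderiv M (\<lambda>y. u y * c y $ 1) x v" by (rule fun_cong[OF mderiv_cong[OF ev]])
    also have "\<dots> = u x * mderiv M c x v $ 1 + mderiv M u x v * c x $ 1"
      by (subst mderiv_mult) (auto intro!: smooth_intros su' c simp: mderiv_nth[OF c])
    finally have dc: "mderiv M ?c x v = u x * mderiv M c x v $ 1 + mderiv M u x v * c x $ 1" .
    have "SN t x v = (mderiv M ?c x v + hinner (k x) (BK k x v) / 2 * ?c x) *s column 1 (n' x)"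
      by (simp add: SN_def sqrt_conn_def Let_def n'_def k_def[abs_def] column_nth)
    also have "mderiv M ?c x v + hinner (k x) (BK k x v) / 2 * ?c x = u x * (mderiv M c x v $ 1 + trace (a v) / 2 * c x $ 1)"
    proof -
      have "u x * u x * cnj (mderiv M u x v) + mderiv M u x v = 0"
      proof -
        have "u x * (cnj (mderiv M u x v) * u x + cnj (u x) * mderiv M u x v) = 0" using du by simp
        then have "u x * u x * cnj (mderiv M u x v) + (cnj (u x) * u x) * mderiv M u x v = 0" by (simp add: algebra_simps)
        then show ?thesis using uu'(1) by simp
      qed
      then have e: "mderiv M u x v = - (u x * u x * cnj (mderiv M u x v))" by (simp add: eq_neg_iff_add_eq_0 add.commute)
      show ?thesis unfolding dc om eventually_nhds_x_imp_x[OF ev] by (subst e) (simp add: algebra_simps)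
    qed
    also have "(u x * (mderiv M c x v $ 1 + trace (a v) / 2 * c x $ 1)) *s column 1 (n' x)
        = (n' x $ 1 $ 1 * u x * (mderiv M c x v $ 1 + trace (a v) / 2 * c x $ 1)) *s axis 1 1"
      by (simp add: vec_eq_iff forall_1 column_def)
    also have "n' x $ 1 $ 1 * u x = n x $ 1 $ 1"
    proof -
      have "n' x $ 1 $ 1 * u x = (cnj (n' x $ 1 $ 1) * n' x $ 1 $ 1) * n x $ 1 $ 1" by (simp add: u_def ac_simps)
      then show ?thesis using unit'(1)[OF n'(2)] by simp
    qed
    finally show ?thesis by (simp add: vec_eq_iff forall_1 matrix_1_vector mscale_nth algebra_simps)
  qed
  note res = cov_atI[of n x SN "\<lambda>v. mscale (trace (a v) / 2) (mat 1)", OF G_bundleD(3)[OF N n] main]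
  show "cov_at SN n x" by (rule res(1))
  show "conn_form SN n x v = mscale (trace (conn_form BF f x v) / 2) (mat 1)" using res(2) by (simp add: a_def)
qed

definition N' where "N' = dual_line \<N>"
definition BN' where "BN' = dual_conn SN"

lemma N': "G_bundle M W U_group N'"
  unfolding N'_def by (rule G_bundle_dual[OF N])

text \<open>Dualising conjugates the connection form, and the trace is imaginary since the projected
  connection is unitary, so only the sign changes.\<close>

lemma dual_frame:
  assumes n: "(U, n) \<in> \<N>" "x \<in> U" and f: "adapted V n f" "x \<in> V"
  shows "cov_at BN' (conj_frame n) x" "conn_form BN' (conj_frame n) x v $ 1 $ 1 = - trace (conn_form BF f x v) / 2"
proof -
  note d = dual_conn_cov[OF sqrt_conn_frame(1)[OF assms] G_bundleD(3)[OF N n], folded conj_frame_def, folded BN'_def]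
  show "cov_at BN' (conj_frame n) x" by (rule d(1))
  have "(V, f) \<in> FF" using f(1) by (simp add: adapted_def)
  then have "cnj (trace (conn_form BF f x v)) = - trace (conn_form BF f x v)"
    by (rule trace_skew[OF BF_frame(3)[OF _ f(2)]])
  then show "conn_form BN' (conj_frame n) x v $ 1 $ 1 = - trace (conn_form BF f x v) / 2"
    by (simp add: d(2) sqrt_conn_frame(2)[OF assms] adj_nth mscale_nth)
qed

lemma tensor_dual_frame:
  fixes e :: "'m \<Rightarrow> complex^'r^'k"
  assumes n: "(U, n) \<in> \<N>" "x \<in> U" and f: "adapted V n f" "x \<in> V"
    and D: "cov_at D e x" and e: "adj (e x) ** e x = mat 1"
  shows "cov_at (tensor_conn N' D BN') (\<lambda>y. mscale (cnj (n y $ 1 $ 1)) (e y)) x"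
    "conn_form (tensor_conn N' D BN') (\<lambda>y. mscale (cnj (n y $ 1 $ 1)) (e y)) x v
      = conn_form D e x v - mscale (trace (conn_form BF f x v) / 2) (mat 1)"
proof -
  have mem: "(U, conj_frame n) \<in> N'" unfolding N'_def by (rule dual_lineI[OF n(1)])
  note t = tensor_conn_cov[OF N' mem n(2) dual_frame(1)[OF n f] D e, unfolded conj_frame_nth]
  show "cov_at (tensor_conn N' D BN') (\<lambda>y. mscale (cnj (n y $ 1 $ 1)) (e y)) x" by (rule t(1))
  show "conn_form (tensor_conn N' D BN') (\<lambda>y. mscale (cnj (n y $ 1 $ 1)) (e y)) x v
      = conn_form D e x v - mscale (trace (conn_form BF f x v) / 2) (mat 1)"
    unfolding t(2) dual_frame(2)[OF n f] by (simp add: vec_eq_iff mscale_nth)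
qed

subsection \<open>The bundle with structure group \<open>SU(2)\<close>\<close>

definition RR where "RR = ring_bundle M W FF \<N> \<iota>"
text \<open>The twist of F by the dual of \<open>\<N>\<close>, with structure group U(2);
  \<open>RR\<close> reduces it to SU(2) by fixing the determinant.\<close>

definition HH where "HH = tensor_line FF N'"

lemma HH: "G_bundle M W U_group HH"
  unfolding HH_def by (rule G_bundle_tensor[OF FF_bundle N'])

lemma HH_mem: "(V, f) \<in> FF \<Longrightarrow> (U, n) \<in> \<N> \<Longrightarrow> (V \<inter> U, \<lambda>x. mscale (cnj (n x $ 1 $ 1)) (f x)) \<in> HH"
  using tensor_lineI[OF _ dual_lineI] by (simp add: HH_def N'_def)

lemma fibre_HH: "x \<in> W \<Longrightarrow> fibre HH x = F x"
proof -
  assume x: "x \<in> W"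
  obtain V f where f: "(V, f) \<in> FF" "x \<in> V" by (rule FF_frame_ex[OF x])
  obtain U n where n: "(U, n) \<in> \<N>" "x \<in> U" by (rule G_bundle_frame_ex[OF N x])
  have "cnj (n x $ 1 $ 1) \<noteq> 0" using frame_1_unit(2)[OF G_bundleD(3)[OF N n]] by simp
  then show ?thesis
    using fibre_eq(1)[OF HH HH_mem[OF f(1) n(1)]] f n FF_D(5)[OF f] by (simp add: range_mscale)
qed

lemma RR_iff_HH: "(U, h) \<in> RR \<longleftrightarrow> (U, h) \<in> unitary_frames M W HH (fibre HH) \<and> (\<forall>x\<in>U. wedge2 (h x) = \<iota> x)"
  by (simp add: RR_def ring_bundle_def Let_def HH_def N'_def)

lemma RR_D:
  assumes h: "(U, h) \<in> RR"
  shows "open U" "U \<subseteq> W" "\<And>x. x \<in> U \<Longrightarrow> adj (h x) ** h x = mat 1" "\<And>x. x \<in> U \<Longrightarrow> range ((*v) (h x)) = F x"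
    "\<And>x. x \<in> U \<Longrightarrow> wedge2 (h x) = \<iota> x"
    "\<And>x T g. x \<in> U \<Longrightarrow> (T, g) \<in> HH \<Longrightarrow> x \<in> T \<Longrightarrow> smooth_at M x (\<lambda>y. adj (g y) ** h y)"
proof -
  have h': "(U, h) \<in> unitary_frames M W HH (fibre HH)" "\<forall>x\<in>U. wedge2 (h x) = \<iota> x" using h by (auto simp: RR_iff_HH)
  note i = iffD1[OF unitary_frames_iff[of HH U h W "fibre HH", OF G_bundleD(1)[OF HH]], OF _ h'(1)]
  have *: "open U \<and> U \<subseteq> W \<and>
    (\<forall>x\<in>U. \<forall>(V, e)\<in>HH. x \<in> V \<longrightarrow> range ((*v) (h x)) \<subseteq> range ((*v) (e x)) \<and> smooth_at M x (\<lambda>y. adj (e y) ** h y)) \<and>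
    (\<forall>x\<in>U. adj (h x) ** h x = mat 1 \<and> range ((*v) (h x)) = fibre HH x)"
    by (rule i)
  show "open U" "U \<subseteq> W" using * by blast+
  show "\<And>x. x \<in> U \<Longrightarrow> adj (h x) ** h x = mat 1" using * by blast
  show "\<And>x. x \<in> U \<Longrightarrow> range ((*v) (h x)) = F x" using * fibre_HH by auto
  show "\<And>x. x \<in> U \<Longrightarrow> wedge2 (h x) = \<iota> x" using h'(2) by blast
  show "\<And>x T g. x \<in> U \<Longrightarrow> (T, g) \<in> HH \<Longrightarrow> x \<in> T \<Longrightarrow> smooth_at M x (\<lambda>y. adj (g y) ** h y)" using * by auto
qed

text \<open>Multiplication by \<open>n\<close> undoes the twist and multiplies the determinant by
  the square of \<open>n\<close>. Statements about the twisted bundle are transferred from F in this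
  way.\<close>

lemma RR_adapted:
  assumes h: "(U, h) \<in> RR" and n: "(V, n) \<in> \<N>"
  shows "adapted (U \<inter> V) n (\<lambda>y. mscale (n y $ 1 $ 1) (h y))"
proof -
  note unit = frame_1_unit[OF G_bundleD(3)[OF N n]]
  have "(U \<inter> V, \<lambda>y. mscale (n y $ 1 $ 1) (h y)) \<in> FF"
    unfolding FF_iff
  proof (intro conjI ballI)
    show "open (U \<inter> V)" "U \<inter> V \<subseteq> W" using RR_D(1,2)[OF h] G_bundleD(1)[OF N n] by auto
    fix x assume x: "x \<in> U \<inter> V"
    have xW: "x \<in> W" using RR_D(2)[OF h] x by auto
    show "adj (mscale (n x $ 1 $ 1) (h x)) ** mscale (n x $ 1 $ 1) (h x) = mat 1"
      using x by (intro isometry_mscale unit(1) RR_D(3)[OF h]) auto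
    show "range ((*v) (mscale (n x $ 1 $ 1) (h x))) = F x" using x unit(2)[of x] RR_D(4)[OF h, of x] by (simp add: range_mscale)
    show "case p of (V, e) \<Rightarrow> x \<in> V \<longrightarrow> smooth_at M x (\<lambda>y. adj (e y) ** mscale (n y $ 1 $ 1) (h y))" if "p \<in> \<E>" for p
    proof -
      obtain T e where p: "p = (T, e)" by force
      have "smooth_at M x (\<lambda>y. adj (e y) ** mscale (n y $ 1 $ 1) (h y))" if T: "x \<in> T"
      proof -
        obtain V' f where f: "(V', f) \<in> FF" "x \<in> V'" by (rule FF_frame_ex[OF xW])
        have s1: "smooth_at M x (\<lambda>y. adj (e y) ** f y)" using FF_D(3)[OF f] \<open>p \<in> \<E>\<close> p T by blast
        have s2: "smooth_at M x (\<lambda>y. adj (mscale (cnj (n y $ 1 $ 1)) (f y)) ** h y)"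
          by (rule RR_D(6)[OF h _ HH_mem[OF f(1) n]]) (use x f in auto)
        have "\<forall>\<^sub>F y in nhds x. (adj (e y) ** f y) ** (adj (mscale (cnj (n y $ 1 $ 1)) (f y)) ** h y)
            = adj (e y) ** mscale (n y $ 1 $ 1) (h y)"
          using eventually_nhds_in_open[OF FF_D(1)[OF f(1)] f(2)] eventually_nhds_in_open[OF RR_D(1)[OF h], of x, OF IntD1[OF x]]
        proof eventually_elim
          case (elim y)
          have "f y ** (adj (f y) ** h y) = h y"
            by (rule isometry_range_matrix) (use FF_D[OF f(1)] RR_D[OF h] elim in auto)
          then show ?case
            by (simp add: adj_mscale mscale_mult_left mscale_mult_right) (metis matrix_mul_assoc)
        qed
        then show ?thesis by (rule smooth_at_cong[OF _ smooth_at_bilinear[OF bounded_bilinear_matrix_mult s1 s2]])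
      qed
      then show ?thesis by (simp add: p)
    qed
  qed
  then show ?thesis using RR_D(5)[OF h] by (auto simp: adapted_def wedge2_mscale)
qed

text \<open>The inverse passage: the two factors \<open>cnj n\<close> cancel the square of
  \<open>n\<close> in the determinant.\<close>

lemma RR_I:
  assumes n: "(U, n) \<in> \<N>" and f: "adapted V n f" and VU: "V \<subseteq> U"
  shows "(V, \<lambda>y. mscale (cnj (n y $ 1 $ 1)) (f y)) \<in> RR"
proof -
  have fF: "(V, f) \<in> FF" and fw: "\<And>y. y \<in> V \<Longrightarrow> wedge2 (f y) = (n y $ 1 $ 1)\<^sup>2 *s \<iota> y"
    using f by (auto simp: adapted_def)
  note unit = frame_1_unit[OF G_bundleD(3)[OF N n]]
  let ?h = "\<lambda>y. mscale (cnj (n y $ 1 $ 1)) (f y)"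
  have rng: "range ((*v) (?h x)) = F x" if "x \<in> V" for x
  proof -
    have "cnj (n x $ 1 $ 1) \<noteq> 0" using unit(2)[of x] that VU by auto
    then show ?thesis using FF_D(5)[OF fF that] by (simp add: range_mscale)
  qed
  have iso: "adj (?h x) ** ?h x = mat 1" if "x \<in> V" for x
    using unit(1)[of x] that VU by (intro isometry_mscale FF_D(4)[OF fF that]) (auto simp: mult.commute)
  have "(V, ?h) \<in> unitary_frames M W HH (fibre HH)"
  proof (rule iffD2[OF unitary_frames_iff[of HH V ?h W "fibre HH", OF G_bundleD(1)[OF HH]]], assumption, intro conjI ballI)
    show "open V" "V \<subseteq> W" by (rule FF_D(1,2)[OF fF])+
    fix x assume x: "x \<in> V"
    have xW: "x \<in> W" using FF_D(2)[OF fF] x by auto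
    show "adj (?h x) ** ?h x = mat 1" by (rule iso[OF x])
    show "range ((*v) (?h x)) = fibre HH x" using rng[OF x] fibre_HH[OF xW] by simp
    show "case p of (T, g) \<Rightarrow> x \<in> T \<longrightarrow> range ((*v) (?h x)) \<subseteq> range ((*v) (g x)) \<and> smooth_at M x (\<lambda>y. adj (g y) ** ?h y)"
      if p: "p \<in> HH" for p
    proof -
      obtain T g where g: "p = (T, g)" by force
      have "range ((*v) (?h x)) \<subseteq> range ((*v) (g x)) \<and> smooth_at M x (\<lambda>y. adj (g y) ** ?h y)" if T: "x \<in> T"
      proof
        have gH: "(T, g) \<in> HH" using p g by simp
        show "range ((*v) (?h x)) \<subseteq> range ((*v) (g x))"
          using rng[OF x] fibre_HH[OF xW] fibre_eq(1)[OF HH gH T] by simp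
        have "(V \<inter> U, ?h) \<in> HH" by (rule HH_mem[OF fF n])
        from G_bundle_transition(3)[OF HH gH this T] show "smooth_at M x (\<lambda>y. adj (g y) ** ?h y)" using x VU by auto
      qed
      then show ?thesis by (simp add: g)
    qed
  qed
  moreover have "wedge2 (?h x) = \<iota> x" if x: "x \<in> V" for x
  proof -
    have "wedge2 (?h x) = ((cnj (n x $ 1 $ 1) * n x $ 1 $ 1)\<^sup>2) *s \<iota> x"
      by (simp add: wedge2_mscale fw[OF x] vector_smult_assoc power_mult_distrib)
    then show ?thesis using unit(1)[of x] x VU by auto
  qed
  ultimately show ?thesis by (simp add: RR_iff_HH)
qed

lemma RR_ex:
  assumes "x \<in> W"
  obtains U h where "(U, h) \<in> RR" "x \<in> U"
proof -
  obtain U n where n: "(U, n) \<in> \<N>" "x \<in> U" by (rule G_bundle_frame_ex[OF N assms])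
  obtain V f where f: "adapted V n f" "x \<in> V" "V \<subseteq> U" by (rule adapted_ex[OF n])
  show ?thesis using that[OF RR_I[OF n(1) f(1,3)] f(2)] .
qed

lemma RR_bundle: "G_bundle M W SU_group RR"
proof (rule G_bundleI)
  show "\<exists>U e. (U, e) \<in> RR \<and> x \<in> U" if "x \<in> W" for x using RR_ex[OF that] by metis
  fix U h U' h' x assume h: "(U, h) \<in> RR" "(U', h') \<in> RR" "x \<in> U" "x \<in> U'"
  have x: "x \<in> W" using RR_D(2)[OF h(1)] h(3) by auto
  note D = RR_D[OF h(1)] and D' = RR_D[OF h(2)]
  have rng: "range ((*v) (h' x)) = range ((*v) (h x))" using D(4)[OF h(3)] D'(4)[OF h(4)] by simp
  note tr = isometry_transition[OF D(3)[OF h(3)] D'(3)[OF h(4)] rng]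
  \<comment> \<open>Both frames have the same wedge \<open>\<iota> x\<close>, which is a unit
    vector, so the transition matrix must have determinant one.\<close>
  have "\<iota> x = det (adj (h x) ** h' x) *s \<iota> x"
    using wedge2_mult[of "h x" "adj (h x) ** h' x"] tr(2) D(5)[OF h(3)] D'(5)[OF h(4)] by metis
  then have "hinner (\<iota> x) (\<iota> x) = det (adj (h x) ** h' x) * hinner (\<iota> x) (\<iota> x)" by (metis hinner_smult_right)
  then have det: "det (adj (h x) ** h' x) = 1" by (simp add: iota_norm[OF x])
  obtain V n where n: "(V, n) \<in> \<N>" "x \<in> V" by (rule G_bundle_frame_ex[OF N x])
  \<comment> \<open>Smoothness is read off from the corresponding frames of F, where the unit
    factors \<open>n\<close> cancel.\<close>
  have "smooth_at M x (\<lambda>y. adj (mscale (n y $ 1 $ 1) (h y)) ** mscale (n y $ 1 $ 1) (h' y))"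
    by (rule FF_transition[of "U \<inter> V" _ "U' \<inter> V"])
      (use RR_adapted[OF h(1) n(1)] RR_adapted[OF h(2) n(1)] n h in \<open>auto simp: adapted_def\<close>)
  moreover have "\<forall>\<^sub>F y in nhds x. adj (mscale (n y $ 1 $ 1) (h y)) ** mscale (n y $ 1 $ 1) (h' y) = adj (h y) ** h' y"
    using G_bundle_near[OF N n(1) n(2)]
    by eventually_elim (use frame_1_unit(1)[OF G_bundleD(3)[OF N n(1)]] in
        \<open>simp add: adj_mscale mscale_mult_left mscale_mult_right mscale_mscale mult.commute\<close>)
  ultimately have "smooth_at M x (\<lambda>y. adj (h y) ** h' y)" by (rule smooth_at_cong[rotated])
  then show "range ((*v) (h x)) = range ((*v) (h' x)) \<and> adj (h x) ** h' x \<in> SU_group \<and> smooth_at M x (\<lambda>x. adj (h x) ** h' x)"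
    using rng tr(1) det by (simp add: SU_group_def)
qed (use RR_D in auto)

section \<open>The connections induced on the twisted bundle and on the twisted line\<close>

definition BF' where "BF' = tensor_conn N' BF BN'"
definition L' where "L' = tensor_line (bundle_restrict W \<L>) N'"
definition A' where "A' = tensor_conn N' A BN'"

text \<open>The dual square root contributes minus half the trace times the identity, which leaves
  the trace free part of the connection on F.\<close>

lemma ring_frame:
  assumes h: "(U, h) \<in> RR" "x \<in> U" and n: "(V, n) \<in> \<N>" "x \<in> V"
  shows "cov_at BF' h x" "conn_form BF' h x v = conn_form BF (\<lambda>y. mscale (n y $ 1 $ 1) (h y)) x v
     - mscale (trace (conn_form BF (\<lambda>y. mscale (n y $ 1 $ 1) (h y)) x v) / 2) (mat 1)"
proof -
  let ?f = "\<lambda>y. mscale (n y $ 1 $ 1) (h y)"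
  have f: "adapted (U \<inter> V) n ?f" "x \<in> U \<inter> V" using RR_adapted[OF h(1) n(1)] h n by auto
  then have fF: "(U \<inter> V, ?f) \<in> FF" by (simp add: adapted_def)
  note t = tensor_dual_frame[OF n f BF_frame(1)[OF fF f(2)] FF_D(4)[OF fF f(2)], folded BF'_def]
  have ev: "\<forall>\<^sub>F y in nhds x. h y = mscale (cnj (n y $ 1 $ 1)) (?f y)"
    using G_bundle_near[OF N n(1) n(2)]
    by eventually_elim (use frame_1_unit(1)[OF G_bundleD(3)[OF N n(1)]] in \<open>simp add: mscale_mscale\<close>)
  have iso: "adj (mscale (cnj (n x $ 1 $ 1)) (?f x)) ** mscale (cnj (n x $ 1 $ 1)) (?f x) = mat 1"
    using RR_D(3)[OF h] eventually_nhds_x_imp_x[OF ev] by simp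
  show "cov_at BF' h x" by (rule cov_at_cong(1)[OF t(1) iso ev])
  show "conn_form BF' h x v = conn_form BF ?f x v - mscale (trace (conn_form BF ?f x v) / 2) (mat 1)"
    unfolding cov_at_cong(2)[OF t(1) iso ev] by (rule t(2))
qed

lemma bounded_linear_half_trace: "bounded_linear (\<lambda>z :: complex^2^2. - mscale (trace z / 2) (mat 1 :: complex^'r^'r))"
  unfolding linear_conv_bounded_linear[symmetric] linear_iff
  by (auto simp: vec_eq_iff mscale_nth trace_2 algebra_simps add_divide_distrib complex_eq_iff)

lemma ring_connection: "connection M su_alg RR BF'"
proof (rule connectionI[OF RR_bundle])
  fix U h x assume h: "(U, h) \<in> RR" "x \<in> U"
  have xW: "x \<in> W" using RR_D(2)[OF h(1)] h(2) by auto
  obtain V n where n: "(V, n) \<in> \<N>" "x \<in> V" by (rule G_bundle_frame_ex[OF N xW])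
  let ?f = "\<lambda>y. mscale (n y $ 1 $ 1) (h y)"
  have fF: "(U \<inter> V, ?f) \<in> FF" "x \<in> U \<inter> V" using RR_adapted[OF h(1) n(1)] h n by (auto simp: adapted_def)
  note r = ring_frame[OF h(1) _ n(1)]
  have "form_at (conn_form BF' h) x"
  proof (rule form_at_cong)
    show "\<forall>\<^sub>F y in nhds x. (\<lambda>v. conn_form BF ?f y v + - mscale (trace (conn_form BF ?f y v) / 2) (mat 1)) = conn_form BF' h y"
      using eventually_nhds_in_open[OF FF_D(1)[OF fF(1)] fF(2)]
      by eventually_elim (simp add: r fun_eq_iff)
    show "form_at (\<lambda>y v. conn_form BF ?f y v + - mscale (trace (conn_form BF ?f y v) / 2) (mat 1)) x"
      by (rule form_at_add[OF BF_frame(2)[OF fF] form_at_linear[OF bounded_linear_half_trace BF_frame(2)[OF fF]]])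
  qed
  moreover have "conn_form BF' h x v \<in> su_alg" for v
  proof -
    have sk: "adj (conn_form BF ?f x v) = - conn_form BF ?f x v" by (rule BF_frame(3)[OF fF])
    then have "cnj (trace (conn_form BF ?f x v)) = - trace (conn_form BF ?f x v)"
      by (rule trace_skew)
    then show ?thesis
      unfolding r(2)[OF h(2) n(2)] su_alg_def
      by (simp add: adj_diff sk adj_mscale trace_sub trace_mscale) (simp add: vec_eq_iff mscale_nth)
  qed
  ultimately show "cov_at BF' h x \<and> form_at (conn_form BF' h) x \<and> (\<forall>v. conn_form BF' h x v \<in> su_alg)"
    using r(1)[OF h(2) n(2)] by simp
qed

lemma L'_bundle: "G_bundle M W U_group L'"
  unfolding L'_def by (rule G_bundle_tensor[OF G_bundle_restrict[OF L W_open subset_UNIV] N'])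

lemma L'_mem:
  assumes "(U, l) \<in> \<L>" "(V, n) \<in> \<N>"
  shows "(U \<inter> W \<inter> V, \<lambda>x. mscale (cnj (n x $ 1 $ 1)) (l x)) \<in> L'"
  using tensor_lineI[OF bundle_restrictI[OF assms(1)] dual_lineI[OF assms(2)]] by (simp add: L'_def N'_def)

lemma L'_E:
  assumes "(T, e) \<in> L'"
  obtains U l V n where "(U, l) \<in> \<L>" "(V, n) \<in> \<N>" "T = U \<inter> W \<inter> V" "e = (\<lambda>x. mscale (cnj (n x $ 1 $ 1)) (l x))"
proof -
  obtain U' l V n' where *: "(U', l) \<in> bundle_restrict W \<L>" "(V, n') \<in> N'" "T = U' \<inter> V" "e = (\<lambda>x. mscale (n' x $ 1 $ 1) (l x))"
    by (rule tensor_lineE[OF assms[unfolded L'_def]]) (rule that)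
  obtain U where U: "(U, l) \<in> \<L>" "U' = U \<inter> W" by (rule bundle_restrictE[OF *(1)]) (rule that)
  obtain n where n: "(V, n) \<in> \<N>" "n' = conj_frame n" by (rule dual_lineE[OF *(2)[unfolded N'_def]]) (rule that)
  show ?thesis by (rule that[OF U(1) n(1)]) (simp_all add: * U n)
qed

lemma line_frame:
  assumes l: "(U, l) \<in> \<L>" "x \<in> U" and n: "(V, n) \<in> \<N>" "x \<in> V" and f: "adapted V' n f" "x \<in> V'"
  shows "cov_at A' (\<lambda>y. mscale (cnj (n y $ 1 $ 1)) (l y)) x"
    "conn_form A' (\<lambda>y. mscale (cnj (n y $ 1 $ 1)) (l y)) x v = conn_form A l x v - mscale (trace (conn_form BF f x v) / 2) (mat 1)"
  unfolding A'_def by (rule tensor_dual_frame[OF n f connectionD(1)[OF L l(1) A l(2)] G_bundleD(3)[OF L l]])+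

lemma line_connection: "connection M u_alg L' A'"
proof (rule connectionI[OF L'_bundle])
  fix T e x assume e: "(T, e) \<in> L'" "x \<in> T"
  obtain U l V n where *: "(U, l) \<in> \<L>" "(V, n) \<in> \<N>" "T = U \<inter> W \<inter> V" "e = (\<lambda>x. mscale (cnj (n x $ 1 $ 1)) (l x))"
    by (rule L'_E[OF e(1)]) (rule that)
  have x: "x \<in> U" "x \<in> V" using e * by auto
  obtain V' f where f: "adapted V' n f" "x \<in> V'" "V' \<subseteq> V" by (rule adapted_ex[OF *(2) x(2)])
  then have fF: "(V', f) \<in> FF" by (simp add: adapted_def)
  have r: "cov_at A' e y" "conn_form A' e y v = conn_form A l y v - mscale (trace (conn_form BF f y v) / 2) (mat 1)"
    if "y \<in> U" "y \<in> V'" for y v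
    using line_frame[OF *(1) that(1) *(2) _ f(1) that(2)] f(3) that(2) *(4) by auto
  note lA = connectionD[OF L *(1) A]
  have "form_at (conn_form A' e) x"
  proof (rule form_at_cong)
    show "\<forall>\<^sub>F y in nhds x. (\<lambda>v. conn_form A l y v + - mscale (trace (conn_form BF f y v) / 2) (mat 1)) = conn_form A' e y"
      using eventually_nhds_in_open[OF FF_D(1)[OF fF] f(2)] G_bundle_near[OF L *(1) x(1)]
      by eventually_elim (simp add: r fun_eq_iff)
    show "form_at (\<lambda>y v. conn_form A l y v + - mscale (trace (conn_form BF f y v) / 2) (mat 1)) x"
      by (rule form_at_add[OF lA(2)[OF x(1)] form_at_linear[OF bounded_linear_half_trace BF_frame(2)[OF fF f(2)]]])
  qed
  moreover have "conn_form A' e x v \<in> u_alg" for v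
  proof -
    have "adj (conn_form A l x v) = - conn_form A l x v" using lA(3)[OF x(1), of v] by (simp add: u_alg_def)
    moreover have "cnj (trace (conn_form BF f x v)) = - trace (conn_form BF f x v)"
      by (rule trace_skew[OF BF_frame(3)[OF fF f(2)]])
    ultimately show ?thesis
      unfolding r(2)[OF x(1) f(2)] u_alg_def by (simp add: adj_diff adj_mscale) (simp add: vec_eq_iff mscale_nth)
  qed
  ultimately show "cov_at A' e x \<and> form_at (conn_form A' e) x \<and> (\<forall>v. conn_form A' e x v \<in> u_alg)"
    using r(1)[OF x(1) f(2)] by simp
qed

end

lemma adj_sum: "adj (\<Sum>i\<in>I. f i) = (\<Sum>i\<in>I. adj (f i :: complex^'n^'m))"
  by (rule linear_sum[OF bounded_linear.linear[OF bounded_linear_adj]])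

lemma trace_sum: "trace (\<Sum>i\<in>I. f i) = (\<Sum>i\<in>I. trace (f i :: complex^'n^'n))"
  by (rule linear_sum[OF bounded_linear.linear[OF bounded_linear_trace]])

lemma coisometry_square:
  fixes m :: "complex^'n^'n"
  assumes "m ** adj m = mscale c (mat 1)" "c \<noteq> 0"
  shows "adj m ** m = mscale c (mat 1)"
proof -
  have "mscale (inverse c) m ** adj m = mat 1" using assms by (simp add: mscale_mult_left mscale_mscale)
  then have "adj m ** mscale (inverse c) m = mat 1" using matrix_left_right_inverse by blast
  then have "mscale c (mscale (inverse c) (adj m ** m)) = mscale c (mat 1)" by (simp add: mscale_mult_right)
  then show ?thesis using assms(2) by (simp add: mscale_mscale)
qed

context solution_setup
begin

section \<open>The Dirac equation in local frames\<close>

lemma spin_frame_atE: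
  obtains V s \<epsilon> where "spin_frame_at M x = (s, \<epsilon>)" "(V, s, \<epsilon>) \<in> spin_frames M" "x \<in> V" "(V, s) \<in> \<S>"
proof -
  obtain V s where "(V, s) \<in> \<S>" "x \<in> V" using G_bundle_frame_ex[OF S] by blast
  then obtain \<epsilon> where "(V, s, \<epsilon>) \<in> spin_frames M" "x \<in> V" by (auto simp: spinor_bundle_def)
  then have ex: "\<exists>f. f \<in> spin_frames M \<and> x \<in> fst f" by force
  define p where "p = (SOME f. f \<in> spin_frames M \<and> x \<in> fst f)"
  have p: "p \<in> spin_frames M \<and> x \<in> fst p" unfolding p_def by (rule someI_ex[OF ex])
  obtain V s \<epsilon> where q: "p = (V, s, \<epsilon>)" by (cases p)
  show ?thesis
    by (rule that[of s \<epsilon> V]) (use p q in \<open>auto simp: spin_frame_at_def p_def[symmetric] spinor_bundle_def\<close>)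
qed

text \<open>\<open>spin_conn\<close> is defined through the frame chosen at \<open>x\<close>, and
  the later computations at \<open>x\<close> use that frame. Its form is a real combination of
  \<open>gam i ** gam j\<close> with distinct indices, hence in su(2), so it contributes nothing to
  traces.\<close>

lemma spin_conn_frame:
  assumes sf: "spin_frame_at M x = (s, \<epsilon>)" and s: "(V, s) \<in> \<S>" "x \<in> V"
  shows "cov_at (spin_conn M) s x" "adj (conn_form (spin_conn M) s x v) = - conn_form (spin_conn M) s x v"
    "trace (conn_form (spin_conn M) s x v) = 0"
proof -
  define \<Omega> where "\<Omega> v = (\<Sum>i\<in>UNIV. \<Sum>j\<in>UNIV - {i}.
      (1/4 * metric M x (levi_civita M (\<lambda>y. column i (\<epsilon> y)) x v) (column j (\<epsilon> x))) *\<^sub>R (gam i ** gam j))" for v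
  have main: "spin_conn M \<psi> x v = s x *v (mderiv M c x v + \<Omega> v *v c x)"
    if c: "smooth_at M x c" and \<psi>: "\<forall>\<^sub>F y in nhds x. \<psi> y = s y *v c y" for c \<psi> v
  proof -
    have ev: "\<forall>\<^sub>F y in nhds x. adj (s y) *v \<psi> y = c y"
      using \<psi> G_bundle_near[OF S s(1) s(2)]
      by eventually_elim (simp add: isometry_vector[OF G_bundleD(3)[OF S s(1)]])
    show ?thesis
      using fun_cong[OF mderiv_cong[OF ev], of v] eventually_nhds_x_imp_x[OF ev]
      by (simp add: spin_conn_def sf Let_def \<Omega>_def)
  qed
  note res = cov_atI[of s x "spin_conn M" \<Omega>, OF G_bundleD(3)[OF S s] main]
  show "cov_at (spin_conn M) s x" by (rule res(1))
  have cf: "conn_form (spin_conn M) s x v = \<Omega> v" by (rule res(2))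
  show "adj (conn_form (spin_conn M) s x v) = - conn_form (spin_conn M) s x v"
    unfolding cf \<Omega>_def adj_sum adj_scaleR sum_negf[symmetric]
    by (intro sum.cong refl) (auto simp: gam_gam(1))
  have "trace ((r *\<^sub>R (gam i ** gam j))) = 0" if "i \<noteq> j" for r i j
    using gam_gam(2)[OF that] by (simp add: scaleR_eq_mscale trace_mscale)
  then show "trace (conn_form (spin_conn M) s x v) = 0"
    unfolding cf \<Omega>_def trace_sum by (intro sum.neutral ballI) auto
qed

lemma spin_frame_orthonormal:
  assumes "(V, s, \<epsilon>) \<in> spin_frames M" "x \<in> V"
  shows "det (\<epsilon> x) > 0" "metric M x (column i (\<epsilon> x)) (column j (\<epsilon> x)) = (if i = j then 1 else 0)"
proof -
  have "\<forall>(U, s, e)\<in>spin_frames M. oriented_orthonormal_frame M U e"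
    using closed unfolding closed_spin_manifold_def spin_structure_def by (elim conjE)
  from bspec[OF this assms(1)] have "oriented_orthonormal_frame M V \<epsilon>" by simp
  then show "det (\<epsilon> x) > 0" "metric M x (column i (\<epsilon> x)) (column j (\<epsilon> x)) = (if i = j then 1 else 0)"
    using assms(2) unfolding oriented_orthonormal_frame_def by auto
qed

lemma clifford_frame:
  assumes "spin_frame_at M x = (s, \<epsilon>)" "(V, s, \<epsilon>) \<in> spin_frames M" "x \<in> V"
  shows "clifford M x (column i (\<epsilon> x)) = s x ** gam i ** adj (s x)"
proof -
  have "(\<Sum>j\<in>UNIV. metric M x (column i (\<epsilon> x)) (column j (\<epsilon> x)) *\<^sub>R gam j) = (\<Sum>j\<in>UNIV. if i = j then gam j else 0)"
    by (intro sum.cong refl) (simp add: spin_frame_orthonormal[OF assms(2,3)])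
  then show ?thesis by (simp add: clifford_def assms(1))
qed

text \<open>The matrix of \<open>\<Psi>\<close> restricted to \<open>F\<close> with respect to the frames \<open>f\<close> of \<open>F\<close> and \<open>s \<otimes> l\<close> of \<open>S \<otimes> L\<close>, and the
  matrix of its covariant derivative.\<close>

definition twist where
  "twist s l f y = mscale (cnj (l y $ 1 $ 1)) (adj (s y) ** \<Psi> y ** f y)"
  for s :: "'m \<Rightarrow> complex^2^2" and l :: "'m \<Rightarrow> complex^1^1" and f :: "'m \<Rightarrow> complex^'r^'n"

definition twist_deriv where
  "twist_deriv s l f x v = mderiv M (twist s l f) x v
     + (conn_form (spin_conn M) s x v + mscale (conn_form A l x v $ 1 $ 1) (mat 1)) ** twist s l f x
     - twist s l f x ** conn_form BF f x v"
  for s :: "'m \<Rightarrow> complex^2^2" and l :: "'m \<Rightarrow> complex^1^1" and f :: "'m \<Rightarrow> complex^2^'n"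

lemma twist_frame:
  assumes "(V, s) \<in> \<S>" "y \<in> V" "(U, l) \<in> \<L>" "y \<in> U"
  shows "\<Psi> y ** f y = mscale (l y $ 1 $ 1) (s y) ** twist s l f y"
proof -
  have "mscale (l y $ 1 $ 1) (s y) ** twist s l f y
      = mscale (cnj (l y $ 1 $ 1) * l y $ 1 $ 1) ((s y ** adj (s y)) ** \<Psi> y ** f y)"
    by (simp add: twist_def mscale_mult_left mscale_mult_right mscale_mscale matrix_mul_assoc mult.commute)
  then show ?thesis
    using frame_1_unit(1)[OF G_bundleD(3)[OF L assms(3,4)]] isometry_square[OF G_bundleD(3)[OF S assms(1,2)]] by simp
qed

lemma smooth_twist:
  assumes s: "(V, s) \<in> \<S>" "x \<in> V" and l: "(U, l) \<in> \<L>" "x \<in> U" and f: "(V', f) \<in> FF" "x \<in> V'"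
  shows "smooth_at M x (twist s l f)"
proof -
  obtain T e where e: "(T, e) \<in> \<E>" "x \<in> T" using G_bundle_frame_ex[OF E] by blast
  have "smooth_at M x (\<lambda>y. mscale (cnj (l y $ 1 $ 1)) (adj (s y) ** \<Psi> y ** e y) ** (adj (e y) ** f y))"
    by (rule smooth_at_bilinear[OF bounded_bilinear_matrix_mult smooth_Psi[OF e s l] FF_D(3)[OF f e]])
  moreover have "\<forall>\<^sub>F y in nhds x. mscale (cnj (l y $ 1 $ 1)) (adj (s y) ** \<Psi> y ** e y) ** (adj (e y) ** f y) = twist s l f y"
    using G_bundle_near[OF E e(1) e(2)]
  proof eventually_elim
    case (elim y)
    have "mscale (cnj (l y $ 1 $ 1)) (adj (s y) ** \<Psi> y ** e y) ** (adj (e y) ** f y)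
      = mscale (cnj (l y $ 1 $ 1)) (adj (s y) ** \<Psi> y ** (e y ** adj (e y)) ** f y)"
      by (simp add: mscale_mult_left matrix_mul_assoc)
    then show ?case using isometry_square[OF G_bundleD(3)[OF E e(1) elim]] by (simp add: twist_def)
  qed
  ultimately show ?thesis by (rule smooth_at_cong[rotated])
qed

text \<open>F and S both have rank 2, so the matrix is square and a scalar product with the adjoint
  on one side gives the same scalar on the other: \<Psi> restricted to F is a multiple of a unitary
  map.\<close>

lemma twist_adj:
  assumes s: "(V, s) \<in> \<S>" "x \<in> V" and l: "(U, l) \<in> \<L>" "x \<in> U" and f: "(V', f) \<in> FF" "x \<in> V'"
  shows "twist s l f x ** adj (twist s l f x) = mscale (of_real (h2 x)) (mat 1)"
    "adj (twist s l f x) ** twist s l f x = mscale (of_real (h2 x)) (mat 1)"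
proof -
  have "twist s l f x ** adj (twist s l f x)
      = mscale (cnj (l x $ 1 $ 1) * l x $ 1 $ 1) (adj (s x) ** ((\<Psi> x ** f x ** adj (f x)) ** adj (\<Psi> x)) ** s x)"
    by (simp add: twist_def adj_mscale adj_mult mscale_mult_left mscale_mult_right mscale_mscale matrix_mul_assoc mult.commute)
  then show 1: "twist s l f x ** adj (twist s l f x) = mscale (of_real (h2 x)) (mat 1)"
    unfolding FF_Psi[OF f] Psi_adj using frame_1_unit(1)[OF G_bundleD(3)[OF L l]] G_bundleD(3)[OF S s]
    by (simp add: mscale_mult_left mscale_mult_right)
  have "h2 x > 0" using FF_D(2)[OF f(1)] f(2) h2_pos by auto
  then show "adj (twist s l f x) ** twist s l f x = mscale (of_real (h2 x)) (mat 1)"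
    by (intro coisometry_square[OF 1]) simp
qed

text \<open>On sections of F the connection \<open>B\<close> and its projection differ by a term
  with values in the orthogonal complement of F, which \<Psi> annihilates. The derivative of \<Psi>
  along F thus involves the projected connection only.\<close>

lemma hom_conn_frame:
  assumes sf: "spin_frame_at M x = (s, \<epsilon>)" and s: "(V, s) \<in> \<S>" "x \<in> V" and l: "(U, l) \<in> \<L>" "x \<in> U"
    and f: "(V', f) \<in> FF" "x \<in> V'"
  shows "hom_conn \<E> B (tensor_conn \<L> (spin_conn M) A) \<Psi> x v ** f x = mscale (l x $ 1 $ 1) (s x ** twist_deriv s l f x v)"
proof -
  define e where "e = frame_at \<E> x"
  obtain T where e: "(T, e) \<in> \<E>" "x \<in> T" using frame_atE[OF E UNIV_I] unfolding e_def .
  define T' where "T' = tensor_conn \<L> (spin_conn M) A"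
  define t where "t y = mscale (l y $ 1 $ 1) (s y)" for y
  define \<tau> where "\<tau> = conn_form (spin_conn M) s x v + mscale (conn_form A l x v $ 1 $ 1) (mat 1)"
  note tc = tensor_conn_cov[OF L l connectionD(1)[OF L l(1) A l(2)] spin_conn_frame(1)[OF sf s] G_bundleD(3)[OF S s],
      folded T'_def t_def[abs_def]]
  have Me: "smooth_at M x (twist s l e)"
    unfolding twist_def[abs_def] by (rule smooth_Psi[OF e s l])
  have "\<forall>\<^sub>F y in nhds x. \<Psi> y ** e y = t y ** twist s l e y"
    using G_bundle_near[OF S s(1) s(2)] G_bundle_near[OF L l(1) l(2)]
    by eventually_elim (simp add: t_def twist_frame[OF s(1) _ l(1)])
  from cov_at_matrix[OF tc(1) Me this]
  have DT: "dmat T' (\<lambda>y. \<Psi> y ** e y) x v = t x ** (mderiv M (twist s l e) x v + \<tau> ** twist s l e x)"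
    by (simp add: tc(2) \<tau>_def)
  note Be = connectionD(1)[OF E e(1) B e(2)]
  have DB: "dmat B e x v = e x ** conn_form B e x v" by (rule dmat_frame[OF Be])
  define g where "g y = adj (e y) ** f y" for y
  have sg: "smooth_at M x g" unfolding g_def[abs_def] by (rule FF_D(3)[OF f e])
  have Mf: "\<forall>\<^sub>F y in nhds x. twist s l f y = twist s l e y ** g y"
    using G_bundle_near[OF E e(1) e(2)]
  proof eventually_elim
    case (elim y)
    have "twist s l e y ** g y = mscale (cnj (l y $ 1 $ 1)) (adj (s y) ** \<Psi> y ** (e y ** adj (e y)) ** f y)"
      by (simp add: twist_def g_def mscale_mult_left matrix_mul_assoc)
    then show ?case using isometry_square[OF G_bundleD(3)[OF E e(1) elim]] by (simp add: twist_def)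
  qed
  have dMf: "mderiv M (twist s l f) x v = twist s l e x ** mderiv M g x v + mderiv M (twist s l e) x v ** g x"
    using fun_cong[OF mderiv_cong[OF Mf], of v] mderiv_mmul[OF Me sg] by simp
  have Mfx: "twist s l f x = twist s l e x ** g x" by (rule eventually_nhds_x_imp_x[OF Mf])
  \<comment> \<open>\<open>g ** adj g\<close> represents the projection to F in the frame
    \<open>e\<close>, and \<Psi> factors through it.\<close>
  have gg: "twist s l e x ** g x ** adj (g x) = twist s l e x"
  proof -
    have "twist s l e x ** g x ** adj (g x)
        = mscale (cnj (l x $ 1 $ 1)) (adj (s x) ** (\<Psi> x ** (e x ** adj (e x)) ** f x ** adj (f x)) ** e x)"
      by (simp add: twist_def g_def adj_mult mscale_mult_left matrix_mul_assoc)
    then show ?thesis using isometry_square[OF G_bundleD(3)[OF E e]] FF_Psi[OF f] by (simp add: twist_def)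
  qed
  have a: "conn_form BF f x v = adj (g x) ** (mderiv M g x v + conn_form B e x v ** g x)"
    unfolding BF_def g_def
    by (rule proj_conn_cov(2)[OF Be _ FF_D(3)[OF f e] FF_D(4)[OF f] FF_proj[OF f]])
      (use G_bundle_near[OF E e(1) e(2)] G_bundleD(3)[OF E e(1)] in \<open>auto elim!: eventually_mono\<close>)
  have Ma: "twist s l f x ** conn_form BF f x v = twist s l e x ** (mderiv M g x v + conn_form B e x v ** g x)"
    unfolding a Mfx using gg by (simp add: matrix_mul_assoc)
  have Pe: "\<Psi> x ** e x = t x ** twist s l e x" by (simp add: t_def twist_frame[OF s l])
  have "hom_conn \<E> B T' \<Psi> x v ** f x
      = (dmat T' (\<lambda>y. \<Psi> y ** e y) x v - \<Psi> x ** e x ** conn_form B e x v) ** g x"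
    by (simp add: hom_conn_dmat e_def[symmetric] DB g_def matrix_mul_assoc)
  also have "\<dots> = t x ** (mderiv M (twist s l e) x v + \<tau> ** twist s l e x - twist s l e x ** conn_form B e x v) ** g x"
    unfolding DT Pe by (simp add: matrix_mult_diff_right matrix_mul_assoc)
  also have "\<dots> = t x ** (mderiv M (twist s l e) x v ** g x + \<tau> ** twist s l f x - twist s l e x ** (conn_form B e x v ** g x))"
    unfolding Mfx by (simp add: matrix_mult_diff_left matrix_mult_add_left matrix_mul_assoc[symmetric])
  also have "mderiv M (twist s l e) x v ** g x + \<tau> ** twist s l f x - twist s l e x ** (conn_form B e x v ** g x) = twist_deriv s l f x v"
    unfolding twist_deriv_def Ma dMf by (simp add: \<tau>_def[symmetric] matrix_add_ldistrib)
  finally show ?thesis by (simp add: T'_def t_def mscale_mult_left)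
qed

text \<open>The Dirac equation is applied to the frame \<open>f\<close>, and the invertible factors
  \<open>s\<close> and \<open>l\<close> are stripped off: Clifford multiplication by the frame
  vectors becomes multiplication by \<open>gam i\<close>.\<close>

lemma dirac_frame:
  assumes sf: "spin_frame_at M x = (s, \<epsilon>)" and s\<epsilon>: "(V, s, \<epsilon>) \<in> spin_frames M" and x: "x \<in> V"
    and l: "(U, l) \<in> \<L>" "x \<in> U" and f: "(V', f) \<in> FF" "x \<in> V'"
  shows "(\<Sum>i\<in>UNIV. gam i ** twist_deriv s l f x (column i (\<epsilon> x))) = 0"
proof -
  have s: "(V, s) \<in> \<S>" using s\<epsilon> by (auto simp: spinor_bundle_def)
  let ?R = "\<lambda>i. twist_deriv s l f x (column i (\<epsilon> x))"
  let ?H = "\<lambda>i. hom_conn \<E> B (tensor_conn \<L> (spin_conn M) A) \<Psi> x (column i (\<epsilon> x))"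
  have "(\<Sum>i\<in>UNIV. clifford M x (column i (\<epsilon> x)) ** ?H i) = 0"
  proof -
    have "dirac M \<E> B \<L> A \<Psi> x = 0" using sol by (simp add: solution_def)
    then show ?thesis by (simp add: dirac_def sf)
  qed
  then have "(\<Sum>i\<in>UNIV. clifford M x (column i (\<epsilon> x)) ** ?H i) ** f x = 0" by simp
  moreover have "clifford M x (column i (\<epsilon> x)) ** ?H i ** f x = mscale (l x $ 1 $ 1) (s x ** (gam i ** ?R i))" for i
  proof -
    have "clifford M x (column i (\<epsilon> x)) ** ?H i ** f x
        = clifford M x (column i (\<epsilon> x)) ** (?H i ** f x)" by (simp add: matrix_mul_assoc)
    also have "\<dots> = mscale (l x $ 1 $ 1) (s x ** gam i ** (adj (s x) ** s x) ** ?R i)"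
      unfolding hom_conn_frame[OF sf s x l f] clifford_frame[OF sf s\<epsilon> x] by (simp add: mscale_mult_right matrix_mul_assoc)
    finally show ?thesis using G_bundleD(3)[OF S s x] by (simp add: matrix_mul_assoc)
  qed
  ultimately have z: "mscale (l x $ 1 $ 1) (s x ** (\<Sum>i\<in>UNIV. gam i ** ?R i)) = 0"
    by (simp add: matrix_sum_left matrix_sum_right mscale_sum)
  have "(\<Sum>i\<in>UNIV. gam i ** ?R i) = mscale (cnj (l x $ 1 $ 1)) (adj (s x) ** mscale (l x $ 1 $ 1) (s x ** (\<Sum>i\<in>UNIV. gam i ** ?R i)))"
    using frame_1_unit(1)[OF G_bundleD(3)[OF L l]] G_bundleD(3)[OF S s x]
    by (simp add: mscale_mult_right mscale_mscale matrix_mul_assoc)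
  then show ?thesis unfolding z by simp
qed

text \<open>The left side is the trace of the derivative of \<Psi> along F times its adjoint:
  \<open>A\<close> enters twice because S has rank 2, and the spin connection not at all. Its real
  part is the derivative of \<open>h2\<close> by the equation \<open>mu = 0\<close>; that the
  imaginary part vanishes comes from the Dirac equation.\<close>

lemma trace_twist_deriv:
  assumes sf: "spin_frame_at M x = (s, \<epsilon>)" and s\<epsilon>: "(V, s, \<epsilon>) \<in> spin_frames M" and x: "x \<in> V"
    and l: "(U, l) \<in> \<L>" "x \<in> U" and f: "(V', f) \<in> FF" "x \<in> V'"
  shows "trace (mderiv M (twist s l f) x v ** adj (twist s l f x))
      + of_real (h2 x) * (2 * conn_form A l x v $ 1 $ 1 - trace (conn_form BF f x v)) = of_real (mderiv M h2 x v)" (is "?T v = ?r v")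
proof -
  have s: "(V, s) \<in> \<S>" using s\<epsilon> by (auto simp: spinor_bundle_def)
  let ?m = "twist s l f"
  note sm = smooth_twist[OF s x l f]
  define X where "X v = twist_deriv s l f x v ** adj (?m x)" for v
  define a where "a v = conn_form BF f x v" for v
  define \<tau> where "\<tau> v = conn_form (spin_conn M) s x v + mscale (conn_form A l x v $ 1 $ 1) (mat 1)" for v
  have sk: "adj (a v) = - a v" for v unfolding a_def by (rule BF_frame(3)[OF f])
  have "adj (conn_form A l x v) = - conn_form A l x v" for v
    using connectionD(3)[OF L l(1) A l(2), of v] by (simp add: u_alg_def)
  from arg_cong[OF this, of "\<lambda>z. z $ 1 $ 1"] have "cnj (conn_form A l x v $ 1 $ 1) = - conn_form A l x v $ 1 $ 1" for v
    by (simp add: adj_nth)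
  then have sk\<tau>: "adj (\<tau> v) = - \<tau> v" for v
    by (simp add: \<tau>_def adj_add adj_mscale spin_conn_frame(2)[OF sf s x]) (simp add: vec_eq_iff mscale_nth)
  have X: "X v = mderiv M ?m x v ** adj (?m x) + mscale (of_real (h2 x)) (\<tau> v) - ?m x ** a v ** adj (?m x)" for v
    using twist_adj(1)[OF s x l f]
    by (simp add: X_def twist_deriv_def \<tau>_def[symmetric] a_def[symmetric] matrix_mult_add_left matrix_mult_diff_left
        matrix_mul_assoc[symmetric] mscale_mult_right)
  have trX: "trace (X v) = ?T v" for v
  proof -
    have "trace (?m x ** a v ** adj (?m x)) = trace (adj (?m x) ** (?m x ** a v))" by (rule trace_mul_sym)
    also have "\<dots> = of_real (h2 x) * trace (a v)"
      using twist_adj(2)[OF s x l f] by (simp add: matrix_mul_assoc mscale_mult_left trace_mscale)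
    finally show ?thesis
      by (simp add: X trace_add trace_sub trace_mscale \<tau>_def spin_conn_frame(3)[OF sf s x] a_def algebra_simps)
  qed
  \<comment> \<open>Differentiating \<open>?m y ** adj (?m y)\<close>, which is \<open>h2 y\<close>
    times the identity, gives the scalar; the terms with the skew forms \<open>\<tau>\<close> and
    \<open>a\<close> cancel against their adjoints.\<close>
  have herm: "X v + adj (X v) = mscale (of_real (mderiv M h2 x v)) (mat 1)" for v
  proof -
    have "\<forall>\<^sub>F y in nhds x. ?m y ** adj (?m y) = h2 y *\<^sub>R mat 1"
      using G_bundle_near[OF S s x] G_bundle_near[OF L l(1) l(2)]
        eventually_nhds_in_open[OF FF_D(1)[OF f(1)] f(2)]
      by eventually_elim (simp add: twist_adj(1)[OF s _ l(1) _ f(1)] scaleR_eq_mscale)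
    from fun_cong[OF mderiv_cong[OF this], of v]
    have "mderiv M (\<lambda>y. ?m y ** adj (?m y)) x v = mscale (of_real (mderiv M h2 x v)) (mat 1)"
      unfolding mderiv_scaleR[OF smooth_h2 smooth_at_const] by (simp add: mderiv_const scaleR_eq_mscale)
    moreover have "mderiv M (\<lambda>y. ?m y ** adj (?m y)) x v = ?m x ** adj (mderiv M ?m x v) + mderiv M ?m x v ** adj (?m x)"
      using mderiv_mmul[OF sm smooth_at_linear[OF bounded_linear_adj sm]] mderiv_adj[OF sm] by simp
    moreover have "adj (?m x ** a v ** adj (?m x)) = - (?m x ** a v ** adj (?m x))"
    proof -
      have "adj (?m x ** a v ** adj (?m x)) = ?m x ** (- a v) ** adj (?m x)" by (simp add: adj_mult sk matrix_mul_assoc)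
      also have "\<dots> = - (?m x ** a v ** adj (?m x))" by (simp add: vec_eq_iff matrix_matrix_mult_def sum_negf)
      finally show ?thesis .
    qed
    moreover have "mscale c (- z) = - mscale c z" for c and z :: "complex^2^2" by (simp add: vec_eq_iff mscale_nth)
    ultimately show ?thesis by (simp add: X adj_add adj_diff adj_mult adj_mscale sk\<tau> add.commute)
  qed
  have "(\<Sum>i\<in>UNIV. gam i ** X (column i (\<epsilon> x))) = (\<Sum>i\<in>UNIV. gam i ** twist_deriv s l f x (column i (\<epsilon> x))) ** adj (?m x)"
    by (simp add: X_def matrix_sum_left matrix_mul_assoc)
  then have dirac: "(\<Sum>i\<in>UNIV. gam i ** X (column i (\<epsilon> x))) = 0" by (simp add: dirac_frame[OF assms])
  \<comment> \<open>The Clifford argument speaks about the three vectors of the orthonormal frame;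
    as both sides are linear in the tangent vector, these suffice.\<close>
  have basis: "?T (column i (\<epsilon> x)) = ?r (column i (\<epsilon> x))" for i
    using gam_sum_trace_real[OF herm dirac, of i] trX by simp
  have lin_l: "linear ?T"
  proof -
    have "linear (mderiv M ?m x)" "linear (conn_form A l x)" "linear (conn_form BF f x)"
      using linear_mderiv[OF sm] connectionD(2)[OF L l(1) A l(2)] BF_frame(2)[OF f] by (auto simp: form_at_def)
    then show ?thesis
      by (simp add: linear_iff matrix_mult_add_left trace_add scaleR_eq_mscale mscale_mult_left trace_mscale mscale_nth algebra_simps
          scaleR_conv_of_real)
  qed
  have lin_r: "linear ?r" using linear_mderiv[OF smooth_h2[of x]] by (simp add: linear_iff scaleR_conv_of_real)
  have "invertible (\<epsilon> x)" using spin_frame_orthonormal(1)[OF s\<epsilon> x] by (simp add: invertible_det_nz)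
  then obtain c where "v = \<epsilon> x *v c" by (metis invertible_def matrix_right_invertible_surjective surjD)
  then have v: "v = (\<Sum>i\<in>UNIV. c $ i *\<^sub>R column i (\<epsilon> x))" by (simp add: matrix_mult_sum scalar_mult_eq_scaleR)
  show ?thesis
    unfolding v linear_sum[OF lin_l] linear_sum[OF lin_r] linear_scale[OF lin_l] linear_scale[OF lin_r] basis ..
qed

text \<open>Jacobi's formula turns the trace identity into the logarithmic derivative of the
  determinant. Its real part is that of \<open>h2\<close>, the norm of the determinant, so division
  by \<open>h2\<close> leaves a unit function governed by the connection forms alone.\<close>

lemma det_twist_derivative:
  assumes sf: "spin_frame_at M x = (s, \<epsilon>)" and s\<epsilon>: "(V, s, \<epsilon>) \<in> spin_frames M" and x: "x \<in> V"
    and l: "(U, l) \<in> \<L>" "x \<in> U" and f: "(V', f) \<in> FF" "x \<in> V'"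
  shows "smooth_at M x (\<lambda>y. det (twist s l f y) * of_real (inverse (h2 y)))"
    "mderiv M (\<lambda>y. det (twist s l f y) * of_real (inverse (h2 y))) x v
      = - (2 * conn_form A l x v $ 1 $ 1 - trace (conn_form BF f x v)) * (det (twist s l f x) * of_real (inverse (h2 x)))"
proof -
  have s: "(V, s) \<in> \<S>" using s\<epsilon> by (auto simp: spinor_bundle_def)
  let ?m = "twist s l f"
  have h: "h2 x > 0" using FF_D(2)[OF f(1)] f(2) h2_pos by auto
  have sm: "smooth_at M x ?m" by (rule smooth_twist[OF s x l f])
  have sd: "smooth_at M x (\<lambda>y. det (?m y))" by (intro smooth_intros sm)
  have sh: "smooth_at M x (\<lambda>y. inverse (h2 y))" by (rule smooth_at_inverse[OF smooth_h2]) (use h in simp)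
  have sh': "smooth_at M x (\<lambda>y. complex_of_real (inverse (h2 y)))" by (rule smooth_at_linear[OF bounded_linear_of_real sh])
  show "smooth_at M x (\<lambda>y. det (?m y) * of_real (inverse (h2 y)))" by (rule smooth_at_bilinear[OF bounded_bilinear_mult sd sh'])
  let ?t = "2 * conn_form A l x v $ 1 $ 1 - trace (conn_form BF f x v)"
  have "of_real (h2 x) * mderiv M (\<lambda>y. det (?m y)) x v = det (?m x) * trace (mderiv M ?m x v ** adj (?m x))"
    unfolding mderiv_det_2[OF sm] by (rule det_derivative_conformal[OF twist_adj(2)[OF s x l f]])
  also have "trace (mderiv M ?m x v ** adj (?m x)) = of_real (mderiv M h2 x v) - of_real (h2 x) * ?t"
    using trace_twist_deriv[OF assms, of v] by (simp add: algebra_simps)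
  finally have dd: "mderiv M (\<lambda>y. det (?m y)) x v = det (?m x) * (of_real (mderiv M h2 x v) - of_real (h2 x) * ?t) / of_real (h2 x)"
    using h by (simp add: field_simps)
  have "mderiv M (\<lambda>y. complex_of_real (inverse (h2 y))) x v = - of_real (mderiv M h2 x v) / (of_real (h2 x))\<^sup>2"
    by (subst mderiv_of_real[OF sh]) (use h in \<open>simp add: mderiv_inverse[OF smooth_h2]\<close>)
  then show "mderiv M (\<lambda>y. det (?m y) * of_real (inverse (h2 y))) x v = - ?t * (det (?m x) * of_real (inverse (h2 x)))"
    unfolding mderiv_mult[OF sd sh'] dd using h by (simp add: field_simps power2_eq_square)
qed

section \<open>Existence of a square root of the determinant\<close>

text \<open>The rescaled adjoint of \<open>\<Psi>\<close> is a unitary isomorphism \<open>S \<otimes> L \<rightarrow> F\<close>, and \<open>det S\<close> is trivial, so that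
  \<open>K = L\<^sup>2\<close>. Without the factor in \<open>L\<close> only its determinant is independent of the spin frame.\<close>

definition coiso where
  "coiso s x = mscale (of_real (inverse (sqrt (h2 x)))) (adj (\<Psi> x) ** s x)"
  for s :: "'m \<Rightarrow> complex^2^2"

text \<open>Spin frames differ by matrices of determinant one.\<close>

lemma coiso_wedge:
  assumes "(V, s) \<in> \<S>" "x \<in> V" "(V', s') \<in> \<S>" "x \<in> V'"
  shows "wedge2 (coiso s' x) = wedge2 (coiso s x)"
proof -
  have tr: "adj (s x) ** s' x \<in> SU_group" by (rule G_bundle_transition(2)[OF S assms(1,3,2,4)])
  have "s' x = s x ** (adj (s x) ** s' x)"
    by (rule isometry_transition(2)) (use G_bundleD(3)[OF S] G_bundle_transition(1)[OF S assms(1,3,2,4)] assms in auto)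
  then have "coiso s' x = coiso s x ** (adj (s x) ** s' x)"
    by (simp add: coiso_def mscale_mult_left) (metis matrix_mul_assoc)
  then show ?thesis using tr by (simp add: wedge2_mult SU_group_def)
qed

lemma coiso_FF:
  assumes "(V, s) \<in> \<S>" "(V', l) \<in> \<L>"
  shows "(V \<inter> V' \<inter> W, \<lambda>y. mscale (l y $ 1 $ 1) (coiso s y)) \<in> FF"
  using FF_adapted[OF assms] by (simp add: coiso_def mscale_mscale)

text \<open>The image of 1 in the fibre of the square of L under the isomorphism onto K. Like every
  \<open>\<iota>\<close> it is given point by point and may be discontinuous.\<close>

definition root_section where "root_section x = wedge2 (coiso (frame_at \<S> x) x)"

lemma root_section_eq:
  assumes "(V, s) \<in> \<S>" "x \<in> V"
  shows "root_section x = wedge2 (coiso s x)"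
proof -
  obtain V' where "(V', frame_at \<S> x) \<in> \<S>" "x \<in> V'" using frame_atE[OF S UNIV_I] .
  then show ?thesis unfolding root_section_def by (rule coiso_wedge[OF assms])
qed

lemma root_section_adapted:
  assumes s: "(V, s) \<in> \<S>" "x \<in> V" and l: "(V', l) \<in> \<L>" "x \<in> V'"
  shows "(l x $ 1 $ 1)\<^sup>2 *s root_section x = wedge2 (mscale (l x $ 1 $ 1) (coiso s x))"
  by (simp add: root_section_eq[OF s] wedge2_mscale)

text \<open>L itself, restricted to the complement of the zeros, is the root: the square of a frame
  \<open>l\<close> times \<open>root_section\<close> is the determinant of the unitary frame of F
  built from \<open>s\<close> and \<open>l\<close>, hence smooth and of norm one.\<close>

lemma square_root_exists: "square_root M W KK (bundle_restrict W \<L>) root_section"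
  unfolding square_root_def
proof (intro conjI ballI)
  show "G_bundle M W U_group (bundle_restrict W \<L>)" by (rule G_bundle_restrict[OF L W_open subset_UNIV])
  have frames: "\<exists>V s V' l. (V, s) \<in> \<S> \<and> x \<in> V \<and> (V', l) \<in> \<L> \<and> x \<in> V'" for x
    using G_bundle_frame_ex[OF S, of x] G_bundle_frame_ex[OF L, of x] by (metis UNIV_I)
  fix x assume x: "x \<in> W"
  obtain V s V' l where s: "(V, s) \<in> \<S>" "x \<in> V" and l: "(V', l) \<in> \<L>" "x \<in> V'" using frames[of x] by blast
  let ?f = "\<lambda>y. mscale (l y $ 1 $ 1) (coiso s y)"
  have f: "(V \<inter> V' \<inter> W, ?f) \<in> FF" "x \<in> V \<inter> V' \<inter> W" using coiso_FF[OF s(1) l(1)] s l x by auto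
  note lx = frame_1_unit[OF G_bundleD(3)[OF L l]]
  have eq: "root_section x = (cnj (l x $ 1 $ 1))\<^sup>2 *s wedge2 (?f x)"
  proof -
    have "(cnj (l x $ 1 $ 1))\<^sup>2 *s wedge2 (?f x) = ((cnj (l x $ 1 $ 1) * l x $ 1 $ 1)\<^sup>2) *s root_section x"
      unfolding root_section_adapted[OF s l, symmetric] by (simp add: vector_smult_assoc power_mult_distrib)
    then show ?thesis using lx(1) by simp
  qed
  show "root_section x \<in> fibre KK x" using fibre_KK[OF f] eq by blast
  have "hinner (root_section x) (root_section x) = ((cnj (l x $ 1 $ 1) * l x $ 1 $ 1)\<^sup>2) * hinner (wedge2 (?f x)) (wedge2 (?f x))"
    unfolding eq hinner_smult_left hinner_smult_right by (simp add: power2_eq_square ac_simps)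
  then have "complex_of_real ((norm (root_section x))\<^sup>2) = 1"
    unfolding wedge2_self[OF f] lx(1) hinner_self[of "root_section x"] by simp
  then show "norm (root_section x) = 1"
    by (metis of_real_eq_1_iff norm_ge_zero power2_eq_1_iff le_minus_one_simps(3))
next
  fix p assume "p \<in> bundle_restrict W \<L>"
  then obtain U l where p: "p = (U \<inter> W, l)" "(U, l) \<in> \<L>" by (auto simp: bundle_restrict_def)
  have "smooth_section M KK (U \<inter> W) (\<lambda>x. (l x $ 1 $ 1)\<^sup>2 *s root_section x)"
    unfolding smooth_section_def
  proof (intro ballI)
    fix q assume "q \<in> KK"
    then obtain V' f where q: "q = (V', \<lambda>x. columnvector (wedge2 (f x)))" "(V', f) \<in> FF" by (cases q) (auto simp: KK_iff)
    have *: "(l x $ 1 $ 1)\<^sup>2 *s root_section x \<in> range ((*v) (columnvector (wedge2 (f x)) :: complex^1^('n \<times> 'n))) \<and>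
       smooth_at M x (\<lambda>x. (adj (columnvector (wedge2 (f x))) :: complex^('n \<times> 'n)^1) *v ((l x $ 1 $ 1)\<^sup>2 *s root_section x))"
      if x: "x \<in> U \<inter> W" "x \<in> V'" for x
    proof -
      obtain V s where s: "(V, s) \<in> \<S>" "x \<in> V" using G_bundle_frame_ex[OF S, of x] by blast
      let ?f = "\<lambda>y. mscale (l y $ 1 $ 1) (coiso s y)"
      have f: "(V \<inter> U \<inter> W, ?f) \<in> FF" "x \<in> V \<inter> U \<inter> W" using coiso_FF[OF s(1) p(2)] s x by auto
      have eq: "(l y $ 1 $ 1)\<^sup>2 *s root_section y = wedge2 (?f y)" if "y \<in> V \<inter> U \<inter> W" for y
        using root_section_adapted[OF s(1) _ p(2)] that by blast
      have "wedge2 (?f x) = det (adj (f x) ** ?f x) *s wedge2 (f x)"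
        by (rule wedge2_change[OF q(2) x(2) FF_D(4)[OF f] FF_D(5)[OF f]])
      then have "(l x $ 1 $ 1)\<^sup>2 *s root_section x \<in> range ((*v) (columnvector (wedge2 (f x)) :: complex^1^('n \<times> 'n)))"
        unfolding eq[OF f(2)] range_columnvector by blast
      moreover have "smooth_at M x (\<lambda>y. (\<chi> i. det (adj (f y) ** ?f y)) :: complex^1)"
        by (rule smooth_at_vec, rule smooth_at_det_2, rule FF_transition[OF q(2) f(1) x(2) f(2)])
      then have "smooth_at M x (\<lambda>x. (adj (columnvector (wedge2 (f x))) :: complex^('n \<times> 'n)^1) *v ((l x $ 1 $ 1)\<^sup>2 *s root_section x))"
      proof (rule smooth_at_cong[rotated])
        show "\<forall>\<^sub>F y in nhds x. (\<chi> i. det (adj (f y) ** ?f y)) =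
            (adj (columnvector (wedge2 (f y))) :: complex^('n \<times> 'n)^1) *v ((l y $ 1 $ 1)\<^sup>2 *s root_section y)"
          using eventually_nhds_in_open[OF FF_D(1)[OF f(1)] f(2)]
          by eventually_elim (simp only: eq adj_columnvector hinner_wedge2)
      qed
      ultimately show ?thesis by blast
    qed
    have op: "open (U \<inter> W \<inter> V')" using G_bundleD(1)[OF L p(2)] W_open FF_D(1)[OF q(2)] by auto
    show "case q of (V, e) \<Rightarrow> (\<forall>x\<in>U \<inter> W \<inter> V. (l x $ 1 $ 1)\<^sup>2 *s root_section x \<in> range ((*v) (e x))) \<and>
                 smooth_map M (U \<inter> W \<inter> V) (\<lambda>x. adj (e x) *v ((l x $ 1 $ 1)\<^sup>2 *s root_section x))"
      unfolding q(1) prod.case smooth_map_iff[OF op] using * by blast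
  qed
  then show "case p of (U, n) \<Rightarrow> smooth_section M KK U (\<lambda>x. (n x $ 1 $ 1)\<^sup>2 *s root_section x)"
    unfolding p(1) by simp
qed

end

context root_setup
begin

section \<open>The parallel section of the square of \<open>L \<otimes> K\<^sup>-\<^sup>1\<^sup>/\<^sup>2\<close>\<close>

text \<open>The determinant of \<open>\<Phi>\<close> is a section of \<open>(L \<otimes> K\<^sup>-\<^sup>1\<^sup>/\<^sup>2)\<^sup>2\<close>, as \<open>S\<close> and \<open>\<Lambda>\<^sup>2\<close> of the \<open>SU(2)\<close>-bundle are
  trivialised. Divided by its norm it is a parallel unit section.\<close>

definition tau :: "'m \<Rightarrow> complex" where
  "tau x = det (adj (frame_at \<S> x x) ** \<Psi> x ** frame_at RR x x) * of_real (inverse (h2 x))"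

text \<open>A change of the frames \<open>s\<close> or \<open>h\<close> multiplies the determinant
  by that of a matrix in SU(2), which is one.\<close>

lemma tau_eq:
  assumes s: "(V, s) \<in> \<S>" "x \<in> V" and h: "(U, h) \<in> RR" "x \<in> U"
  shows "tau x = det (adj (s x) ** \<Psi> x ** h x) * of_real (inverse (h2 x))"
proof -
  define s' where "s' = frame_at \<S> x"
  obtain V' where s': "(V', s') \<in> \<S>" "x \<in> V'" using frame_atE[OF S UNIV_I] unfolding s'_def .
  have xW: "x \<in> W" using RR_D(2)[OF h(1)] h(2) by auto
  define h' where "h' = frame_at RR x"
  obtain U' where h': "(U', h') \<in> RR" "x \<in> U'" using frame_atE[OF RR_bundle xW] unfolding h'_def .
  define m where "m = adj (s' x) ** s x"
  define k where "k = adj (h' x) ** h x"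
  have m: "det m = 1" "s x = s' x ** m"
    using G_bundle_transition(2)[OF S s'(1) s(1) s'(2) s(2)]
      isometry_transition(2)[OF G_bundleD(3)[OF S s'] G_bundleD(3)[OF S s] G_bundle_transition(1)[OF S s(1) s'(1) s(2) s'(2)]]
    by (auto simp: m_def SU_group_def)
  have k: "det k = 1" "h x = h' x ** k"
    using G_bundle_transition(2)[OF RR_bundle h'(1) h(1) h'(2) h(2)]
      isometry_transition(2)[OF RR_D(3)[OF h'] RR_D(3)[OF h] G_bundle_transition(1)[OF RR_bundle h(1) h'(1) h(2) h'(2)]]
    by (auto simp: k_def SU_group_def)
  have "adj (s x) ** \<Psi> x ** h x = adj m ** (adj (s' x) ** \<Psi> x ** h' x) ** k"
    unfolding m(2) k(2) by (simp add: adj_mult matrix_mul_assoc)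
  then have "det (adj (s x) ** \<Psi> x ** h x) = det (adj (s' x) ** \<Psi> x ** h' x)"
    by (simp add: det_mul det_adj_2 m(1) k(1))
  then show ?thesis by (simp add: tau_def s'_def h'_def)
qed

text \<open>The matrices have size 2, so the scalar by which the two expressions differ enters
  squared.\<close>

lemma tau_twist:
  assumes s: "(V, s) \<in> \<S>" "x \<in> V" and h: "(U, h) \<in> RR" "x \<in> U"
  shows "det (twist s l (\<lambda>y. mscale (n y $ 1 $ 1) (h y)) x) * of_real (inverse (h2 x))
    = (cnj (cnj (n x $ 1 $ 1) * l x $ 1 $ 1))\<^sup>2 * tau x"
proof -
  have "twist s l (\<lambda>y. mscale (n y $ 1 $ 1) (h y)) x
      = mscale (cnj (cnj (n x $ 1 $ 1) * l x $ 1 $ 1)) (adj (s x) ** \<Psi> x ** h x)"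
    by (simp add: twist_def mscale_mult_right mscale_mscale mult.commute)
  then show ?thesis by (simp add: det_mscale_2 tau_eq[OF assms])
qed

lemma RR_FF:
  assumes "(U, h) \<in> RR" "(V, n) \<in> \<N>"
  shows "(U \<inter> V, \<lambda>y. mscale (n y $ 1 $ 1) (h y)) \<in> FF"
  using RR_adapted[OF assms] by (simp add: adapted_def)

text \<open>With \<open>m\<close> the matrix of \<Psi>, taking determinants in the identity for
  \<open>adj m ** m\<close> shows that \<open>det m\<close> has norm \<open>h2\<close>; the frames
  contribute unit factors.\<close>

lemma tau_unit:
  assumes x: "x \<in> W"
  shows "cnj (tau x) * tau x = 1"
proof -
  obtain V s where s: "(V, s) \<in> \<S>" "x \<in> V" using G_bundle_frame_ex[OF S] by blast
  obtain U l where l: "(U, l) \<in> \<L>" "x \<in> U" using G_bundle_frame_ex[OF L] by blast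
  obtain V' n where n: "(V', n) \<in> \<N>" "x \<in> V'" by (rule G_bundle_frame_ex[OF N x])
  obtain U' h where h: "(U', h) \<in> RR" "x \<in> U'" by (rule RR_ex[OF x])
  let ?f = "\<lambda>y. mscale (n y $ 1 $ 1) (h y)"
  have f: "(U' \<inter> V', ?f) \<in> FF" "x \<in> U' \<inter> V'" using RR_FF[OF h(1) n(1)] h n by auto
  have h0: "h2 x > 0" using x h2_pos by simp
  define d where "d = det (twist s l ?f x)"
  define u where "u = cnj (cnj (n x $ 1 $ 1) * l x $ 1 $ 1)"
  have "cnj d * d = (of_real (h2 x))\<^sup>2"
    using arg_cong[OF twist_adj(2)[OF s l f], of det] by (simp add: det_mul det_adj_2 det_mscale_2 d_def)
  moreover have "cnj u * u = (cnj (n x $ 1 $ 1) * n x $ 1 $ 1) * (cnj (l x $ 1 $ 1) * l x $ 1 $ 1)"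
    by (simp add: u_def ac_simps)
  then have "cnj u * u = 1"
    using frame_1_unit(1)[OF G_bundleD(3)[OF N n]] frame_1_unit(1)[OF G_bundleD(3)[OF L l]] by simp
  moreover have "d * of_real (inverse (h2 x)) = u\<^sup>2 * tau x"
    unfolding d_def u_def by (rule tau_twist[OF s h])
  then have "cnj (d * of_real (inverse (h2 x))) * (d * of_real (inverse (h2 x))) = (cnj u * u)\<^sup>2 * (cnj (tau x) * tau x)"
    by (simp add: power2_eq_square ac_simps)
  moreover have "cnj (d * of_real (inverse (h2 x))) * (d * of_real (inverse (h2 x))) = (cnj d * d) / (of_real (h2 x))\<^sup>2"
    by (simp add: power2_eq_square divide_inverse ac_simps)
  ultimately show ?thesis using h0 by simp
qed

text \<open>The coefficient of the section \<open>tau\<close> of the squared line with respect to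
  \<open>e \<otimes> e\<close>; for a unit frame the inverse of \<open>e\<close> is its
  conjugate.\<close>

definition gtau where "gtau e y = (cnj (e y $ 1 $ 1))\<^sup>2 * tau y" for e :: "'m \<Rightarrow> complex^1^1"

text \<open>The form on the twisted line is that of \<open>A\<close> minus half the trace over F,
  and twice this form governs the normalised determinant of \<Psi>: the section with coefficient
  \<open>gtau\<close> is parallel.\<close>

lemma gtau_frame:
  assumes e: "(T, e) \<in> L'" "x \<in> T"
  shows "smooth_at M x (gtau e)" "mderiv M (gtau e) x v = - 2 * conn_form A' e x v $ 1 $ 1 * gtau e x"
    "cnj (gtau e x) * gtau e x = 1"
proof -
  obtain U l V n where *: "(U, l) \<in> \<L>" "(V, n) \<in> \<N>" "T = U \<inter> W \<inter> V" "e = (\<lambda>x. mscale (cnj (n x $ 1 $ 1)) (l x))"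
    by (rule L'_E[OF e(1)]) (rule that)
  have x: "x \<in> U" "x \<in> V" "x \<in> W" using e * by auto
  obtain V' s \<epsilon> where s: "spin_frame_at M x = (s, \<epsilon>)" "(V', s, \<epsilon>) \<in> spin_frames M" "x \<in> V'" "(V', s) \<in> \<S>"
    by (rule spin_frame_atE)
  obtain U' h where h: "(U', h) \<in> RR" "x \<in> U'" by (rule RR_ex[OF x(3)])
  let ?f = "\<lambda>y. mscale (n y $ 1 $ 1) (h y)"
  have f: "(U' \<inter> V, ?f) \<in> FF" "x \<in> U' \<inter> V" using RR_FF[OF h(1) *(2)] h x by auto
  have ad: "adapted (U' \<inter> V) n ?f" by (rule RR_adapted[OF h(1) *(2)])
  have ev: "\<forall>\<^sub>F y in nhds x. det (twist s l ?f y) * of_real (inverse (h2 y)) = gtau e y"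
    using G_bundle_near[OF S s(4) s(3)] eventually_nhds_in_open[OF RR_D(1)[OF h(1)] h(2)]
  proof eventually_elim
    case (elim y)
    show ?case unfolding gtau_def *(4) mscale_nth by (rule tau_twist[OF s(4) elim(1) h(1) elim(2)])
  qed
  note d = det_twist_derivative[OF s(1,2,3) *(1) x(1) f]
  show "smooth_at M x (gtau e)" by (rule smooth_at_cong[OF ev d(1)])
  have ce: "conn_form A' e x v $ 1 $ 1 = conn_form A l x v $ 1 $ 1 - trace (conn_form BF ?f x v) / 2"
    using line_frame(2)[OF *(1) x(1) *(2) x(2) ad f(2)] by (simp add: *(4) mscale_nth)
  have "mderiv M (gtau e) x v = - (2 * conn_form A l x v $ 1 $ 1 - trace (conn_form BF ?f x v)) * gtau e x"
    using d(2)[of v] unfolding mderiv_cong[OF ev] eventually_nhds_x_imp_x[OF ev] .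
  then show "mderiv M (gtau e) x v = - 2 * conn_form A' e x v $ 1 $ 1 * gtau e x"
    unfolding ce by (simp add: algebra_simps)
  have "cnj (gtau e x) * gtau e x = (cnj (e x $ 1 $ 1) * e x $ 1 $ 1)\<^sup>2 * (cnj (tau x) * tau x)"
    by (simp add: gtau_def power2_eq_square ac_simps)
  then show "cnj (gtau e x) * gtau e x = 1"
    using frame_1_unit(1)[OF G_bundleD(3)[OF L'_bundle e]] tau_unit[OF x(3)] by simp
qed

text \<open>As \<open>gtau\<close> is the coefficient of a parallel section of the square, the
  connection form is minus half its logarithmic derivative. The form is thereby expressed through
  one scalar function, from which the curvature is computed.\<close>

lemma line_section_derivative:
  assumes e: "(T, e) \<in> L'" "y \<in> T" and k: "smooth_at M y k" and s: "\<forall>\<^sub>F z in nhds y. s z = e z *v (\<chi> i. k z)"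
  shows "A' s y v = e y *v (\<chi> i. mderiv M k y v + - mderiv M (gtau e) y v * inverse (2 * gtau e y) * k y)"
proof -
  have sk: "smooth_at M y (\<lambda>z. (\<chi> i. k z) :: complex^1)" by (intro smooth_at_vec k)
  have "A' s y v = e y *v (mderiv M (\<lambda>z. (\<chi> i. k z) :: complex^1) y v + conn_form A' e y v *v (\<chi> i. k y))"
    by (rule cov_atD[OF connectionD(1)[OF L'_bundle e(1) line_connection e(2)] sk s])
  moreover have "mderiv M (\<lambda>z. (\<chi> i. k z) :: complex^1) y v $ 1 = mderiv M k y v"
    using mderiv_nth[OF sk, of 1 v] by simp
  moreover have "gtau e y \<noteq> 0" using gtau_frame(3)[OF e] by auto
  then have "- mderiv M (gtau e) y v * inverse (2 * gtau e y) = conn_form A' e y v $ 1 $ 1"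
    unfolding gtau_frame(2)[OF e] by (simp add: field_simps)
  ultimately show ?thesis by (simp add: vec_eq_iff forall_1 matrix_1_vector distrib_left mult.assoc)
qed

text \<open>A logarithmic derivative is closed, so a line bundle connection with such a form has no
  curvature. Closedness appears as the bracket identity for derivatives of \<open>gtau\<close>; the
  same identity for the coefficient of \<open>s\<close> removes its second derivatives.\<close>

lemma line_flat: "flat_conn M W L' A'"
  unfolding flat_conn_def
proof safe
  fix U X Y s x
  assume U: "open U" "U \<subseteq> W" and X: "smooth_vector_field M U X" and Y: "smooth_vector_field M U Y"
    and s: "smooth_section M L' U s" and x: "x \<in> U"
  obtain T e where e: "(T, e) \<in> L'" "x \<in> T" using G_bundle_frame_ex[OF L'_bundle, of x] U x by blast
  note op = G_bundleD(1)[OF L'_bundle e(1)] and iso = G_bundleD(3)[OF L'_bundle e(1)]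
  define c where "c y = (adj (e y) *v s y) $ 1" for y
  define g where "g = gtau e"
  have sec: "\<And>y. y \<in> U \<inter> T \<Longrightarrow> s y \<in> range ((*v) (e y))" "smooth_map M (U \<inter> T) (\<lambda>y. adj (e y) *v s y)"
    using s e(1) by (auto simp: smooth_section_def)
  have opUT: "open (U \<inter> T)" using U op by auto
  have c: "smooth_at M y c" if "y \<in> U \<inter> T" for y
    using sec(2) that smooth_map_iff[OF opUT] unfolding c_def[abs_def] by (intro smooth_at_nth) blast
  have g: "smooth_at M y g" "g y \<noteq> 0" if "y \<in> U \<inter> T" for y
    using gtau_frame(1)[OF e(1), of y] gtau_frame(3)[OF e(1), of y] that by (auto simp: g_def)
  have se: "s y = e y *v (\<chi> i. c y)" if "y \<in> U \<inter> T" for y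
  proof -
    have "(\<chi> i. c y) = adj (e y) *v s y" by (simp add: vec_eq_iff forall_1 c_def)
    then show ?thesis using isometry_range[OF iso sec(1)] that by auto
  qed
  define \<alpha> where "\<alpha> v y = - mderiv M g y v * inverse (2 * g y)" for v y
  have D1: "A' s y v = e y *v (\<chi> i. mderiv M c y v + \<alpha> v y * c y)" if y: "y \<in> U \<inter> T" for y v
    unfolding \<alpha>_def g_def
    by (rule line_section_derivative[OF e(1) _ c[OF y]])
      (use y se eventually_nhds_in_open[OF opUT y] in \<open>auto elim!: eventually_mono\<close>)
  note xUT = IntI[OF x e(2)]
  note cx = c[OF xUT] and gx = g[OF xUT]
  have s2: "smooth_at M x (\<lambda>y. 2 * g y)" by (intro smooth_at_bilinear[OF bounded_bilinear_mult] smooth_at_const gx)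
  have s2': "smooth_at M x (\<lambda>y. inverse (2 * g y))" by (rule smooth_at_inverse[OF s2]) (use gx in simp)
  have d2: "mderiv M (\<lambda>y. inverse (2 * g y)) x v = - (2 * mderiv M g x v) / (2 * g x)\<^sup>2" for v
    using mderiv_inverse[OF s2] gx(2) mderiv_mult[OF smooth_at_const gx(1)] by (simp add: mderiv_const)
  have second: "smooth_at M x (\<lambda>y. mderiv M c y (Z y) + \<alpha> (Z y) y * c y)"
    "mderiv M (\<lambda>y. mderiv M c y (Z y) + \<alpha> (Z y) y * c y) x v
      = mderiv M (\<lambda>y. mderiv M c y (Z y)) x v
      + (- mderiv M g x (Z x) * inverse (2 * g x)) * mderiv M c x v
      + (- mderiv M g x (Z x) * (- (2 * mderiv M g x v) / (2 * g x)\<^sup>2)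
         + - mderiv M (\<lambda>y. mderiv M g y (Z y)) x v * inverse (2 * g x)) * c x"
    if Z: "smooth_vector_field M U Z" for Z v
  proof -
    note sc = smooth_at_mderiv_field[OF Z U(1) x cx] and sg = smooth_at_mderiv_field[OF Z U(1) x gx(1)]
    have sg': "smooth_at M x (\<lambda>y. - mderiv M g y (Z y))" by (intro smooth_intros sg)
    have sa: "smooth_at M x (\<lambda>y. - mderiv M g y (Z y) * inverse (2 * g y))"
      by (rule smooth_at_bilinear[OF bounded_bilinear_mult sg' s2'])
    have sac: "smooth_at M x (\<lambda>y. - mderiv M g y (Z y) * inverse (2 * g y) * c y)"
      by (rule smooth_at_bilinear[OF bounded_bilinear_mult sa cx])
    show "smooth_at M x (\<lambda>y. mderiv M c y (Z y) + \<alpha> (Z y) y * c y)"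
      unfolding \<alpha>_def by (rule smooth_at_add[OF sc sac])
    show "mderiv M (\<lambda>y. mderiv M c y (Z y) + \<alpha> (Z y) y * c y) x v
      = mderiv M (\<lambda>y. mderiv M c y (Z y)) x v
      + (- mderiv M g x (Z x) * inverse (2 * g x)) * mderiv M c x v
      + (- mderiv M g x (Z x) * (- (2 * mderiv M g x v) / (2 * g x)\<^sup>2)
         + - mderiv M (\<lambda>y. mderiv M g y (Z y)) x v * inverse (2 * g x)) * c x"
      unfolding \<alpha>_def mderiv_add[OF sc sac] mderiv_mult[OF sa cx] mderiv_mult[OF sg' s2'] mderiv_minus[OF sg] d2 by simp
  qed
  have D2: "A' (\<lambda>y. A' s y (Z y)) x v = e x *v (\<chi> i. mderiv M (\<lambda>y. mderiv M c y (Z y) + \<alpha> (Z y) y * c y) x v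
      + \<alpha> v x * (mderiv M c x (Z x) + \<alpha> (Z x) x * c x))" if Z: "smooth_vector_field M U Z" for Z v
    unfolding \<alpha>_def[of v] g_def
    by (rule line_section_derivative[OF e second(1)[OF Z]])
      (use D1 eventually_nhds_in_open[OF opUT xUT] in \<open>auto elim!: eventually_mono\<close>)
  have LBc: "mderiv M c x (lie_bracket M X Y x)
      = mderiv M (\<lambda>y. mderiv M c y (Y y)) x (X x) - mderiv M (\<lambda>y. mderiv M c y (X y)) x (Y x)"
    using mderiv_lie_bracket[OF X Y U(1) x cx] by simp
  have LBg: "mderiv M g x (lie_bracket M X Y x)
      = mderiv M (\<lambda>y. mderiv M g y (Y y)) x (X x) - mderiv M (\<lambda>y. mderiv M g y (X y)) x (Y x)"
    using mderiv_lie_bracket[OF X Y U(1) x gx(1)] by simp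
  have "curvature M A' X Y s x = e x *v (\<chi> i.
      (mderiv M (\<lambda>y. mderiv M c y (Y y) + \<alpha> (Y y) y * c y) x (X x) + \<alpha> (X x) x * (mderiv M c x (Y x) + \<alpha> (Y x) x * c x))
      - (mderiv M (\<lambda>y. mderiv M c y (X y) + \<alpha> (X y) y * c y) x (Y x) + \<alpha> (Y x) x * (mderiv M c x (X x) + \<alpha> (X x) x * c x))
      - (mderiv M c x (lie_bracket M X Y x) + \<alpha> (lie_bracket M X Y x) x * c x))"
    unfolding curvature_def D2[OF Y] D2[OF X] D1[OF xUT]
    by (simp add: vec_eq_iff forall_1 matrix_1_vector algebra_simps)
  \<comment> \<open>What is left besides the bracket terms is symmetric in \<open>X\<close> and
    \<open>Y\<close>.\<close>
  also have "\<dots> = e x *v (\<chi> i. 0)"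
    unfolding second(2)[OF X] second(2)[OF Y] LBc unfolding \<alpha>_def LBg by (simp add: algebra_simps)
  finally show "curvature M A' X Y s x = 0" by (simp add: vec_eq_iff forall_1 matrix_1_vector)
qed

text \<open>Along a curve the square of a parallel section, divided by the parallel unit section
  \<open>tau\<close>, is constant; a closed loop therefore leaves the square unchanged.\<close>

lemma line_holonomies: "holonomies M W L' A' \<subseteq> {1, -1}"
proof
  fix z assume "z \<in> holonomies M W L' A'"
  then obtain T c s where c: "piecewise_C1_curve M T c" "c ` {0..1} \<subseteq> W" "c 0 = c 1"
    and s: "parallel_along M L' A' T c s" "s 0 \<noteq> 0" "s 1 = z *s s 0"
    by (auto simp: holonomies_def)
  have cc: "continuous_on {0..1} c" and fin: "finite T" using c(1) by (auto simp: piecewise_C1_curve_def)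
  \<comment> \<open>\<open>cnj (tau (c t))\<close> is the inverse of the unit number
    \<open>tau (c t)\<close>, so \<open>q\<close> is a quotient of two parallel sections of the
    squared line.\<close>
  define q where "q t = cnj (tau (c t)) * (s t $ 1)\<^sup>2" for t
  \<comment> \<open>In a frame the unit factors cancel. This expresses \<open>q\<close> through
    continuous coefficients, although \<open>tau\<close> and \<open>s\<close> need not be continuous
    as complex functions.\<close>
  have q: "q t = cnj (gtau e (c t)) * ((adj (e (c t)) *v s t) $ 1)\<^sup>2" if e: "(U, e) \<in> L'" "c t \<in> U" for U e t
  proof -
    have "cnj (gtau e (c t)) * ((adj (e (c t)) *v s t) $ 1)\<^sup>2
        = (cnj (e (c t) $ 1 $ 1) * e (c t) $ 1 $ 1)\<^sup>2 * (cnj (tau (c t)) * (s t $ 1)\<^sup>2)"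
      by (simp add: gtau_def matrix_1_vector adj_nth power2_eq_square ac_simps)
    then show ?thesis using frame_1_unit(1)[OF G_bundleD(3)[OF L'_bundle e]] by (simp add: q_def)
  qed
  have par: "continuous_on {t \<in> {0..1}. c t \<in> U} (\<lambda>t. adj (e (c t)) *v s t)"
    "\<And>t. t \<in> {0<..<1} - T \<Longrightarrow> c t \<in> U \<Longrightarrow> ((\<lambda>t. adj (e (c t)) *v s t) has_vector_derivative
       - (conn_form A' e (c t) (velocity M c t) *v (adj (e (c t)) *v s t))) (at t)" if "(U, e) \<in> L'" for U e
    using s(1) that by (auto simp: parallel_along_def)
  have ex: "\<exists>U e. (U, e) \<in> L' \<and> c t \<in> U" if "t \<in> {0..1}" for t
    using G_bundle_frame_ex[OF L'_bundle, of "c t"] c(2) that by blast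
  have cont: "continuous_on {0..1} q"
    unfolding continuous_on_eq_continuous_within
  proof
    fix t :: real assume t: "t \<in> {0..1}"
    obtain U e where e: "(U, e) \<in> L'" "c t \<in> U" using ex[OF t] by blast
    note op = G_bundleD(1)[OF L'_bundle e(1)]
    obtain O' where O': "open O'" "O' \<inter> {0..1} = c -` U \<inter> {0..1}"
      using cc[unfolded continuous_on_open_invariant, rule_format, OF op] by auto
    have "continuous_on U (gtau e)"
      by (rule continuous_at_imp_continuous_on) (auto intro: smooth_at_isCont gtau_frame(1)[OF e(1)])
    moreover have "continuous_on {t \<in> {0..1}. c t \<in> U} c" using cc by (rule continuous_on_subset) auto
    ultimately have "continuous_on {t \<in> {0..1}. c t \<in> U} (\<lambda>t. gtau e (c t))"
      by (rule continuous_on_compose2) auto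
    then have "continuous_on {t \<in> {0..1}. c t \<in> U} (\<lambda>t. cnj (gtau e (c t)) * ((adj (e (c t)) *v s t) $ 1)\<^sup>2)"
      by (intro continuous_intros par(1)[OF e(1)])
    then have "continuous_on {t \<in> {0..1}. c t \<in> U} q"
      by (rule continuous_on_eq) (use q[OF e(1)] in auto)
    moreover have "{t \<in> {0..1}. c t \<in> U} = {0..1} \<inter> O'"
    proof -
      have "{t \<in> {0..1}. c t \<in> U} = c -` U \<inter> {0..1}" by blast
      then show ?thesis unfolding O'(2)[symmetric] by (simp only: Int_commute)
    qed
    moreover have tO: "t \<in> O'"
    proof -
      have "t \<in> O' \<inter> {0..1}" unfolding O'(2) using t e(2) by simp
      then show ?thesis by (rule IntD1)
    qed
    ultimately have "continuous (at t within ({0..1} \<inter> O')) q"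
      using t e(2) by (simp add: continuous_on_eq_continuous_within)
    moreover have "at t within ({0..1} \<inter> O') = at t within {0..1}"
      by (rule at_within_nhd[OF tO O'(1)]) auto
    ultimately show "continuous (at t within {0..1}) q" by simp
  qed
  have der: "(q has_derivative (\<lambda>h. 0)) (at t within {0..1})" if t: "t \<in> {0..1} - (T \<union> {0, 1})" for t
  proof -
    have t': "t \<in> {0<..<1} - T" using t by auto
    obtain U e where e: "(U, e) \<in> L'" "c t \<in> U" using ex[of t] t by auto
    note op = G_bundleD(1)[OF L'_bundle e(1)]
    define \<theta> where "\<theta> = conn_form A' e (c t) (velocity M c t) $ 1 $ 1"
    define w where "w t = (adj (e (c t)) *v s t) $ 1" for t
    \<comment> \<open>The connection is unitary; this sign makes the two contributions to the
      derivative of \<open>q\<close> cancel.\<close>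
    have th: "cnj \<theta> = - \<theta>"
    proof -
      have "adj (conn_form A' e (c t) v) = - conn_form A' e (c t) v" for v
        using connectionD(3)[OF L'_bundle e(1) line_connection e(2), of v] by (simp add: u_alg_def)
      from arg_cong[OF this, of "\<lambda>z. z $ 1 $ 1"] show ?thesis by (simp add: adj_nth \<theta>_def)
    qed
    have "((\<lambda>t. (adj (e (c t)) *v s t) $ 1) has_vector_derivative
        (- (conn_form A' e (c t) (velocity M c t) *v (adj (e (c t)) *v s t))) $ 1) (at t)"
      by (rule bounded_linear.has_vector_derivative[OF bounded_linear_vec_nth par(2)[OF e(1) t' e(2)]])
    then have dw: "(w has_vector_derivative (- \<theta> * w t)) (at t)"
      by (simp add: w_def[abs_def] \<theta>_def matrix_1_vector mult.assoc)
    have "((\<lambda>t. cnj (gtau e (c t))) has_vector_derivative cnj (mderiv M (gtau e) (c t) (velocity M c t))) (at t)"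
      by (rule bounded_linear.has_vector_derivative[OF bounded_linear_cnj
            has_vector_derivative_along_curve[OF c(1) t' gtau_frame(1)[OF e]]])
    then have dg: "((\<lambda>t. cnj (gtau e (c t))) has_vector_derivative (2 * \<theta> * cnj (gtau e (c t)))) (at t)"
      unfolding gtau_frame(2)[OF e] \<theta>_def[symmetric] by (simp add: th)
    have dq: "((\<lambda>t. cnj (gtau e (c t)) * (w t * w t)) has_vector_derivative 0) (at t)"
      using has_vector_derivative_mult[OF dg has_vector_derivative_mult[OF dw dw]] by (simp add: algebra_simps)
    have "open ({0<..<1} \<inter> c -` U)"
      by (intro continuous_open_preimage op continuous_on_subset[OF cc]) auto
    then have "(q has_vector_derivative 0) (at t)"
      by (rule has_vector_derivative_transform_within_open[OF dq])
        (use t' e q[OF e(1)] in \<open>auto simp: w_def power2_eq_square\<close>)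
    then show ?thesis by (simp add: has_vector_derivative_def has_derivative_at_withinI)
  qed
  \<comment> \<open>Zero derivative off a finite set together with continuity on the closed interval
    takes care of the corners and the endpoints of the curve.\<close>
  have "q 1 = q 0"
    by (rule has_derivative_zero_unique_strong_interval[of "T \<union> {0, 1}" 0 1 q "q 0"]) (use fin cont der in auto)
  then have eq: "cnj (tau (c 0)) * (z * s 0 $ 1)\<^sup>2 = cnj (tau (c 0)) * (s 0 $ 1)\<^sup>2"
    unfolding q_def c(3)[symmetric] s(3) by simp
  have "c 0 \<in> W" using c(2) by (rule subsetD) simp
  then have "tau (c 0) \<noteq> 0" using tau_unit[of "c 0"] by auto
  moreover have "s 0 $ 1 \<noteq> 0" using s(2) by (auto simp: vec_eq_iff forall_1)
  ultimately have "z\<^sup>2 = 1" using eq by (simp add: power_mult_distrib)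
  then show "z \<in> {1, -1}" by (simp add: power2_eq_1_iff)
qed

section \<open>The induced solution\<close>

text \<open>Homomorphisms are matrices that vanish on the orthogonal complement of their domain, and
  the twisting line has fibre \<open>\<complex>\<close>; so restricting \<Psi> to F and twisting
  leaves the matrix as it is.\<close>

lemma Phi_eq: "x \<in> W \<Longrightarrow> induced_section FF \<Psi> x = \<Psi> x"
proof -
  assume "x \<in> W"
  then obtain U f where f: "(U, f) \<in> FF" "x \<in> U" by (rule FF_frame_ex)
  show ?thesis using FF_proj[OF f] FF_Psi[OF f] by (simp add: induced_section_def matrix_mul_assoc)
qed

lemma proj_RR: "(U, h) \<in> RR \<Longrightarrow> x \<in> U \<Longrightarrow> \<Psi> x ** (h x ** adj (h x)) = \<Psi> x"
proof -
  assume h: "(U, h) \<in> RR" "x \<in> U"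
  have "x \<in> W" using RR_D(2)[OF h(1)] h(2) by auto
  then obtain V f where f: "(V, f) \<in> FF" "x \<in> V" by (rule FF_frame_ex)
  have "f x ** adj (f x) = h x ** adj (h x)"
    by (rule isometry_transition(3)[OF FF_D(4)[OF f] RR_D(3)[OF h]]) (simp add: FF_D(5)[OF f] RR_D(4)[OF h])
  then show ?thesis using FF_Psi[OF f] by (simp add: matrix_mul_assoc[symmetric])
qed

text \<open>The twists of source and target cancel: in frames of the twisted bundles \<Phi> has the
  matrix that \<Psi> has in frames of F and \<open>s \<otimes> l\<close>.\<close>

lemma Phi_smooth_hom: "smooth_hom M W RR (tensor_line \<S> L') (induced_section FF \<Psi>)"
  unfolding smooth_hom_def
proof (intro conjI ballI)
  fix x assume x: "x \<in> W"
  obtain V s where s: "(V, s) \<in> \<S>" "x \<in> V" using G_bundle_frame_ex[OF S] by blast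
  obtain T e where e: "(T, e) \<in> L'" "x \<in> T" by (rule G_bundle_frame_ex[OF L'_bundle x])
  have "(V \<inter> T, \<lambda>x. mscale (e x $ 1 $ 1) (s x)) \<in> tensor_line \<S> L'" by (rule tensor_lineI[OF s(1) e(1)])
  then obtain Q where Q: "(Q, frame_at (tensor_line \<S> L') x) \<in> tensor_line \<S> L'" "x \<in> Q"
    by (rule frame_at_mem) (use s e in auto)
  obtain V' s' T' e' where t: "(V', s') \<in> \<S>" "(T', e') \<in> L'" "Q = V' \<inter> T'"
      "frame_at (tensor_line \<S> L') x = (\<lambda>x. mscale (e' x $ 1 $ 1) (s' x))"
    by (rule tensor_lineE[OF Q(1)]) (rule that)
  have "adj (mscale (e' x $ 1 $ 1) (s' x)) ** mscale (e' x $ 1 $ 1) (s' x) = mat 1"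
    using Q(2) t by (intro tensor_frame_isometry G_bundleD(3)[OF S t(1)] G_bundleD(3)[OF L'_bundle t(2)]) auto
  then have P: "fibre_proj (tensor_line \<S> L') x = mat 1" by (simp add: fibre_proj_def t(4) isometry_square)
  obtain U h where h: "(U, h) \<in> RR" "x \<in> U" by (rule RR_ex[OF x])
  show "induced_section FF \<Psi> x = fibre_proj (tensor_line \<S> L') x ** induced_section FF \<Psi> x ** fibre_proj RR x"
    unfolding P Phi_eq[OF x] fibre_eq(2)[OF RR_bundle h] by (simp add: proj_RR[OF h])
next
  have smooth: "smooth_map M (W \<inter> U \<inter> Q) (\<lambda>x. adj (t x) ** induced_section FF \<Psi> x ** h x)"
    if h: "(U, h) \<in> RR" and q: "(Q, t) \<in> tensor_line \<S> L'" for U h Q t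
  proof -
    obtain V s T e where t: "(V, s) \<in> \<S>" "(T, e) \<in> L'" "Q = V \<inter> T" "t = (\<lambda>x. mscale (e x $ 1 $ 1) (s x))"
      by (rule tensor_lineE[OF q]) (rule that)
    obtain U' l V' n where *: "(U', l) \<in> \<L>" "(V', n) \<in> \<N>" "T = U' \<inter> W \<inter> V'" "e = (\<lambda>x. mscale (cnj (n x $ 1 $ 1)) (l x))"
      by (rule L'_E[OF t(2)]) (rule that)
    let ?f = "\<lambda>y. mscale (n y $ 1 $ 1) (h y)"
    have eq: "twist s l ?f y = adj (t y) ** induced_section FF \<Psi> y ** h y" if "y \<in> W" for y
      unfolding Phi_eq[OF that]
      by (simp add: twist_def t(4) *(4) adj_mscale mscale_nth mscale_mult_left mscale_mult_right mscale_mscale mult.commute)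
    have op: "open (W \<inter> U \<inter> Q)"
      using W_open RR_D(1)[OF h] t(3) G_bundleD(1)[OF S t(1)] G_bundleD(1)[OF L'_bundle t(2)] by auto
    have "smooth_at M x (\<lambda>x. adj (t x) ** induced_section FF \<Psi> x ** h x)" if x: "x \<in> W \<inter> U \<inter> Q" for x
    proof (rule smooth_at_cong)
      show "smooth_at M x (twist s l ?f)"
        by (rule smooth_twist[OF t(1) _ *(1) _ RR_FF[OF h *(2)]]) (use x t(3) *(3) in auto)
      show "\<forall>\<^sub>F y in nhds x. twist s l ?f y = adj (t y) ** induced_section FF \<Psi> y ** h y"
        using eventually_nhds_in_open[OF op x] by eventually_elim (simp add: eq)
    qed
    then show ?thesis using smooth_map_iff[OF op] by blast
  qed
  fix p assume "p \<in> RR"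
  then show "case p of (U, e) \<Rightarrow> \<forall>(V, t)\<in>tensor_line \<S> L'.
      smooth_map M (W \<inter> U \<inter> V) (\<lambda>x. adj (t x) ** induced_section FF \<Psi> x ** e x)"
    using smooth by (cases p) (auto split: prod.splits)
qed

text \<open>Source and target are both twisted by the dual square root, whose form is minus half the
  trace over F. In the derivative of a homomorphism the two scalar terms cancel, which leaves the
  derivative for the untwisted bundles.\<close>

lemma hom_conn_RR:
  assumes x: "x \<in> W" and sf: "spin_frame_at M x = (s, \<epsilon>)" and s: "(V, s) \<in> \<S>" "x \<in> V"
    and l: "(U, l) \<in> \<L>" "x \<in> U" and n: "(V', n) \<in> \<N>" "x \<in> V'"
  shows "hom_conn RR BF' (tensor_conn L' (spin_conn M) A') (induced_section FF \<Psi>) x v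
    = mscale (cnj (n x $ 1 $ 1) * l x $ 1 $ 1)
        (s x ** twist_deriv s l (\<lambda>y. mscale (n y $ 1 $ 1) (frame_at RR x y)) x v ** adj (frame_at RR x x))"
proof -
  define h where "h = frame_at RR x"
  obtain Q where h: "(Q, h) \<in> RR" "x \<in> Q" using frame_atE[OF RR_bundle x] unfolding h_def .
  let ?f = "\<lambda>y. mscale (n y $ 1 $ 1) (h y)"
  have f: "(Q \<inter> V', ?f) \<in> FF" "x \<in> Q \<inter> V'" using RR_FF[OF h(1) n(1)] h n by auto
  have ad: "adapted (Q \<inter> V') n ?f" by (rule RR_adapted[OF h(1) n(1)])
  define e where "e y = mscale (cnj (n y $ 1 $ 1)) (l y)" for y
  have e: "(U \<inter> W \<inter> V', e) \<in> L'" "x \<in> U \<inter> W \<inter> V'"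
    using L'_mem[OF l(1) n(1)] l n x by (auto simp: e_def[abs_def])
  have e11: "e y $ 1 $ 1 = cnj (n y $ 1 $ 1) * l y $ 1 $ 1" for y by (simp add: e_def mscale_nth)
  define t where "t y = mscale (e y $ 1 $ 1) (s y)" for y
  define T' where "T' = tensor_conn L' (spin_conn M) A'"
  note tc = tensor_conn_cov[OF L'_bundle e connectionD(1)[OF L'_bundle e(1) line_connection e(2)]
      spin_conn_frame(1)[OF sf s] G_bundleD(3)[OF S s], folded T'_def t_def[abs_def]]
  let ?m = "twist s l ?f"
  have sm: "smooth_at M x ?m" by (rule smooth_twist[OF s l f])
  define a where "a = conn_form BF ?f x v"
  define \<theta> where "\<theta> = conn_form A l x v $ 1 $ 1"
  define \<Omega> where "\<Omega> = conn_form (spin_conn M) s x v"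
  have ce: "conn_form A' e x v $ 1 $ 1 = \<theta> - trace a / 2"
    using line_frame(2)[OF l n ad f(2), of v] by (simp add: e_def[abs_def] \<theta>_def a_def mscale_nth)
  have ch: "conn_form BF' h x v = a - mscale (trace a / 2) (mat 1)" unfolding a_def by (rule ring_frame(2)[OF h n])
  have fr: "induced_section FF \<Psi> y ** h y = t y ** ?m y" if "y \<in> W" "y \<in> V" "y \<in> U" "y \<in> V'" for y
  proof -
    have "t y ** ?m y = mscale (cnj (n y $ 1 $ 1)) (mscale (l y $ 1 $ 1) (s y) ** ?m y)"
      by (simp add: t_def e11 mscale_mult_left mscale_mscale)
    also have "\<dots> = mscale (cnj (n y $ 1 $ 1) * n y $ 1 $ 1) (\<Psi> y ** h y)"
      unfolding twist_frame[OF s(1) that(2) l(1) that(3), symmetric] by (simp add: mscale_mult_right mscale_mscale)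
    finally show ?thesis using frame_1_unit(1)[OF G_bundleD(3)[OF N n(1) that(4)]] Phi_eq[OF that(1)] by simp
  qed
  have "\<forall>\<^sub>F y in nhds x. induced_section FF \<Psi> y ** h y = t y ** ?m y"
    using eventually_nhds_in_open[OF W_open x] G_bundle_near[OF S s(1) s(2)]
      G_bundle_near[OF L l(1) l(2)] G_bundle_near[OF N n(1) n(2)]
    by eventually_elim (rule fr)
  from cov_at_matrix[OF tc(1) sm this]
  have DT: "dmat T' (\<lambda>y. induced_section FF \<Psi> y ** h y) x v
      = t x ** (mderiv M ?m x v + (\<Omega> + mscale (\<theta> - trace a / 2) (mat 1)) ** ?m x)"
    by (simp add: tc(2) ce \<Omega>_def)
  have DB: "induced_section FF \<Psi> x ** dmat BF' h x v = t x ** ?m x ** (a - mscale (trace a / 2) (mat 1))"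
    unfolding dmat_frame[OF ring_frame(1)[OF h n]] ch by (simp add: matrix_mul_assoc fr[OF x s(2) l(2) n(2)])
  have "mderiv M ?m x v + (\<Omega> + mscale (\<theta> - trace a / 2) (mat 1)) ** ?m x - ?m x ** (a - mscale (trace a / 2) (mat 1))
      = twist_deriv s l ?f x v"
  proof -
    have "mscale (\<theta> - trace a / 2) z = mscale \<theta> z - mscale (trace a / 2) z" for z :: "complex^2^2"
      by (simp add: vec_eq_iff mscale_nth algebra_simps)
    then show ?thesis
      by (simp add: twist_deriv_def a_def[symmetric] \<theta>_def[symmetric] \<Omega>_def[symmetric] matrix_mult_add_left
          matrix_mult_diff_left matrix_mult_diff_right mscale_mult_left mscale_mult_right)
  qed
  then have "dmat T' (\<lambda>y. induced_section FF \<Psi> y ** h y) x v - induced_section FF \<Psi> x ** dmat BF' h x v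
      = t x ** twist_deriv s l ?f x v"
    unfolding DT DB by (simp only: matrix_mul_assoc[symmetric] matrix_mult_diff_right[symmetric])
  then show ?thesis
    by (simp add: hom_conn_dmat T'_def[symmetric] h_def[symmetric] t_def e11 mscale_mult_left)
qed

text \<open>The Clifford sum has the same matrices as that of \<Psi> restricted to F, which
  \<open>dirac_frame\<close> shows to vanish; the algebraic equation concerns the very same
  matrix.\<close>

lemma Phi_solution: "solution M W RR BF' L' A' (induced_section FF \<Psi>)"
  unfolding solution_def
proof (intro conjI ballI)
  show "smooth_hom M W RR (tensor_line \<S> L') (induced_section FF \<Psi>)" by (rule Phi_smooth_hom)
  fix x assume x: "x \<in> W"
  show "mu (induced_section FF \<Psi> x) = 0" using sol by (simp add: Phi_eq[OF x] solution_def)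
  obtain V s \<epsilon> where s: "spin_frame_at M x = (s, \<epsilon>)" "(V, s, \<epsilon>) \<in> spin_frames M" "x \<in> V" "(V, s) \<in> \<S>"
    by (rule spin_frame_atE)
  obtain U l where l: "(U, l) \<in> \<L>" "x \<in> U" using G_bundle_frame_ex[OF L] by blast
  obtain V' n where n: "(V', n) \<in> \<N>" "x \<in> V'" by (rule G_bundle_frame_ex[OF N x])
  define h where "h = frame_at RR x"
  obtain Q where h: "(Q, h) \<in> RR" "x \<in> Q" using frame_atE[OF RR_bundle x] unfolding h_def .
  let ?f = "\<lambda>y. mscale (n y $ 1 $ 1) (h y)"
  have f: "(Q \<inter> V', ?f) \<in> FF" "x \<in> Q \<inter> V'" using RR_FF[OF h(1) n(1)] h n by auto
  let ?R = "\<lambda>i. twist_deriv s l ?f x (column i (\<epsilon> x))"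
  let ?H = "\<lambda>i. hom_conn RR BF' (tensor_conn L' (spin_conn M) A') (induced_section FF \<Psi>) x (column i (\<epsilon> x))"
  let ?c = "cnj (n x $ 1 $ 1) * l x $ 1 $ 1"
  have "clifford M x (column i (\<epsilon> x)) ** ?H i = mscale ?c (s x ** (gam i ** ?R i) ** adj (h x))" for i
  proof -
    have "clifford M x (column i (\<epsilon> x)) ** ?H i
      = mscale ?c (s x ** gam i ** (adj (s x) ** s x) ** ?R i ** adj (h x))"
      unfolding hom_conn_RR[OF x s(1,4,3) l n] clifford_frame[OF s(1-3)] h_def[symmetric]
      by (simp add: mscale_mult_right matrix_mul_assoc)
    then show ?thesis using G_bundleD(3)[OF S s(4,3)] by (simp add: matrix_mul_assoc)
  qed
  then have "(\<Sum>i\<in>UNIV. clifford M x (column i (\<epsilon> x)) ** ?H i) = mscale ?c (s x ** (\<Sum>i\<in>UNIV. gam i ** ?R i) ** adj (h x))"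
    by (simp add: matrix_sum_left matrix_sum_right mscale_sum)
  then show "dirac M RR BF' L' A' (induced_section FF \<Psi>) x = 0"
    by (simp add: dirac_def s(1) dirac_frame[OF s(1-3) l f])
qed

end

text \<open>Existence of a root and the claims about a root are separate: the latter hold for every
  root, not merely for the one obtained from L. The norm of \<Phi> extends by that of \<Psi>, which
  is continuous because its square is twice the smooth function \<open>h2\<close>.\<close>

theorem propositionA3:
  fixes M :: "'m::t2_space spin_manifold"
    and \<E> :: "('m, 'n::finite, 'n) frames" and B :: "('m, 'n) conn"
    and \<L> :: "('m, 1, 1) frames" and A :: "('m, 1) conn"
    and \<Psi> :: "'m \<Rightarrow> complex^'n^2"
  assumes "closed_spin_manifold M"
    and "G_bundle M UNIV SU_group \<E>" and "connection M su_alg \<E> B"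
    and "G_bundle M UNIV U_group \<L>" and "connection M u_alg \<L> A"
    and "solution M UNIV \<E> B \<L> A \<Psi>"
  shows
    "let Z = {x. \<Psi> x = 0};
         W = - Z;
         F = (\<lambda>x. perp {v. \<Psi> x *v v = 0});
         \<F> = (unitary_frames M W (bundle_restrict W \<E>) F :: ('m, 2, 'n) frames);
         BF = proj_conn \<F> B;
         \<K> = det_bundle \<F>;
         BK = det_conn M \<F> BF
     in is_subbundle TYPE(2) M W (bundle_restrict W \<E>) F \<and>
        (\<exists>\<N> \<iota>. square_root M W \<K> \<N> \<iota>) \<and>
        (\<forall>\<N> \<iota>. square_root M W \<K> \<N> \<iota> \<longrightarrow>
          (let \<N>' = dual_line \<N>;
               BN' = dual_conn (sqrt_conn M \<N> \<iota> BK);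
               \<F>' = ring_bundle M W \<F> \<N> \<iota>;
               BF' = tensor_conn \<N>' BF BN';
               \<L>' = tensor_line (bundle_restrict W \<L>) \<N>';
               A' = tensor_conn \<N>' A BN';
               \<Phi> = induced_section \<F> \<Psi>
           in G_bundle M W SU_group \<F>' \<and> connection M su_alg \<F>' BF' \<and>
              G_bundle M W U_group \<L>' \<and> connection M u_alg \<L>' A' \<and>
              solution M W \<F>' BF' \<L>' A' \<Phi> \<and>
              (\<forall>x\<in>W. norm (\<Phi> x) = norm (\<Psi> x)) \<and>
              (\<exists>h :: 'm \<Rightarrow> real. continuous_on UNIV h \<and> (\<forall>x\<in>W. h x = norm (\<Phi> x)) \<and> Z = {x. h x = 0}) \<and>
              flat_conn M W \<L>' A' \<and>
              holonomies M W \<L>' A' \<subseteq> {1, -1}))"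
proof -
  interpret solution_setup M \<E> B \<L> A \<Psi> using assms by unfold_locales
  have root: "G_bundle M W SU_group RR' \<and> connection M su_alg RR' BR' \<and>
      G_bundle M W U_group L' \<and> connection M u_alg L' A' \<and>
      solution M W RR' BR' L' A' (induced_section FF \<Psi>) \<and>
      (\<forall>x\<in>W. norm (induced_section FF \<Psi> x) = norm (\<Psi> x)) \<and>
      (\<exists>h :: 'm \<Rightarrow> real. continuous_on UNIV h \<and> (\<forall>x\<in>W. h x = norm (induced_section FF \<Psi> x)) \<and> {x. \<Psi> x = 0} = {x. h x = 0}) \<and>
      flat_conn M W L' A' \<and> holonomies M W L' A' \<subseteq> {1, -1}"
    if "square_root M W KK \<N> \<iota>" and "RR' = ring_bundle M W FF \<N> \<iota>"
      and "BR' = tensor_conn (dual_line \<N>) BF (dual_conn (sqrt_conn M \<N> \<iota> BK))"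
      and "L' = tensor_line (bundle_restrict W \<L>) (dual_line \<N>)"
      and "A' = tensor_conn (dual_line \<N>) A (dual_conn (sqrt_conn M \<N> \<iota> BK))" for \<N> \<iota> RR' BR' L' A'
  proof -
    interpret R: root_setup M \<E> B \<L> A \<Psi> \<N> \<iota> using that(1) by unfold_locales
    have eqs: "RR' = R.RR" "BR' = R.BF'" "L' = R.L'" "A' = R.A'"
      using that by (simp_all add: R.RR_def R.BF'_def R.L'_def R.A'_def R.N'_def R.BN'_def R.SN_def)
    have "\<exists>h :: 'm \<Rightarrow> real. continuous_on UNIV h \<and> (\<forall>x\<in>W. h x = norm (induced_section FF \<Psi> x)) \<and> {x. \<Psi> x = 0} = {x. h x = 0}"
      using cont_norm_Psi R.Phi_eq by (intro exI[of _ "\<lambda>x. norm (\<Psi> x)"]) simp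
    then show ?thesis
      unfolding eqs
      using R.RR_bundle R.ring_connection R.L'_bundle R.line_connection R.Phi_solution R.Phi_eq R.line_flat R.line_holonomies
      by simp
  qed
  show ?thesis
    unfolding Let_def W_def[symmetric] F_def[symmetric] FF_def[symmetric] BF_def[symmetric] KK_def[symmetric] BK_def[symmetric]
  proof (rule conjI[OF subbundle conjI])
    show "\<exists>\<N> \<iota>. square_root M W KK \<N> \<iota>" by (intro exI, rule square_root_exists)
  qed (intro allI impI, rule root[OF _ refl refl refl refl], assumption)
qed

end
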